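(* Suppose that $X$ is an infinite-dimensional Banach space and $Y$ is an affinely independent finite subset of $\ell_2$. Then $Y$, with the metric inherited from $\ell_2$, admits an isometric embedding into $X$, i.e. there is a map $f: Y \to X$ with $\|f(y)-f(y')\|_X = \|y-y'\|_2$ for all $y,y' \in Y$.
   Context: $\ell_2$ is the Hilbert space of real square-summable sequences with its usual norm $\|\cdot\|_2$. Isometric embeddings are distance-preserving maps; they are not assumed to be linear or affine. *)

theory Defs
  imports "HOL-Analysis.Analysis"
begin

text \<open>The Hilbert space of real square-summable sequences.\<close>

typedef ell2 = "{x :: nat \<Rightarrow> real. summable (\<lambda>i. (x i)\<^sup>2)}"
  morphisms ell2_nth Abs_ell2
  by (rule exI[of _ "\<lambda>_. 0"]) simp

setup_lifting type_definition_ell2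

lemma summable_ell2_nth_power2: "summable (\<lambda>i. (ell2_nth x i)\<^sup>2)"
  using ell2_nth[of x] by simp

lemma summable_mult_of_summable_power2:
  fixes x y :: "nat \<Rightarrow> real"
  assumes "summable (\<lambda>i. (x i)\<^sup>2)" "summable (\<lambda>i. (y i)\<^sup>2)"
  shows "summable (\<lambda>i. x i * y i)"
proof (rule summable_comparison_test')
  show "summable (\<lambda>i. (x i)\<^sup>2 + (y i)\<^sup>2)"
    using assms by (rule summable_add)
  show "norm (x i * y i) \<le> (x i)\<^sup>2 + (y i)\<^sup>2" if "i \<ge> 0" for i
  proof -
    have "2 * (\<bar>x i\<bar> * \<bar>y i\<bar>) \<le> (x i)\<^sup>2 + (y i)\<^sup>2"
      using sum_squares_bound[of "\<bar>x i\<bar>" "\<bar>y i\<bar>"] by (simp add: mult.assoc)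
    moreover have "0 \<le> \<bar>x i\<bar> * \<bar>y i\<bar>" by simp
    ultimately show ?thesis unfolding real_norm_def abs_mult by linarith
  qed
qed

lemma summable_ell2_nth_mult: "summable (\<lambda>i. ell2_nth x i * ell2_nth y i)"
  by (intro summable_mult_of_summable_power2 summable_ell2_nth_power2)

instantiation ell2 :: real_vector
begin

lift_definition zero_ell2 :: ell2 is "\<lambda>_. 0" by simp

lift_definition plus_ell2 :: "ell2 \<Rightarrow> ell2 \<Rightarrow> ell2" is "\<lambda>x y i. x i + y i"
proof -
  fix x y :: "nat \<Rightarrow> real"
  assume "summable (\<lambda>i. (x i)\<^sup>2)" "summable (\<lambda>i. (y i)\<^sup>2)"
  then have "summable (\<lambda>i. (x i)\<^sup>2 + (y i)\<^sup>2 + 2 * (x i * y i))"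
    by (intro summable_add summable_mult summable_mult_of_summable_power2)
  then show "summable (\<lambda>i. (x i + y i)\<^sup>2)"
    by (simp add: power2_sum mult.assoc)
qed

lift_definition uminus_ell2 :: "ell2 \<Rightarrow> ell2" is "\<lambda>x i. - x i" by simp

lift_definition minus_ell2 :: "ell2 \<Rightarrow> ell2 \<Rightarrow> ell2" is "\<lambda>x y i. x i - y i"
proof -
  fix x y :: "nat \<Rightarrow> real"
  assume "summable (\<lambda>i. (x i)\<^sup>2)" "summable (\<lambda>i. (y i)\<^sup>2)"
  then have "summable (\<lambda>i. (x i)\<^sup>2 + (y i)\<^sup>2 - 2 * (x i * y i))"
    by (intro summable_add summable_diff summable_mult summable_mult_of_summable_power2)
  then show "summable (\<lambda>i. (x i - y i)\<^sup>2)"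
    by (simp add: power2_diff mult.assoc)
qed

lift_definition scaleR_ell2 :: "real \<Rightarrow> ell2 \<Rightarrow> ell2" is "\<lambda>c x i. c * x i"
  by (simp add: power_mult_distrib summable_mult)

instance
  by standard (transfer; simp add: fun_eq_iff algebra_simps)+

end

instantiation ell2 :: real_inner
begin

definition inner_ell2 :: "ell2 \<Rightarrow> ell2 \<Rightarrow> real"
  where "inner_ell2 x y = (\<Sum>i. ell2_nth x i * ell2_nth y i)"

definition norm_ell2 :: "ell2 \<Rightarrow> real"
  where "norm_ell2 x = sqrt (\<Sum>i. (ell2_nth x i)\<^sup>2)"

definition dist_ell2 :: "ell2 \<Rightarrow> ell2 \<Rightarrow> real"
  where "dist_ell2 x y = norm (x - y)"

definition sgn_ell2 :: "ell2 \<Rightarrow> ell2"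
  where "sgn_ell2 x = x /\<^sub>R norm x"

definition uniformity_ell2 :: "(ell2 \<times> ell2) filter"
  where "uniformity_ell2 = (INF e\<in>{0<..}. principal {(x, y). dist x y < e})"

definition open_ell2 :: "ell2 set \<Rightarrow> bool"
  where "open_ell2 U \<longleftrightarrow> (\<forall>x\<in>U. eventually (\<lambda>(x', y). x' = x \<longrightarrow> y \<in> U) uniformity)"

instance
proof
  fix x y z :: ell2 and r :: real
  show "dist x y = norm (x - y)" by (rule dist_ell2_def)
  show "sgn x = x /\<^sub>R norm x" by (rule sgn_ell2_def)
  show "uniformity = (INF e\<in>{0<..}. principal {(x, y :: ell2). dist x y < e})"
    by (rule uniformity_ell2_def)
  show "open U \<longleftrightarrow> (\<forall>x\<in>U. eventually (\<lambda>(x', y). x' = x \<longrightarrow> y \<in> U) uniformity)"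
    for U :: "ell2 set" by (rule open_ell2_def)
  show "inner x y = inner y x"
    by (simp add: inner_ell2_def mult.commute)
  show "inner (x + y) z = inner x z + inner y z"
    by (simp add: inner_ell2_def plus_ell2.rep_eq distrib_right suminf_add summable_ell2_nth_mult)
  show "inner (r *\<^sub>R x) y = r * inner x y"
    by (simp add: inner_ell2_def scaleR_ell2.rep_eq mult.assoc suminf_mult summable_ell2_nth_mult)
  show "0 \<le> inner x x"
    unfolding inner_ell2_def by (intro suminf_nonneg summable_ell2_nth_mult) simp
  have "inner x x = 0 \<longleftrightarrow> (\<forall>i. ell2_nth x i * ell2_nth x i = 0)"
    unfolding inner_ell2_def by (intro suminf_eq_zero_iff summable_ell2_nth_mult) simp
  also have "\<dots> \<longleftrightarrow> x = 0"
    by (simp add: ell2_nth_inject[symmetric] zero_ell2.rep_eq fun_eq_iff)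
  finally show "inner x x = 0 \<longleftrightarrow> x = 0" .
  show "norm x = sqrt (inner x x)"
    by (simp add: norm_ell2_def inner_ell2_def power2_eq_square)
qed

end

lemma abs_ell2_nth_le_norm: "\<bar>ell2_nth x i\<bar> \<le> norm x"
proof -
  have "(ell2_nth x i)\<^sup>2 \<le> (\<Sum>i. (ell2_nth x i)\<^sup>2)"
    using sum_le_suminf[OF summable_ell2_nth_power2, of "{i}" x] by simp
  then have "sqrt ((ell2_nth x i)\<^sup>2) \<le> norm x"
    unfolding norm_ell2_def by (rule real_sqrt_le_mono)
  then show ?thesis by simp
qed

lemma sum_power2_ell2_nth_le: "(\<Sum>i<n. (ell2_nth x i)\<^sup>2) \<le> (norm x)\<^sup>2"
proof -
  have "(\<Sum>i<n. (ell2_nth x i)\<^sup>2) \<le> (\<Sum>i. (ell2_nth x i)\<^sup>2)"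
    by (rule sum_le_suminf[OF summable_ell2_nth_power2]) auto
  then show ?thesis
    by (simp add: norm_ell2_def suminf_nonneg summable_ell2_nth_power2)
qed

instance ell2 :: banach
proof
  fix X :: "nat \<Rightarrow> ell2"
  assume X: "Cauchy X"
  define l where "l i = lim (\<lambda>n. ell2_nth (X n) i)" for i
  have l: "(\<lambda>n. ell2_nth (X n) i) \<longlonglongrightarrow> l i" for i
  proof -
    have "Cauchy (\<lambda>n. ell2_nth (X n) i)"
    proof (rule CauchyI)
      fix e :: real assume "e > 0"
      then obtain M where M: "\<And>m n. m \<ge> M \<Longrightarrow> n \<ge> M \<Longrightarrow> norm (X m - X n) < e"
        using CauchyD[OF X \<open>e > 0\<close>] by blast
      have "norm (ell2_nth (X m) i - ell2_nth (X n) i) < e" if "m \<ge> M" "n \<ge> M" for m n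
        using M[OF that] abs_ell2_nth_le_norm[of "X m - X n" i]
        by (simp add: minus_ell2.rep_eq)
      then show "\<exists>M. \<forall>m\<ge>M. \<forall>n\<ge>M. norm (ell2_nth (X m) i - ell2_nth (X n) i) < e"
        by blast
    qed
    then show ?thesis
      unfolding l_def using Cauchy_convergent_iff convergent_LIMSEQ_iff by blast
  qed
  have tail: "\<exists>M. \<forall>n\<ge>M. \<forall>k. (\<Sum>i<k. (ell2_nth (X n) i - l i)\<^sup>2) \<le> e\<^sup>2" if e: "e > 0" for e
  proof -
    obtain M where M: "\<And>m n. m \<ge> M \<Longrightarrow> n \<ge> M \<Longrightarrow> norm (X m - X n) < e"
      using CauchyD[OF X e] by blast
    have "(\<Sum>i<k. (ell2_nth (X n) i - l i)\<^sup>2) \<le> e\<^sup>2" if n: "n \<ge> M" for n k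
    proof (rule LIMSEQ_le_const2)
      show "(\<lambda>m. \<Sum>i<k. (ell2_nth (X n) i - ell2_nth (X m) i)\<^sup>2)
              \<longlonglongrightarrow> (\<Sum>i<k. (ell2_nth (X n) i - l i)\<^sup>2)"
        by (intro tendsto_intros l)
      have "(\<Sum>i<k. (ell2_nth (X n) i - ell2_nth (X m) i)\<^sup>2) \<le> e\<^sup>2" if "m \<ge> M" for m
      proof -
        have "(\<Sum>i<k. (ell2_nth (X n) i - ell2_nth (X m) i)\<^sup>2) \<le> (norm (X n - X m))\<^sup>2"
          using sum_power2_ell2_nth_le[where x = "X n - X m" and n = k]
          by (simp add: minus_ell2.rep_eq)
        also have "\<dots> \<le> e\<^sup>2"
          using M[OF n that] by (intro power_mono) auto
        finally show ?thesis .
      qed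
      then show "\<exists>N. \<forall>m\<ge>N. (\<Sum>i<k. (ell2_nth (X n) i - ell2_nth (X m) i)\<^sup>2) \<le> e\<^sup>2"
        by blast
    qed
    then show ?thesis by blast
  qed
  have diff_summable: "summable (\<lambda>i. (ell2_nth (X n) i - l i)\<^sup>2)"
    if "\<forall>k. (\<Sum>i<k. (ell2_nth (X n) i - l i)\<^sup>2) \<le> e" for n e
    by (rule summableI_nonneg_bounded[where x = e]) (use that in auto)
  obtain N where N: "\<forall>k. (\<Sum>i<k. (ell2_nth (X N) i - l i)\<^sup>2) \<le> 1\<^sup>2"
    using tail[of 1] by auto
  define d where "d = Abs_ell2 (\<lambda>i. ell2_nth (X N) i - l i)"
  have d: "ell2_nth d = (\<lambda>i. ell2_nth (X N) i - l i)"
    unfolding d_def using diff_summable[OF N] by (simp add: Abs_ell2_inverse)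
  define L where "L = X N - d"
  have L: "ell2_nth L i = l i" for i
    by (simp add: L_def minus_ell2.rep_eq d)
  have "X \<longlonglongrightarrow> L"
  proof (rule LIMSEQ_I)
    fix r :: real assume "r > 0"
    then obtain M where M: "\<forall>n\<ge>M. \<forall>k. (\<Sum>i<k. (ell2_nth (X n) i - l i)\<^sup>2) \<le> (r / 2)\<^sup>2"
      using tail[of "r / 2"] by auto
    have "norm (X n - L) < r" if "n \<ge> M" for n
    proof -
      have "(\<Sum>i. (ell2_nth (X n - L) i)\<^sup>2) \<le> (r / 2)\<^sup>2"
        using M that by (intro suminf_le_const summable_ell2_nth_power2)
          (simp add: minus_ell2.rep_eq L)
      then have "norm (X n - L) \<le> sqrt ((r / 2)\<^sup>2)"
        unfolding norm_ell2_def by (rule real_sqrt_le_mono)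
      then show ?thesis using \<open>r > 0\<close> by simp
    qed
    then show "\<exists>M. \<forall>n\<ge>M. norm (X n - L) < r" by blast
  qed
  then show "convergent X" by (rule convergentI)
qed

end

theory Submission
  imports Defs "HOL-Probability.Probability" "HOL-Real_Asymp.Real_Asymp"
begin

text \<open>By Dvoretzky's theorem the target space contains, for every \<open>\<epsilon>\<close>, a linear \<open>\<epsilon>\<close>-isometric copy of the
  span of \<open>Y\<close>. Affine independence allows one to move the points of \<open>Y\<close> inside their span so that all squared
  distances change independently, by amounts \<open>U a b\<close> to first order. The images under the
  \<open>\<epsilon>\<close>-isometry then have squared distances within a small error of the perturbed ones, and the
  Poincare--Miranda theorem on the cube of all \<open>U\<close> yields a perturbation for which they are exactly the original
  distances.

  Dvoretzky's theorem is obtained from Gaussian matrices. A basic sequence (Mazur) with almost monotone projections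
  and a greedy choice give vectors \<open>y l\<close> of norm at least \<open>1 / 2\<close> with upper Euclidean estimates
  (Dvoretzky--Rogers). For Gaussian \<open>g\<close> the norm of \<open>\<Sum>l. g l *\<^sub>R y l\<close> has variance bounded independently of
  the number of vectors, while it is typically as large as the largest \<open>\<bar>g l\<bar> / 2\<close>. Hence after
  normalisation it concentrates around \<open>1\<close>, simultaneously for finitely many directions.\<close>

subsection \<open>Norming functionals and basic sequences\<close>

text \<open>The obstacle is that the norm of the target need not be differentiable, so an inverse
  function theorem cannot correct the approximate distances of a Dvoretzky embedding.
  Poincare-Miranda asks only for continuity and for signs on opposite faces. This dictates the order
  of choices: first the size \<open>r\<close> of the perturbation, so small that its quadratic
  effect on squared distances is at most \<open>r / 2\<close>; then the distortion, costing at most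
  another \<open>r / 2\<close>. On a face where the perturbation is \<open>r\<close> or
  \<open>- r\<close> the sign is then forced. The same lack of smoothness makes the concentration
  argument work with subgradients, which come from a Hahn-Banach extension over finitely many
  vectors. A variance bound with Chebyshev's inequality replaces exponential concentration: the
  number of directions depends only on the dimension and the distortion and is fixed before the
  number \<open>k\<close> of vectors \<open>y l\<close>, while the typical norm exceeds every bound
  as \<open>k\<close> grows. No rate of growth in \<open>k\<close> enters.\<close>

lemma homogeneous_system_nontrivial:
  fixes W :: "('i \<Rightarrow> real) set"
  assumes "finite W" "finite S" "card W < card S"
  shows "\<exists>c. (\<exists>i\<in>S. c i \<noteq> 0) \<and> (\<forall>w\<in>W. (\<Sum>i\<in>S. w i * c i) = 0)"
proof -
  have gen: "\<exists>c. (\<exists>i\<in>S. c i \<noteq> 0) \<and> (\<forall>j<m. (\<Sum>i\<in>S. A j i * c i) = 0)"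
    if "finite S" "m < card S" for m :: nat and A :: "nat \<Rightarrow> 'i \<Rightarrow> real" and S
    using that
  proof (induction m arbitrary: A S)
    case 0
    then obtain i where "i \<in> S" by (metis card.empty ex_in_conv less_irrefl)
    then show ?case by (intro exI[of _ "\<lambda>_. 1"]) auto
  next
    case (Suc m)
    show ?case
    proof (cases "\<forall>i\<in>S. A m i = 0")
      case True
      with Suc.IH[OF Suc.prems(1), of A] Suc.prems(2) show ?thesis
        by (auto simp: less_Suc_eq)
    next
      case False
      then obtain p where p: "p \<in> S" "A m p \<noteq> 0" by blast
      \<comment> \<open>Gaussian elimination with pivot \<open>p\<close>: row \<open>m\<close>
        clears \<open>p\<close> from the other rows, the induction hypothesis solves those on
        \<open>?S\<close>, and row \<open>m\<close> then determines the value at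
        \<open>p\<close>.\<close>
      let ?S = "S - {p}"
      have "m < card ?S" using Suc.prems p by simp
      then obtain c where c: "\<exists>i\<in>?S. c i \<noteq> 0" "\<And>j. j < m \<Longrightarrow> (\<Sum>i\<in>?S. (A j i - A j p / A m p * A m i) * c i) = 0"
        using Suc.IH[of ?S "\<lambda>j i. A j i - A j p / A m p * A m i"] Suc.prems(1) by auto
      define d where "d = c(p := - (\<Sum>i\<in>?S. A m i * c i) / A m p)"
      have split: "(\<Sum>i\<in>S. A j i * d i) = A j p * d p + (\<Sum>i\<in>?S. A j i * c i)" for j
        using p Suc.prems(1) by (subst sum.remove[of S p]) (auto simp: d_def intro!: sum.cong)
      have "(\<Sum>i\<in>S. A j i * d i) = 0" if "j < Suc m" for j
      proof (cases "j = m")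
        case True
        show ?thesis unfolding split True using p by (simp add: d_def)
      next
        case False
        with that have "j < m" by simp
        from c(2)[OF this] have "(\<Sum>i\<in>?S. A j i * c i) - A j p / A m p * (\<Sum>i\<in>?S. A m i * c i) = 0"
          by (simp add: sum_subtractf left_diff_distrib sum_distrib_left mult.assoc)
        then show ?thesis unfolding split by (simp add: d_def)
      qed
      moreover have "\<exists>i\<in>S. d i \<noteq> 0" using c(1) by (auto simp: d_def)
      ultimately show ?thesis by blast
    qed
  qed
  obtain f where f: "bij_betw f {..<card W} W"
    using ex_bij_betw_nat_finite[OF assms(1)] unfolding atLeast0LessThan by blast
  obtain c where c: "\<exists>i\<in>S. c i \<noteq> 0" "\<forall>j<card W. (\<Sum>i\<in>S. f j i * c i) = 0"
    using gen[OF assms(2,3), of f] by blast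
  have "(\<Sum>i\<in>S. w i * c i) = 0" if "w \<in> W" for w
  proof -
    from that f obtain j where "j < card W" "w = f j" unfolding bij_betw_def by blast
    with c(2) show ?thesis by blast
  qed
  with c(1) show ?thesis by blast
qed

text \<open>A finite-dimensional Hahn--Banach theorem: the functional sending \<open>y\<close> to \<open>norm y\<close> extends, without
  increasing its norm, to the span of \<open>y\<close> and the vectors \<open>z i\<close>; \<open>s i\<close> is its value at \<open>z i\<close>.\<close>
lemma norming_functional_extension:
  fixes y :: "'a::real_normed_vector" and z :: "'i \<Rightarrow> 'a"
  assumes "finite S"
  shows "\<exists>s. \<forall>t a. t * norm y + (\<Sum>i\<in>S. a i * s i) \<le> norm (t *\<^sub>R y + (\<Sum>i\<in>S. a i *\<^sub>R z i))"
  using assms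
proof (induction S rule: finite_induct)
  case empty
  show ?case by (simp add: mult_right_mono)
next
  case (insert p S)
  then obtain s where s: "\<And>t a. t * norm y + (\<Sum>i\<in>S. a i * s i) \<le> norm (t *\<^sub>R y + (\<Sum>i\<in>S. a i *\<^sub>R z i))"
    by blast
  \<comment> \<open>\<open>f\<close> and \<open>w\<close> take coefficients and not vectors, so
    linear relations among the \<open>z i\<close> raise no question of well-definedness.\<close>
  define f where "f t a = t * norm y + (\<Sum>i\<in>S. a i * s i)" for t a
  define w where "w t a = t *\<^sub>R y + (\<Sum>i\<in>S. a i *\<^sub>R z i)" for t a
  have fw: "f t a \<le> norm (w t a)" for t a unfolding f_def w_def by (rule s)
  have f_add: "f t a + f t' a' = f (t + t') (\<lambda>i. a i + a' i)" for t t' a a'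
    by (simp add: f_def sum.distrib algebra_simps)
  have w_add: "w t a + w t' a' = w (t + t') (\<lambda>i. a i + a' i)" for t t' a a'
    by (simp add: w_def sum.distrib algebra_simps)
  have f_scale: "f (c * t) (\<lambda>i. c * a i) = c * f t a" for c t a
    by (simp add: f_def sum_distrib_left algebra_simps)
  have w_scale: "w (c * t) (\<lambda>i. c * a i) = c *\<^sub>R w t a" for c t a
    by (simp add: w_def scaleR_sum_right algebra_simps)
  \<comment> \<open>The value \<open>\<sigma>\<close> at \<open>z p\<close> must lie above all
    left-hand sides and below all right-hand sides. The triangle inequality makes every lower bound
    at most every upper bound.\<close>
  have key: "f t a - norm (w t a - z p) \<le> norm (w t' a' + z p) - f t' a'" for t t' a a'
  proof -
    have "f t a + f t' a' \<le> norm (w t a + w t' a')" unfolding f_add w_add by (rule fw)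
    also have "\<dots> \<le> norm (w t a - z p) + norm (w t' a' + z p)"
      using norm_triangle_ineq[of "w t a - z p" "w t' a' + z p"] by simp
    finally show ?thesis by simp
  qed
  define L where "L = {f t a - norm (w t a - z p) | t a. True}"
  define \<sigma> where "\<sigma> = Sup L"
  have bdd: "bdd_above L" unfolding L_def by (rule bdd_aboveI[of _ "norm (w 0 (\<lambda>_. 0) + z p) - f 0 (\<lambda>_. 0)"]) (use key in auto)
  have lo: "f t a - norm (w t a - z p) \<le> \<sigma>" for t a
    unfolding \<sigma>_def by (rule cSup_upper[OF _ bdd]) (auto simp: L_def)
  have hi: "\<sigma> \<le> norm (w t a + z p) - f t a" for t a
    unfolding \<sigma>_def by (rule cSup_least) (use key in \<open>auto simp: L_def\<close>)
  have main: "f t a + l * \<sigma> \<le> norm (w t a + l *\<^sub>R z p)" for t a l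
  proof -
    have inv: "c * (inverse c * r) = r" if "0 < c" for c r :: real using that by simp
    consider "l = 0" | "l > 0" | "l < 0" by linarith
    then show ?thesis
    proof cases
      case 1 then show ?thesis using fw by simp
    next
      case 2
      have "f t a = l * f (inverse l * t) (\<lambda>i. inverse l * a i)" "w t a = l *\<^sub>R w (inverse l * t) (\<lambda>i. inverse l * a i)"
        by (simp_all only: f_scale[symmetric] w_scale[symmetric] inv[OF 2])
      moreover have "l * (f (inverse l * t) (\<lambda>i. inverse l * a i) + \<sigma>) \<le> l * norm (w (inverse l * t) (\<lambda>i. inverse l * a i) + z p)"
        using hi[of "inverse l * t" "\<lambda>i. inverse l * a i"] 2 by (intro mult_left_mono) auto
      moreover have "l * norm (w (inverse l * t) (\<lambda>i. inverse l * a i) + z p) = norm (l *\<^sub>R w (inverse l * t) (\<lambda>i. inverse l * a i) + l *\<^sub>R z p)"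
        using 2 by (simp flip: scaleR_add_right)
      ultimately show ?thesis by (simp add: distrib_left)
    next
      case 3
      define m where "m = - l"
      have m: "m > 0" using 3 by (simp add: m_def)
      have "f t a = m * f (inverse m * t) (\<lambda>i. inverse m * a i)" "w t a = m *\<^sub>R w (inverse m * t) (\<lambda>i. inverse m * a i)"
        by (simp_all only: f_scale[symmetric] w_scale[symmetric] inv[OF m])
      moreover have "m * (f (inverse m * t) (\<lambda>i. inverse m * a i) - \<sigma>) \<le> m * norm (w (inverse m * t) (\<lambda>i. inverse m * a i) - z p)"
        using lo[of "inverse m * t" "\<lambda>i. inverse m * a i"] m by (intro mult_left_mono) auto
      moreover have "m * norm (w (inverse m * t) (\<lambda>i. inverse m * a i) - z p) = norm (m *\<^sub>R w (inverse m * t) (\<lambda>i. inverse m * a i) - m *\<^sub>R z p)"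
        using m by (simp flip: scaleR_diff_right)
      ultimately show ?thesis by (simp add: right_diff_distrib m_def)
    qed
  qed
  show ?case
  proof (intro exI[of _ "s(p := \<sigma>)"] allI)
    fix t a
    have "(\<Sum>i\<in>S. a i * (s(p := \<sigma>)) i) = (\<Sum>i\<in>S. a i * s i)"
      using insert.hyps by (intro sum.cong) auto
    then show "t * norm y + (\<Sum>i\<in>insert p S. a i * (s(p := \<sigma>)) i) \<le> norm (t *\<^sub>R y + (\<Sum>i\<in>insert p S. a i *\<^sub>R z i))"
      using main[of t a "a p"] insert.hyps by (simp add: f_def w_def algebra_simps)
  qed
qed

text \<open>Apply the extension with \<open>y\<close> the vector sum itself. Testing it on
  \<open>t = 1\<close> and \<open>- a\<close>, whose vector is zero, forces the functional to attain
  the norm. The coefficients \<open>s\<close> will serve as a subgradient of the norm at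
  \<open>a\<close>.\<close>

lemma exists_norming_coefficients:
  fixes x :: "'i \<Rightarrow> 'a::real_normed_vector"
  assumes "finite S"
  shows "\<exists>s. (\<Sum>i\<in>S. a i * s i) = norm (\<Sum>i\<in>S. a i *\<^sub>R x i) \<and> (\<forall>b. (\<Sum>i\<in>S. b i * s i) \<le> norm (\<Sum>i\<in>S. b i *\<^sub>R x i))"
proof -
  obtain s where s: "\<And>t b. t * norm (\<Sum>i\<in>S. a i *\<^sub>R x i) + (\<Sum>i\<in>S. b i * s i) \<le> norm (t *\<^sub>R (\<Sum>i\<in>S. a i *\<^sub>R x i) + (\<Sum>i\<in>S. b i *\<^sub>R x i))"
    using norming_functional_extension[OF assms] by metis
  have "(\<Sum>i\<in>S. b i * s i) \<le> norm (\<Sum>i\<in>S. b i *\<^sub>R x i)" for b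
    using s[of 0 b] by simp
  moreover have "norm (\<Sum>i\<in>S. a i *\<^sub>R x i) \<le> (\<Sum>i\<in>S. a i * s i)"
    using s[of 1 "\<lambda>i. - a i"] by (simp add: sum_negf)
  ultimately show ?thesis by (intro exI[of _ s]) (auto intro: antisym)
qed

lemma exists_independent_card:
  assumes inf: "\<not> (\<exists>B :: 'a::real_vector set. finite B \<and> span B = UNIV)"
  shows "\<exists>B :: 'a set. finite B \<and> independent B \<and> card B = n"
proof (induction n)
  case 0
  show ?case by (intro exI[of _ "{}"]) (simp add: independent_empty)
next
  case (Suc n)
  then obtain B :: "'a set" where B: "finite B" "independent B" "card B = n" by blast
  with inf obtain x where x: "x \<notin> span B" by auto
  then have "x \<notin> B" using span_base by blast
  with B x show ?case by (intro exI[of _ "insert x B"]) (simp add: independent_insert)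
qed

text \<open>Each \<open>y\<close> has a norming functional on the span of \<open>y\<close> and the
  same \<open>card Y + 1\<close> independent vectors; by dimension counting all of these vanish at a
  common nonzero \<open>u\<close>. Along \<open>u\<close> the functional of \<open>y\<close> keeps
  the value \<open>norm y\<close>, so the norm cannot drop.\<close>

lemma exists_Birkhoff_orthogonal_unit:
  fixes Y :: "'a::real_normed_vector set"
  assumes inf: "\<not> (\<exists>B :: 'a set. finite B \<and> span B = UNIV)" and Y: "finite Y"
  shows "\<exists>v. norm v = 1 \<and> (\<forall>y\<in>Y. \<forall>l. norm y \<le> norm (y + l *\<^sub>R v))"
proof -
  obtain B :: "'a set" where B: "finite B" "independent B" "card B = Suc (card Y)"
    using exists_independent_card[OF inf] by blast
  obtain s where s: "\<And>y t a. t * norm y + (\<Sum>b\<in>B. a b * s y b) \<le> norm (t *\<^sub>R y + (\<Sum>b\<in>B. a b *\<^sub>R b))"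
    using norming_functional_extension[OF B(1), of _ "\<lambda>b. b"] by metis
  have "card (s ` Y) < card B" using card_image_le[OF Y, of s] B(3) by simp
  then obtain c where c: "\<exists>b\<in>B. c b \<noteq> 0" "\<And>y. y \<in> Y \<Longrightarrow> (\<Sum>b\<in>B. s y b * c b) = 0"
    using homogeneous_system_nontrivial[of "s ` Y" B] B(1) Y by auto
  define u where "u = (\<Sum>b\<in>B. c b *\<^sub>R b)"
  have u: "u \<noteq> 0" using c(1) B independentD[OF B(2,1) subset_refl, of c] by (auto simp: u_def)
  have le: "norm y \<le> norm (y + l *\<^sub>R u)" if "y \<in> Y" for y l
  proof -
    have "(\<Sum>b\<in>B. (l * c b) * s y b) = l * (\<Sum>b\<in>B. s y b * c b)"
      by (simp add: sum_distrib_left algebra_simps)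
    with s[of 1 y "\<lambda>b. l * c b"] c(2)[OF that] show ?thesis
      by (simp add: u_def scaleR_sum_right)
  qed
  show ?thesis
  proof (intro exI[of _ "u /\<^sub>R norm u"] conjI ballI allI)
    fix y l assume "y \<in> Y"
    then show "norm y \<le> norm (y + l *\<^sub>R (u /\<^sub>R norm u))" using le[of y "l / norm u"] by (simp add: divide_inverse)
  qed (use u in simp)
qed

section \<open>Almost monotone sequences\<close>

lemma prefix_norm_le:
  fixes x :: "nat \<Rightarrow> 'a::real_normed_vector"
  assumes e: "e \<ge> 0"
    and step: "\<And>n. n < N \<Longrightarrow> norm (\<Sum>i<n. a i *\<^sub>R x i) \<le> (1 + e) * norm (\<Sum>i<Suc n. a i *\<^sub>R x i)"
    and n: "n \<le> N"
  shows "norm (\<Sum>i<n. a i *\<^sub>R x i) \<le> (1 + e) ^ N * norm (\<Sum>i<N. a i *\<^sub>R x i)"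
proof -
  have "norm (\<Sum>i<n. a i *\<^sub>R x i) \<le> (1 + e) ^ (N - n) * norm (\<Sum>i<N. a i *\<^sub>R x i)"
    using n
  proof (induction n rule: inc_induct)
    case base
    show ?case by simp
  next
    case (step m)
    have "norm (\<Sum>i<m. a i *\<^sub>R x i) \<le> (1 + e) * norm (\<Sum>i<Suc m. a i *\<^sub>R x i)"
      using step.hyps by (intro assms(2)) simp
    also have "\<dots> \<le> (1 + e) * ((1 + e) ^ (N - Suc m) * norm (\<Sum>i<N. a i *\<^sub>R x i))"
      using step.IH e by (intro mult_left_mono) auto
    also have "\<dots> = (1 + e) ^ (N - m) * norm (\<Sum>i<N. a i *\<^sub>R x i)"
      using step.hyps by (simp add: Suc_diff_Suc[symmetric])
    finally show ?case .
  qed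
  also have "\<dots> \<le> (1 + e) ^ N * norm (\<Sum>i<N. a i *\<^sub>R x i)"
    using e by (intro mult_right_mono power_increasing) auto
  finally show ?thesis .
qed

text \<open>The \<open>i\<close>-th term is the difference of two consecutive partial sums, which is
  the source of the factor 2.\<close>

lemma abs_coefficient_le:
  fixes x :: "nat \<Rightarrow> 'a::real_normed_vector"
  assumes e: "e \<ge> 0" and unit: "\<And>i. i < N \<Longrightarrow> norm (x i) = 1"
    and step: "\<And>n. n < N \<Longrightarrow> norm (\<Sum>i<n. a i *\<^sub>R x i) \<le> (1 + e) * norm (\<Sum>i<Suc n. a i *\<^sub>R x i)"
    and i: "i < N"
  shows "\<bar>a i\<bar> \<le> 2 * (1 + e) ^ N * norm (\<Sum>i<N. a i *\<^sub>R x i)"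
proof -
  have "\<bar>a i\<bar> = norm ((\<Sum>j<Suc i. a j *\<^sub>R x j) - (\<Sum>j<i. a j *\<^sub>R x j))"
    using unit[OF i] by simp
  also have "\<dots> \<le> norm (\<Sum>j<Suc i. a j *\<^sub>R x j) + norm (\<Sum>j<i. a j *\<^sub>R x j)"
    by (rule norm_triangle_ineq4)
  also have "\<dots> \<le> (1 + e) ^ N * norm (\<Sum>i<N. a i *\<^sub>R x i) + (1 + e) ^ N * norm (\<Sum>i<N. a i *\<^sub>R x i)"
    using i by (intro add_mono prefix_norm_le[OF e step]) auto
  finally show ?thesis by simp
qed

text \<open>Mazur's construction of a basic sequence: the next vector is Birkhoff orthogonal to a fine grid in the
  span of the previous ones.\<close>
lemma exists_almost_monotone_sequence:
  assumes inf: "\<not> (\<exists>B :: 'a::real_normed_vector set. finite B \<and> span B = UNIV)" and e: "e > 0"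
  shows "\<exists>x :: nat \<Rightarrow> 'a. (\<forall>i<N. norm (x i) = 1) \<and>
    (\<forall>n<N. \<forall>a. norm (\<Sum>i<n. a i *\<^sub>R x i) \<le> (1 + e) * norm (\<Sum>i<Suc n. a i *\<^sub>R x i))"
proof (induction N)
  case 0
  show ?case by simp
next
  case (Suc N)
  then obtain x :: "nat \<Rightarrow> 'a" where unit: "\<And>i. i < N \<Longrightarrow> norm (x i) = 1"
    and step: "\<And>n a. n < N \<Longrightarrow> norm (\<Sum>i<n. a i *\<^sub>R x i) \<le> (1 + e) * norm (\<Sum>i<Suc n. a i *\<^sub>R x i)"
    by blast
  \<comment> \<open>\<open>C\<close> bounds the coefficients of all vectors of norm 1, so a finite
    grid suffices. Mesh \<open>1 / q\<close> moves such a vector by at most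
    \<open>e / (2 * (1 + e))\<close>; this error enters twice, and
    \<open>1 - e / (1 + e) = 1 / (1 + e)\<close>.\<close>
  define C where "C = 2 * (1 + e) ^ N"
  have C: "C > 0" using e by (simp add: C_def)
  define q where "q = 2 * (1 + e) * (real N + 1) / e"
  have q: "q > 0" using e by (simp add: q_def add_pos_nonneg)
  define r where "r = \<lceil>q * C\<rceil> + 1"
  define G where "G g = (\<Sum>i<N. (of_int (g i) / q) *\<^sub>R x i)" for g :: "nat \<Rightarrow> int"
  let ?Y = "G ` (PiE {..<N} (\<lambda>_. {-r..r}))"
  have "finite ?Y" by (intro finite_imageI finite_PiE) auto
  then obtain v where v: "norm v = 1" "\<And>y l. y \<in> ?Y \<Longrightarrow> norm y \<le> norm (y + l *\<^sub>R v)"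
    using exists_Birkhoff_orthogonal_unit[OF inf] by metis
  have main1: "1 \<le> (1 + e) * norm ((\<Sum>i<N. a i *\<^sub>R x i) + l *\<^sub>R v)" if y: "norm (\<Sum>i<N. a i *\<^sub>R x i) = 1" for a l
  proof -
    let ?y = "\<Sum>i<N. a i *\<^sub>R x i"
    define g where "g = (\<lambda>i\<in>{..<N}. \<lfloor>q * a i\<rfloor>)"
    have ai: "\<bar>a i\<bar> \<le> C" if "i < N" for i
      using abs_coefficient_le[OF less_imp_le[OF e] unit step that, of a] y by (simp add: C_def)
    have "g \<in> PiE {..<N} (\<lambda>_. {-r..r})"
    proof
      fix i assume "i \<in> {..<N}"
      then have "\<bar>q * a i\<bar> \<le> q * C" using ai[of i] q by (simp add: abs_mult)
      then show "g i \<in> {-r..r}" using \<open>i \<in> {..<N}\<close> by (simp add: g_def r_def) linarith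
    qed (simp add: g_def)
    then have gY: "G g \<in> ?Y" by blast
    have "norm (?y - G g) \<le> (\<Sum>i<N. norm ((a i - of_int (g i) / q) *\<^sub>R x i))"
      unfolding G_def sum_subtractf[symmetric] scaleR_diff_left[symmetric] by (rule norm_sum)
    also have "\<dots> \<le> (\<Sum>i<N. 1 / q)"
    proof (rule sum_mono)
      fix i assume i: "i \<in> {..<N}"
      have "q * \<bar>a i - of_int (g i) / q\<bar> = \<bar>q * (a i - of_int (g i) / q)\<bar>" using q by (simp add: abs_mult)
      also have "\<dots> = \<bar>q * a i - of_int \<lfloor>q * a i\<rfloor>\<bar>" using q i by (simp add: g_def right_diff_distrib)
      also have "\<dots> \<le> 1" by linarith
      finally show "norm ((a i - of_int (g i) / q) *\<^sub>R x i) \<le> 1 / q"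
        using q unit[of i] i by (simp add: field_simps)
    qed
    also have "\<dots> = N / q" by simp
    also have "\<dots> \<le> e / (2 * (1 + e))" using e by (simp add: q_def divide_simps)
    finally have d: "norm (?y - G g) \<le> e / (2 * (1 + e))" .
    have "norm ?y \<le> norm (?y - G g) + norm (G g)" using norm_triangle_ineq[of "?y - G g" "G g"] by simp
    also have "norm (G g) \<le> norm (G g + l *\<^sub>R v)" by (rule v(2)[OF gY])
    also have "\<dots> \<le> norm (?y - G g) + norm (?y + l *\<^sub>R v)"
      using norm_triangle_ineq4[of "?y + l *\<^sub>R v" "?y - G g"] by (simp add: add.commute)
    finally have "1 \<le> 2 * (e / (2 * (1 + e))) + norm (?y + l *\<^sub>R v)" using d y by linarith
    then have "1 / (1 + e) \<le> norm (?y + l *\<^sub>R v)" using e by (simp add: field_simps)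
    then show ?thesis using e by (simp add: divide_le_eq mult.commute)
  qed
  have main: "norm (\<Sum>i<N. a i *\<^sub>R x i) \<le> (1 + e) * norm ((\<Sum>i<N. a i *\<^sub>R x i) + l *\<^sub>R v)" for a l
  proof (cases "norm (\<Sum>i<N. a i *\<^sub>R x i) = 0")
    case True
    then show ?thesis using e by (simp add: True)
  next
    case False
    define m where "m = norm (\<Sum>i<N. a i *\<^sub>R x i)"
    have m: "m > 0" using False by (simp add: m_def)
    have s: "(\<Sum>i<N. (a i / m) *\<^sub>R x i) = (\<Sum>i<N. a i *\<^sub>R x i) /\<^sub>R m"
      by (simp add: scaleR_sum_right divide_inverse mult.commute)
    have "norm (\<Sum>i<N. (a i / m) *\<^sub>R x i) = 1" unfolding s using m by (simp add: m_def)
    note main1[OF this, of "l / m"]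
    moreover define z where "z = (\<Sum>i<N. a i *\<^sub>R x i) + l *\<^sub>R v"
    have "(\<Sum>i<N. (a i / m) *\<^sub>R x i) + (l / m) *\<^sub>R v = z /\<^sub>R m"
      unfolding s z_def by (simp add: scaleR_add_right divide_inverse mult.commute)
    moreover have "norm (z /\<^sub>R m) = norm z / m" using m by (simp add: divide_inverse)
    ultimately have "1 \<le> (1 + e) * (norm z / m)" by simp
    then have "m \<le> (1 + e) * norm z" using m by (simp add: le_divide_eq)
    then show ?thesis by (simp only: m_def z_def)
  qed
  show ?case
  proof (intro exI[of _ "x(N := v)"] conjI allI impI)
    fix i assume "i < Suc N"
    then show "norm ((x(N := v)) i) = 1" using unit v(1) by (auto simp: less_Suc_eq)
  next
    fix n a assume n: "n < Suc N"
    have s: "(\<Sum>i<k. a i *\<^sub>R (x(N := v)) i) = (\<Sum>i<k. a i *\<^sub>R x i)" if "k \<le> N" for k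
      using that by (intro sum.cong) auto
    show "norm (\<Sum>i<n. a i *\<^sub>R (x(N := v)) i) \<le> (1 + e) * norm (\<Sum>i<Suc n. a i *\<^sub>R (x(N := v)) i)"
    proof (cases "n = N")
      case True
      then show ?thesis using main[of a "a N"] s[of N] by simp
    next
      case False
      then show ?thesis using step[of n a] n s[of n] s[of "Suc n"] by simp
    qed
  qed
qed

text \<open>The vectors of an almost monotone sequence are divided by \<open>N\<close>, which
  secures the upper estimate. In the lower one a factor \<open>N\<close> comes from this division,
  another from passing to the sum of absolute coefficients, and the rest from
  \<open>abs_coefficient_le\<close>. The base \<open>1 + e\<close> may be as close to 1 as
  desired.\<close>

lemma exists_embedding_subexponential:
  assumes inf: "\<not> (\<exists>B :: 'a::real_normed_vector set. finite B \<and> span B = UNIV)" and e: "e > 0" and N: "N > 0"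
  shows "\<exists>x :: nat \<Rightarrow> 'a. \<forall>a. norm (\<Sum>i<N. a i *\<^sub>R x i) \<le> sqrt (\<Sum>i<N. (a i)\<^sup>2) \<and>
    sqrt (\<Sum>i<N. (a i)\<^sup>2) \<le> 2 * (real N)\<^sup>2 * (1 + e) ^ N * norm (\<Sum>i<N. a i *\<^sub>R x i)"
proof -
  obtain x :: "nat \<Rightarrow> 'a" where unit: "\<And>i. i < N \<Longrightarrow> norm (x i) = 1"
    and step: "\<And>n a. n < N \<Longrightarrow> norm (\<Sum>i<n. a i *\<^sub>R x i) \<le> (1 + e) * norm (\<Sum>i<Suc n. a i *\<^sub>R x i)"
    using exists_almost_monotone_sequence[OF inf e, of N] by blast
  show ?thesis
  proof (intro exI[of _ "\<lambda>i. x i /\<^sub>R real N"] allI conjI)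
    fix a
    let ?T = "\<Sum>i<N. a i *\<^sub>R (x i /\<^sub>R real N)"
    have T: "?T = (\<Sum>i<N. a i *\<^sub>R x i) /\<^sub>R N" by (simp add: scaleR_sum_right mult.commute)
    have "norm (\<Sum>i<N. a i *\<^sub>R x i) \<le> (\<Sum>i<N. norm (a i *\<^sub>R x i))" by (rule norm_sum)
    also have "\<dots> \<le> (\<Sum>i<N. sqrt (\<Sum>i<N. (a i)\<^sup>2))"
    proof (rule sum_mono)
      fix i assume i: "i \<in> {..<N}"
      then have "(a i)\<^sup>2 \<le> (\<Sum>i<N. (a i)\<^sup>2)" by (intro member_le_sum) auto
      then show "norm (a i *\<^sub>R x i) \<le> sqrt (\<Sum>i<N. (a i)\<^sup>2)"
        using unit i by (simp add: real_le_rsqrt)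
    qed
    finally show "norm ?T \<le> sqrt (\<Sum>i<N. (a i)\<^sup>2)" unfolding T using N by (simp add: field_simps)
    have "sqrt (\<Sum>i<N. (a i)\<^sup>2) \<le> (\<Sum>i<N. \<bar>a i\<bar>)"
      by (fold L2_set_def) (rule L2_set_le_sum_abs)
    also have "\<dots> \<le> (\<Sum>i<N. 2 * (1 + e) ^ N * norm (\<Sum>i<N. a i *\<^sub>R x i))"
      using abs_coefficient_le[OF less_imp_le[OF e] unit step] by (intro sum_mono) auto
    also have "\<dots> = 2 * (real N)\<^sup>2 * (1 + e) ^ N * norm ?T"
      unfolding T using N by (simp add: power2_eq_square)
    finally show "sqrt (\<Sum>i<N. (a i)\<^sup>2) \<le> 2 * (real N)\<^sup>2 * (1 + e) ^ N * norm ?T" .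
  qed
qed

subsection \<open>The Dvoretzky--Rogers lemma\<close>

lemma sum_square_orthonormal:
  fixes u :: "nat \<Rightarrow> nat \<Rightarrow> real"
  assumes on: "\<And>l m. l < k \<Longrightarrow> m < k \<Longrightarrow> (\<Sum>i<N. u l i * u m i) = (if l = m then 1 else 0)"
  shows "(\<Sum>i<N. (\<Sum>l<k. c l * u l i)\<^sup>2) = (\<Sum>l<k. (c l)\<^sup>2)"
proof -
  have "(\<Sum>i<N. (\<Sum>l<k. c l * u l i)\<^sup>2) = (\<Sum>i<N. \<Sum>l<k. \<Sum>m<k. c l * c m * (u l i * u m i))"
    by (simp add: power2_eq_square sum_product algebra_simps)
  also have "\<dots> = (\<Sum>l<k. \<Sum>i<N. \<Sum>m<k. c l * c m * (u l i * u m i))" by (rule sum.swap)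
  also have "\<dots> = (\<Sum>l<k. \<Sum>m<k. \<Sum>i<N. c l * c m * (u l i * u m i))"
    by (intro sum.cong refl sum.swap)
  also have "\<dots> = (\<Sum>l<k. \<Sum>m<k. c l * c m * (\<Sum>i<N. u l i * u m i))" by (simp add: sum_distrib_left)
  also have "\<dots> = (\<Sum>l<k. \<Sum>m<k. if l = m then (c l)\<^sup>2 else 0)"
    by (intro sum.cong refl) (simp add: on power2_eq_square)
  also have "\<dots> = (\<Sum>l<k. (c l)\<^sup>2)" by (intro sum.cong refl) simp
  finally show ?thesis .
qed

text \<open>A greedy choice in the orthogonal complement of \<open>W\<close>: the second alternative is what being unable to
  continue means, \<open>W'\<close> being \<open>W\<close> together with the vectors chosen so far.\<close>
lemma greedy_orthonormal:
  fixes x :: "nat \<Rightarrow> 'a::real_normed_vector" and W :: "(nat \<Rightarrow> real) set"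
  assumes W: "finite W"
  shows "(\<exists>u. (\<forall>l<j. \<forall>m<j. (\<Sum>i<N. u l i * u m i) = (if l = m then 1 else 0))
      \<and> (\<forall>l<j. (\<forall>w\<in>W. (\<Sum>i<N. w i * u l i) = 0) \<and> b / 2 \<le> norm (\<Sum>i<N. u l i *\<^sub>R x i)))
    \<or> (\<exists>W'. finite W' \<and> card W' \<le> card W + j \<and>
      (\<forall>a. (\<forall>w\<in>W'. (\<Sum>i<N. w i * a i) = 0) \<longrightarrow> norm (\<Sum>i<N. a i *\<^sub>R x i) \<le> b / 2 * sqrt (\<Sum>i<N. (a i)\<^sup>2)))"
    (is "(\<exists>u. ?on j u \<and> ?good j u) \<or> ?stuck j")
proof (induction j)
  case 0
  show ?case by simp
next
  case (Suc j)
  then consider "?stuck j" | u where "?on j u" "?good j u" by blast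
  then show ?case
  proof cases
    case 1
    then obtain W' where "finite W'" "card W' \<le> card W + j"
      "\<forall>a. (\<forall>w\<in>W'. (\<Sum>i<N. w i * a i) = 0) \<longrightarrow> norm (\<Sum>i<N. a i *\<^sub>R x i) \<le> b / 2 * sqrt (\<Sum>i<N. (a i)\<^sup>2)"
      by blast
    then have "?stuck (Suc j)" by (intro exI[of _ W']) auto
    then show ?thesis ..
  next
    case 2
    let ?W = "W \<union> u ` {..<j}"
    have fW: "finite ?W" "card ?W \<le> card W + Suc j"
      using W card_Un_le[of W "u ` {..<j}"] card_image_le[of "{..<j}" u] by auto
    show ?thesis
    proof (cases "\<forall>a. (\<forall>w\<in>?W. (\<Sum>i<N. w i * a i) = 0) \<longrightarrow> norm (\<Sum>i<N. a i *\<^sub>R x i) \<le> b / 2 * sqrt (\<Sum>i<N. (a i)\<^sup>2)")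
      case True
      with fW have "?stuck (Suc j)" by blast
      then show ?thesis ..
    next
      case False
      then obtain a where a: "\<And>w. w \<in> ?W \<Longrightarrow> (\<Sum>i<N. w i * a i) = 0"
        "b / 2 * sqrt (\<Sum>i<N. (a i)\<^sup>2) < norm (\<Sum>i<N. a i *\<^sub>R x i)" by (auto simp: not_le)
      define r where "r = sqrt (\<Sum>i<N. (a i)\<^sup>2)"
      have "r \<noteq> 0"
      proof
        assume "r = 0"
        then have "\<forall>i<N. a i = 0" by (simp add: r_def sum_nonneg_eq_0_iff)
        then show False using a(2) \<open>r = 0\<close> by (simp add: r_def)
      qed
      then have r: "r > 0" by (simp add: r_def less_le sum_nonneg)
      have r2: "r\<^sup>2 = (\<Sum>i<N. (a i)\<^sup>2)" by (simp add: r_def sum_nonneg)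
      define v where "v i = a i / r" for i
      define u' where "u' = u(j := v)"
      have vv: "(\<Sum>i<N. v i * v i) = 1"
        using r by (simp add: v_def power2_eq_square[symmetric] power_divide sum_divide_distrib[symmetric] r2[symmetric])
      have wv: "(\<Sum>i<N. w i * v i) = 0" if "w \<in> ?W" for w
        using a(1)[OF that] by (simp add: v_def sum_divide_distrib[symmetric])
      have "?on (Suc j) u'"
      proof (intro allI impI)
        fix l m assume "l < Suc j" "m < Suc j"
        then consider "l < j" "m < j" | "l = j" "m < j" | "l < j" "m = j" | "l = j" "m = j" by linarith
        then show "(\<Sum>i<N. u' l i * u' m i) = (if l = m then 1 else 0)"
        proof cases
          case 1 then show ?thesis using 2(1) by (simp add: u'_def)
        next
          case 2 then show ?thesis using wv[of "u m"] by (simp add: u'_def mult.commute)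
        next
          case 3 then show ?thesis using wv[of "u l"] by (simp add: u'_def)
        next
          case 4 then show ?thesis using vv by (simp add: u'_def)
        qed
      qed
      moreover have "?good (Suc j) u'"
      proof (intro allI impI)
        fix l assume l: "l < Suc j"
        show "(\<forall>w\<in>W. (\<Sum>i<N. w i * u' l i) = 0) \<and> b / 2 \<le> norm (\<Sum>i<N. u' l i *\<^sub>R x i)"
        proof (cases "l = j")
          case True
          have "(\<Sum>i<N. v i *\<^sub>R x i) = (\<Sum>i<N. a i *\<^sub>R x i) /\<^sub>R r"
            by (simp add: v_def scaleR_sum_right divide_inverse mult.commute)
          then have "b / 2 \<le> norm (\<Sum>i<N. v i *\<^sub>R x i)"
            using a(2) r by (simp add: r_def[symmetric] field_simps)
          then show ?thesis using True wv by (simp add: u'_def)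
        next
          case False
          then show ?thesis using 2(2) l by (simp add: u'_def)
        qed
      qed
      ultimately show ?thesis by blast
    qed
  qed
qed

text \<open>Each failure of the greedy choice halves the norm of the embedding \<open>T\<close> at the cost of at most \<open>k\<close> new
  constraints. In dimension \<open>N = p * k + 1\<close> this cannot happen \<open>p\<close> times, because \<open>T\<close> has a
  subexponential lower bound.\<close>
lemma Dvoretzky_Rogers:
  assumes inf: "\<not> (\<exists>B :: 'a::real_normed_vector set. finite B \<and> span B = UNIV)" and k: "k > 0"
  shows "\<exists>y :: nat \<Rightarrow> 'a. (\<forall>a. norm (\<Sum>l<k. a l *\<^sub>R y l) \<le> sqrt (\<Sum>l<k. (a l)\<^sup>2)) \<and> (\<forall>l<k. 1 / 2 \<le> norm (y l))"
    (is ?goal)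
proof -
  \<comment> \<open>\<open>p\<close> is the number of phases: halving gains \<open>2 ^ p\<close>,
    which has to beat the factor in the lower estimate, a polynomial in \<open>p\<close> times
    \<open>(3/2) ^ p\<close>.\<close>
  have "eventually (\<lambda>p. 2 * (real p * real k + 1)\<^sup>2 * 2 * (3/2) ^ p < 2 ^ p) at_top"
    using k by real_asymp
  then obtain p where p: "2 * (real p * real k + 1)\<^sup>2 * 2 * (3/2) ^ p < (2::real) ^ p"
    using eventually_happens'[OF sequentially_bot] by blast
  define N where "N = p * k + 1"
  \<comment> \<open>Taking \<open>e\<close> relative to \<open>k\<close> keeps the loss over one
    phase of \<open>k\<close> dimensions at most \<open>3 / 2\<close>, less than the gain 2 of a
    halving.\<close>
  define e :: real where "e = 1 / (3 * real k)"
  have e: "e > 0" using k by (simp add: e_def)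
  have "(1 + e) ^ k \<le> exp e ^ k" using e exp_ge_add_one_self[of e] by (intro power_mono) auto
  also have "\<dots> = exp (1 / 3)" using k by (simp add: exp_of_nat_mult[symmetric] e_def)
  also have "\<dots> \<le> 1 + 1/3 + (1/3)\<^sup>2" by (rule exp_bound) auto
  also have "\<dots> \<le> 3 / 2" by (simp add: power2_eq_square)
  finally have ek: "(1 + e) ^ k \<le> 3 / 2" .
  have e1: "1 + e \<le> 2" using k by (simp add: e_def)
  have "(1 + e) ^ N = (1 + e) * ((1 + e) ^ k) ^ p" by (simp add: N_def power_mult[symmetric] mult.commute)
  also have "\<dots> \<le> 2 * (3 / 2) ^ p" using e e1 ek by (intro mult_mono power_mono) auto
  finally have "2 * (real N)\<^sup>2 * (1 + e) ^ N \<le> 2 * (real N)\<^sup>2 * (2 * (3 / 2) ^ p)" by (intro mult_left_mono) auto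
  also have "\<dots> < 2 ^ p" using p by (simp add: N_def mult.assoc add.commute)
  finally have small: "2 * (real N)\<^sup>2 * (1 + e) ^ N < 2 ^ p" .
  obtain x :: "nat \<Rightarrow> 'a" where x: "\<And>a. norm (\<Sum>i<N. a i *\<^sub>R x i) \<le> sqrt (\<Sum>i<N. (a i)\<^sup>2)"
    "\<And>a. sqrt (\<Sum>i<N. (a i)\<^sup>2) \<le> 2 * (real N)\<^sup>2 * (1 + e) ^ N * norm (\<Sum>i<N. a i *\<^sub>R x i)"
    using exists_embedding_subexponential[OF inf e, of N] by (auto simp: N_def)
  define bound where "bound W b \<longleftrightarrow> (\<forall>a. (\<forall>w\<in>W. (\<Sum>i<N. w i * a i) = 0) \<longrightarrow>
    norm (\<Sum>i<N. a i *\<^sub>R x i) \<le> b * sqrt (\<Sum>i<N. (a i)\<^sup>2))" for W b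
  have phases: "?goal \<or> (\<exists>W. finite W \<and> card W \<le> r * k \<and> bound W ((1/2) ^ r))" for r
  proof (induction r)
    case 0
    have "bound {} 1" using x(1) by (simp add: bound_def)
    then show ?case by (intro disjI2 exI[of _ "{}"]) simp
  next
    case (Suc r)
    then consider ?goal | W where "finite W" "card W \<le> r * k" "bound W ((1/2) ^ r)" by blast
    then show ?case
    proof cases
      case 1 then show ?thesis ..
    next
      case 2
      define b :: real where "b = (1/2) ^ r"
      have b: "b > 0" by (simp add: b_def)
      consider W' where "finite W'" "card W' \<le> card W + k" "bound W' (b / 2)"
        | u where "\<And>l m. l < k \<Longrightarrow> m < k \<Longrightarrow> (\<Sum>i<N. u l i * u m i) = (if l = m then 1 else 0)"
          "\<And>l w. l < k \<Longrightarrow> w \<in> W \<Longrightarrow> (\<Sum>i<N. w i * u l i) = 0" "\<And>l. l < k \<Longrightarrow> b / 2 \<le> norm (\<Sum>i<N. u l i *\<^sub>R x i)"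
        using greedy_orthonormal[OF 2(1), of k N b x] unfolding bound_def by blast
      then show ?thesis
      proof cases
        case 1
        then have "finite W' \<and> card W' \<le> Suc r * k \<and> bound W' ((1/2) ^ Suc r)" using 2(2) by (simp add: b_def)
        then show ?thesis by blast
      next
        case u: 2
        \<comment> \<open>On the complement of \<open>W\<close> the norm is at most \<open>b\<close>
          times the Euclidean norm, and the chosen unit vectors have images of norm at least
          \<open>b / 2\<close>. Division by \<open>b\<close> gives the constants 1 and
          \<open>1 / 2\<close>.\<close>
        define y where "y l = (\<Sum>i<N. u l i *\<^sub>R x i) /\<^sub>R b" for l
        have "norm (\<Sum>l<k. a l *\<^sub>R y l) \<le> sqrt (\<Sum>l<k. (a l)\<^sup>2)" for a
        proof -
          define c where "c i = (\<Sum>l<k. a l * u l i)" for i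
          have "(\<Sum>l<k. a l *\<^sub>R (\<Sum>i<N. u l i *\<^sub>R x i)) = (\<Sum>l<k. \<Sum>i<N. (a l * u l i) *\<^sub>R x i)"
            by (simp add: scaleR_sum_right)
          also have "\<dots> = (\<Sum>i<N. \<Sum>l<k. (a l * u l i) *\<^sub>R x i)" by (rule sum.swap)
          also have "\<dots> = (\<Sum>i<N. c i *\<^sub>R x i)" by (simp add: c_def scaleR_sum_left)
          finally have y: "(\<Sum>l<k. a l *\<^sub>R y l) = (\<Sum>i<N. c i *\<^sub>R x i) /\<^sub>R b"
            unfolding y_def scaleR_left_commute[of _ "inverse b"] scaleR_sum_right[symmetric] by simp
          have "(\<Sum>i<N. w i * c i) = 0" if "w \<in> W" for w
          proof -
            have "(\<Sum>i<N. w i * c i) = (\<Sum>i<N. \<Sum>l<k. a l * (w i * u l i))"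
              by (simp add: c_def sum_distrib_left mult.left_commute)
            also have "\<dots> = (\<Sum>l<k. a l * (\<Sum>i<N. w i * u l i))"
              by (subst sum.swap) (simp add: sum_distrib_left)
            also have "\<dots> = 0" using u(2) that by simp
            finally show ?thesis .
          qed
          then have "norm (\<Sum>i<N. c i *\<^sub>R x i) \<le> b * sqrt (\<Sum>i<N. (c i)\<^sup>2)"
            using 2(3) by (simp add: bound_def b_def)
          also have "(\<Sum>i<N. (c i)\<^sup>2) = (\<Sum>l<k. (a l)\<^sup>2)"
            unfolding c_def by (rule sum_square_orthonormal[OF u(1)])
          finally show ?thesis unfolding y using b by (simp add: field_simps)
        qed
        moreover have "1 / 2 \<le> norm (y l)" if "l < k" for l
          using u(3)[OF that] b by (simp add: y_def field_simps)
        ultimately have ?goal by blast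
        then show ?thesis ..
      qed
    qed
  qed
  show ?goal
  proof (rule ccontr)
    assume "\<not> ?goal"
    with phases[of p] obtain W where W: "finite W" "card W \<le> p * k" "bound W ((1/2) ^ p)" by blast
    \<comment> \<open>The extra 1 in \<open>N = p * k + 1\<close> leaves a nonzero vector under at
      most \<open>p * k\<close> constraints.\<close>
    have "card W < card {..<N}" using W by (simp add: N_def)
    then obtain c where c: "\<exists>i\<in>{..<N}. c i \<noteq> 0" "\<forall>w\<in>W. (\<Sum>i<N. w i * c i) = 0"
      using homogeneous_system_nontrivial[of W "{..<N}"] W(1) by blast
    define s where "s = sqrt (\<Sum>i<N. (c i)\<^sup>2)"
    obtain i where i: "i < N" "c i \<noteq> 0" using c(1) by auto
    have "0 < (c i)\<^sup>2" using i by simp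
    also have "\<dots> \<le> (\<Sum>i<N. (c i)\<^sup>2)" using i by (intro member_le_sum) auto
    finally have s: "s > 0" by (simp add: s_def)
    have "s \<le> 2 * (real N)\<^sup>2 * (1 + e) ^ N * norm (\<Sum>i<N. c i *\<^sub>R x i)" unfolding s_def by (rule x(2))
    also have "\<dots> \<le> 2 * (real N)\<^sup>2 * (1 + e) ^ N * ((1/2) ^ p * s)"
      using W(3) c(2) e by (intro mult_left_mono) (auto simp: bound_def s_def)
    also have "\<dots> < 2 ^ p * ((1/2) ^ p * s)"
      using small s by (intro mult_strict_right_mono) auto
    also have "\<dots> = s" by (simp add: power_one_over)
    finally show False by simp
  qed
qed

subsection \<open>Rotation invariance of Gaussian measures\<close>

definition std_gauss :: "real measure"
  where "std_gauss = density lborel (\<lambda>x. ennreal (std_normal_density x))"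

lemma sets_std_gauss [simp, measurable_cong]: "sets std_gauss = sets borel"
  and space_std_gauss [simp]: "space std_gauss = UNIV"
  by (simp_all add: std_gauss_def)

lemma prob_space_std_gauss: "prob_space std_gauss"
  unfolding std_gauss_def by (rule prob_space_normal_density) simp

text \<open>For \<open>s \<noteq> 0\<close> two one-dimensional substitutions suffice, with the
  order of integration exchanged in between: \<open>y\<close> is replaced by the first new
  coordinate, with factor \<open>\<bar>1/s\<bar>\<close>, then \<open>x\<close> by the second, which
  cancels the factor. For \<open>s = 0\<close> both coordinates are merely multiplied by
  \<open>c = 1\<close> or \<open>c = -1\<close>.\<close>

lemma nn_integral_lborel_rotate:
  fixes h :: "real \<times> real \<Rightarrow> ennreal"
  assumes [measurable]: "h \<in> borel_measurable (borel \<Otimes>\<^sub>M borel)" and cs: "c\<^sup>2 + s\<^sup>2 = 1"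
  shows "(\<integral>\<^sup>+x. \<integral>\<^sup>+y. h (c * x + s * y, c * y - s * x) \<partial>lborel \<partial>lborel) = (\<integral>\<^sup>+x. \<integral>\<^sup>+y. h (x, y) \<partial>lborel \<partial>lborel)"
proof (cases "s = 0")
  case True
  then have c: "\<bar>c\<bar> = 1" "c \<noteq> 0" using cs abs_square_eq_1[of c] by auto
  have "(\<integral>\<^sup>+x. \<integral>\<^sup>+y. h (x, y) \<partial>lborel \<partial>lborel) = (\<integral>\<^sup>+x. \<integral>\<^sup>+y. h (x, 0 + c * y) \<partial>lborel \<partial>lborel)"
    by (rule nn_integral_cong, subst nn_integral_real_affine[where c = c and t = 0])
       (use c in simp_all)
  also have "\<dots> = (\<integral>\<^sup>+x. \<integral>\<^sup>+y. h (0 + c * x, 0 + c * y) \<partial>lborel \<partial>lborel)"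
    by (subst nn_integral_real_affine[where c = c and t = 0]) (use c in simp_all)
  finally show ?thesis using True by simp
next
  case False
  have "(\<integral>\<^sup>+x. \<integral>\<^sup>+y. h (c * x + s * y, c * y - s * x) \<partial>lborel \<partial>lborel)
      = (\<integral>\<^sup>+x. \<bar>1/s\<bar> * (\<integral>\<^sup>+u. h (u, c * u / s - x / s) \<partial>lborel) \<partial>lborel)"
  proof (rule nn_integral_cong)
    fix x
    have e: "(c * x + s * (- (c * x / s) + 1 / s * u), c * (- (c * x / s) + 1 / s * u) - s * x)
        = (u, c * u / s - x / s)" for u
    proof -
      have "c * (- (c * x / s) + 1 / s * u) - s * x = c * u / s - (c\<^sup>2 + s\<^sup>2) * x / s"
        using False by (simp add: field_simps power2_eq_square)
      moreover have "c * x + s * (- (c * x / s) + 1 / s * u) = u"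
        using False by (simp add: field_simps)
      ultimately show ?thesis unfolding cs by simp
    qed
    show "(\<integral>\<^sup>+y. h (c * x + s * y, c * y - s * x) \<partial>lborel)
      = \<bar>1/s\<bar> * (\<integral>\<^sup>+u. h (u, c * u / s - x / s) \<partial>lborel)"
      by (subst nn_integral_real_affine[where c = "1/s" and t = "- (c * x / s)"])
         (use False in \<open>simp_all only: e, simp_all\<close>)
  qed
  also have "\<dots> = \<bar>1/s\<bar> * (\<integral>\<^sup>+x. \<integral>\<^sup>+u. h (u, c * u / s - x / s) \<partial>lborel \<partial>lborel)"
    by (rule nn_integral_cmult) simp
  also have "\<dots> = \<bar>1/s\<bar> * (\<integral>\<^sup>+u. \<integral>\<^sup>+x. h (u, c * u / s - x / s) \<partial>lborel \<partial>lborel)"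
    by (subst lborel_pair.Fubini') simp_all
  also have "\<dots> = (\<integral>\<^sup>+u. \<bar>1/s\<bar> * (\<integral>\<^sup>+x. h (u, c * u / s - x / s) \<partial>lborel) \<partial>lborel)"
    by (rule nn_integral_cmult[symmetric]) simp
  also have "\<dots> = (\<integral>\<^sup>+u. \<integral>\<^sup>+v. h (u, v) \<partial>lborel \<partial>lborel)"
  proof (rule nn_integral_cong)
    fix u
    show "\<bar>1/s\<bar> * (\<integral>\<^sup>+x. h (u, c * u / s - x / s) \<partial>lborel) = (\<integral>\<^sup>+v. h (u, v) \<partial>lborel)"
      by (subst nn_integral_real_affine[where c = "-1/s" and t = "c * u / s" and f = "\<lambda>v. h (u, v)"])
         (use False in simp_all)
  qed
  finally show ?thesis .
qed

lemma std_gauss_pair: "std_gauss \<Otimes>\<^sub>M std_gauss = density (lborel \<Otimes>\<^sub>M lborel)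
    (\<lambda>(x, y). ennreal (std_normal_density x) * ennreal (std_normal_density y))"
  unfolding std_gauss_def
  by (rule pair_measure_density)
     (auto intro!: prob_space_imp_sigma_finite prob_space_normal_density sigma_finite_lborel)

text \<open>The joint density depends only on the sum of the two squares, and planar Lebesgue
  measure is rotation invariant.\<close>

lemma distr_std_gauss_pair_rotate:
  fixes c s :: real
  assumes cs: "c\<^sup>2 + s\<^sup>2 = 1"
  shows "distr (std_gauss \<Otimes>\<^sub>M std_gauss) (std_gauss \<Otimes>\<^sub>M std_gauss) (\<lambda>(x, y). (c * x + s * y, c * y - s * x))
    = std_gauss \<Otimes>\<^sub>M std_gauss" (is "distr ?G ?G ?r = _")
proof (rule measure_eqI)
  fix A assume "A \<in> sets (distr ?G ?G ?r)"
  then have A[measurable]: "A \<in> sets (borel \<Otimes>\<^sub>M borel)" "A \<in> sets ?G"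
    by (simp_all cong: sets_pair_measure_cong)
  have r[measurable]: "?r \<in> ?G \<rightarrow>\<^sub>M ?G" by simp
  define D where "D = (\<lambda>(x, y). ennreal (std_normal_density x) * ennreal (std_normal_density y))"
  have [measurable]: "D \<in> borel_measurable (borel \<Otimes>\<^sub>M borel)" unfolding D_def by simp
  have D: "D (c * x + s * y, c * y - s * x) = D (x, y)" for x y
  proof -
    have "(c * x + s * y)\<^sup>2 + (c * y - s * x)\<^sup>2 = (c\<^sup>2 + s\<^sup>2) * (x\<^sup>2 + y\<^sup>2)"
      by (simp add: power2_eq_square algebra_simps)
    then have "- (c * x + s * y)\<^sup>2 / 2 + - (c * y - s * x)\<^sup>2 / 2 = - x\<^sup>2 / 2 + - y\<^sup>2 / 2"
      using cs by (simp add: field_simps)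
    then show ?thesis
      by (simp add: D_def std_normal_density_def ennreal_mult[symmetric] exp_add[symmetric])
  qed
  have "emeasure (distr ?G ?G ?r) A = (\<integral>\<^sup>+z. indicator A (?r z) \<partial>?G)"
    by (subst nn_integral_indicator[symmetric], simp, subst nn_integral_distr) simp_all
  also have "\<dots> = (\<integral>\<^sup>+z. D z * indicator A (?r z) \<partial>(lborel \<Otimes>\<^sub>M lborel))"
    unfolding std_gauss_pair D_def[symmetric] by (subst nn_integral_density) simp_all
  also have "\<dots> = (\<integral>\<^sup>+x. \<integral>\<^sup>+y. D (x, y) * indicator A (?r (x, y)) \<partial>lborel \<partial>lborel)"
    by (subst lborel.nn_integral_fst[symmetric]) simp_all
  also have "\<dots> = (\<integral>\<^sup>+x. \<integral>\<^sup>+y. (\<lambda>z. D z * indicator A z) (c * x + s * y, c * y - s * x) \<partial>lborel \<partial>lborel)"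
    by (simp add: D)
  also have "\<dots> = (\<integral>\<^sup>+x. \<integral>\<^sup>+y. D (x, y) * indicator A (x, y) \<partial>lborel \<partial>lborel)"
    by (rule nn_integral_lborel_rotate[OF _ cs]) simp
  also have "\<dots> = (\<integral>\<^sup>+z. D z * indicator A z \<partial>(lborel \<Otimes>\<^sub>M lborel))"
    by (subst lborel.nn_integral_fst[symmetric]) simp_all
  also have "\<dots> = (\<integral>\<^sup>+z. indicator A z \<partial>?G)"
    unfolding std_gauss_pair D_def[symmetric] by (subst nn_integral_density) simp_all
  finally show "emeasure (distr ?G ?G ?r) A = emeasure ?G A" by simp
qed simp

text \<open>Both measures are compared with the product over \<open>I \<times> bool\<close>, as product measures are determined on
  boxes only.\<close>
lemma nn_integral_PiM_pair:
  assumes I: "finite I" and M: "prob_space M"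
    and g[measurable]: "g \<in> borel_measurable (PiM I (\<lambda>_. M) \<Otimes>\<^sub>M PiM I (\<lambda>_. M))"
  shows "(\<integral>\<^sup>+z. g z \<partial>(PiM I (\<lambda>_. M) \<Otimes>\<^sub>M PiM I (\<lambda>_. M)))
    = (\<integral>\<^sup>+w. g (\<lambda>i\<in>I. fst (w i), \<lambda>i\<in>I. snd (w i)) \<partial>PiM I (\<lambda>_. M \<Otimes>\<^sub>M M))"
proof -
  interpret M: prob_space M by fact
  interpret MM: pair_prob_space M M ..
  let ?P = "PiM I (\<lambda>_. M)" and ?L = "PiM I (\<lambda>_. M \<Otimes>\<^sub>M M)"
  let ?J = "I \<times> (UNIV :: bool set)"
  let ?H = "PiM ?J (\<lambda>_. M)"
  interpret Pp: prob_space ?P by (rule prob_space_PiM) (rule M)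
  interpret P: product_prob_space "\<lambda>_. M" I ..
  interpret H: product_prob_space "\<lambda>_. M" ?J ..
  interpret L: product_prob_space "\<lambda>_. M \<Otimes>\<^sub>M M" I ..
  have JF: "finite ?J" using I by simp
  \<comment> \<open>\<open>e1\<close> and \<open>e2\<close> carry pairs of families and families of
    pairs to families over \<open>?J\<close>, with \<open>False\<close> marking first components;
    \<open>d\<close> splits such a family and undoes \<open>e1\<close>.\<close>
  define e1 where "e1 = (\<lambda>(x, y). \<lambda>p\<in>?J. if snd p then y (fst p) else x (fst p) :: 'b)"
  define e2 where "e2 = (\<lambda>w. \<lambda>p\<in>?J. if snd p then snd (w (fst p)) else fst (w (fst p)) :: 'b)"
  define d where "d = (\<lambda>w. (\<lambda>i\<in>I. w (i, False) :: 'b, \<lambda>i\<in>I. w (i, True) :: 'b))"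
  have e1m[measurable]: "e1 \<in> ?P \<Otimes>\<^sub>M ?P \<rightarrow>\<^sub>M ?H"
    unfolding e1_def split_beta'
  proof (rule measurable_restrict)
    fix p assume "p \<in> ?J" then have "fst p \<in> I" by auto
    then show "(\<lambda>z. if snd p then snd z (fst p) else fst z (fst p)) \<in> ?P \<Otimes>\<^sub>M ?P \<rightarrow>\<^sub>M M"
      by (cases "snd p") simp_all
  qed
  have e2m[measurable]: "e2 \<in> ?L \<rightarrow>\<^sub>M ?H"
    unfolding e2_def
  proof (rule measurable_restrict)
    fix p assume "p \<in> ?J" then have "fst p \<in> I" by auto
    then show "(\<lambda>w. if snd p then snd (w (fst p)) else fst (w (fst p))) \<in> ?L \<rightarrow>\<^sub>M M"
      by (cases "snd p") simp_all
  qed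
  have dm[measurable]: "d \<in> ?H \<rightarrow>\<^sub>M ?P \<Otimes>\<^sub>M ?P"
    unfolding d_def by (intro measurable_Pair measurable_restrict) auto
  have prodJ: "(\<Prod>p\<in>?J. emeasure M (A p)) = (\<Prod>i\<in>I. emeasure M (A (i, False)) * emeasure M (A (i, True)))" for A
    by (subst prod.Sigma[of I "\<lambda>_. UNIV" "\<lambda>i b. emeasure M (A (i, b))", simplified, OF I, symmetric])
       (simp add: UNIV_bool)
  have D1: "distr (?P \<Otimes>\<^sub>M ?P) ?H e1 = ?H"
  proof (rule H.PiM_eqI[OF JF])
    fix A assume A: "\<And>p. p \<in> ?J \<Longrightarrow> A p \<in> sets M"
    have "e1 -` Pi\<^sub>E ?J A \<inter> space (?P \<Otimes>\<^sub>M ?P) = (Pi\<^sub>E I (\<lambda>i. A (i, False))) \<times> (Pi\<^sub>E I (\<lambda>i. A (i, True)))"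
    proof (intro set_eqI iffI)
      fix z assume z: "z \<in> e1 -` Pi\<^sub>E ?J A \<inter> space (?P \<Otimes>\<^sub>M ?P)"
      then have "fst z i \<in> A (i, False)" "snd z i \<in> A (i, True)" if "i \<in> I" for i
        using PiE_mem[of "e1 z" ?J A "(i, False)"] PiE_mem[of "e1 z" ?J A "(i, True)"] that
        by (auto simp: e1_def split_beta)
      with z show "z \<in> (Pi\<^sub>E I (\<lambda>i. A (i, False))) \<times> (Pi\<^sub>E I (\<lambda>i. A (i, True)))"
        by (auto simp: space_pair_measure space_PiM PiE_iff mem_Times_iff)
    next
      fix z assume z: "z \<in> (Pi\<^sub>E I (\<lambda>i. A (i, False))) \<times> (Pi\<^sub>E I (\<lambda>i. A (i, True)))"
      have "A p \<subseteq> space M" if "p \<in> ?J" for p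
        using A[OF that] by (rule sets.sets_into_space)
      with z show "z \<in> e1 -` Pi\<^sub>E ?J A \<inter> space (?P \<Otimes>\<^sub>M ?P)"
        by (force simp: e1_def space_pair_measure space_PiM PiE_iff)
    qed
    then have "emeasure (distr (?P \<Otimes>\<^sub>M ?P) ?H e1) (Pi\<^sub>E ?J A)
      = emeasure (?P \<Otimes>\<^sub>M ?P) ((Pi\<^sub>E I (\<lambda>i. A (i, False))) \<times> (Pi\<^sub>E I (\<lambda>i. A (i, True))))"
      using A JF by (subst emeasure_distr) (auto intro!: sets_PiM_I_finite)
    also have "\<dots> = (\<Prod>i\<in>I. emeasure M (A (i, False))) * (\<Prod>i\<in>I. emeasure M (A (i, True)))"
      using A I by (subst Pp.emeasure_pair_measure_Times) (auto simp: P.emeasure_PiM intro!: sets_PiM_I_finite)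
    also have "\<dots> = (\<Prod>p\<in>?J. emeasure M (A p))"
      unfolding prodJ by (simp add: prod.distrib)
    finally show "emeasure (distr (?P \<Otimes>\<^sub>M ?P) ?H e1) (Pi\<^sub>E ?J A) = (\<Prod>p\<in>?J. emeasure M (A p))" .
  qed simp
  have D2: "distr ?L ?H e2 = ?H"
  proof (rule H.PiM_eqI[OF JF])
    fix A assume A: "\<And>p. p \<in> ?J \<Longrightarrow> A p \<in> sets M"
    have "e2 -` Pi\<^sub>E ?J A \<inter> space ?L = Pi\<^sub>E I (\<lambda>i. A (i, False) \<times> A (i, True))"
    proof (intro set_eqI iffI)
      fix z assume z: "z \<in> e2 -` Pi\<^sub>E ?J A \<inter> space ?L"
      then have "fst (z i) \<in> A (i, False)" "snd (z i) \<in> A (i, True)" if "i \<in> I" for i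
        using PiE_mem[of "e2 z" ?J A "(i, False)"] PiE_mem[of "e2 z" ?J A "(i, True)"] that
        by (auto simp: e2_def)
      with z show "z \<in> Pi\<^sub>E I (\<lambda>i. A (i, False) \<times> A (i, True))"
        by (auto simp: space_pair_measure space_PiM PiE_iff mem_Times_iff)
    next
      fix z assume z: "z \<in> Pi\<^sub>E I (\<lambda>i. A (i, False) \<times> A (i, True))"
      have "A p \<subseteq> space M" if "p \<in> ?J" for p
        using A[OF that] by (rule sets.sets_into_space)
      with z show "z \<in> e2 -` Pi\<^sub>E ?J A \<inter> space ?L"
        by (force simp: e2_def space_pair_measure space_PiM PiE_iff mem_Times_iff)
    qed
    then have "emeasure (distr ?L ?H e2) (Pi\<^sub>E ?J A) = emeasure ?L (Pi\<^sub>E I (\<lambda>i. A (i, False) \<times> A (i, True)))"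
      using A JF by (subst emeasure_distr) (auto intro!: sets_PiM_I_finite)
    also have "\<dots> = (\<Prod>i\<in>I. emeasure M (A (i, False)) * emeasure M (A (i, True)))"
      using A I by (subst L.emeasure_PiM) (auto simp: M.emeasure_pair_measure_Times intro!: prod.cong)
    finally show "emeasure (distr ?L ?H e2) (Pi\<^sub>E ?J A) = (\<Prod>p\<in>?J. emeasure M (A p))"
      unfolding prodJ .
  qed simp
  have "(\<integral>\<^sup>+z. g z \<partial>(?P \<Otimes>\<^sub>M ?P)) = (\<integral>\<^sup>+z. g (d (e1 z)) \<partial>(?P \<Otimes>\<^sub>M ?P))"
    by (intro nn_integral_cong arg_cong[where f = g])
       (auto simp: d_def e1_def space_pair_measure space_PiM PiE_iff extensional_def)
  also have "\<dots> = (\<integral>\<^sup>+w. g (d w) \<partial>?H)"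
    by (subst D1[symmetric], subst nn_integral_distr) simp_all
  also have "\<dots> = (\<integral>\<^sup>+w. g (d (e2 w)) \<partial>?L)"
    by (subst D2[symmetric], subst nn_integral_distr) simp_all
  also have "\<dots> = (\<integral>\<^sup>+w. g (\<lambda>i\<in>I. fst (w i), \<lambda>i\<in>I. snd (w i)) \<partial>?L)"
    by (intro nn_integral_cong arg_cong[where f = g]) (auto simp: d_def e2_def)
  finally show ?thesis .
qed

text \<open>After regrouping into a family of pairs, the map rotates each pair by the same planar
  rotation, so the product measure is preserved factor by factor.\<close>

lemma nn_integral_std_gauss_PiM_rotate:
  fixes c s :: real
  assumes I: "finite I" and cs: "c\<^sup>2 + s\<^sup>2 = 1"
    and f[measurable]: "f \<in> borel_measurable (PiM I (\<lambda>_. std_gauss) \<Otimes>\<^sub>M PiM I (\<lambda>_. std_gauss))"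
  shows "(\<integral>\<^sup>+z. f (\<lambda>i\<in>I. c * fst z i + s * snd z i, \<lambda>i\<in>I. c * snd z i - s * fst z i)
      \<partial>(PiM I (\<lambda>_. std_gauss) \<Otimes>\<^sub>M PiM I (\<lambda>_. std_gauss)))
    = (\<integral>\<^sup>+z. f z \<partial>(PiM I (\<lambda>_. std_gauss) \<Otimes>\<^sub>M PiM I (\<lambda>_. std_gauss)))"
proof -
  let ?P = "PiM I (\<lambda>_. std_gauss)" and ?G2 = "std_gauss \<Otimes>\<^sub>M std_gauss"
  let ?L = "PiM I (\<lambda>_. ?G2)"
  interpret G: prob_space std_gauss by (rule prob_space_std_gauss)
  interpret GG: pair_prob_space std_gauss std_gauss ..
  let ?r = "\<lambda>(x, y). (c * x + s * y, c * y - s * x)"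
  have r[measurable]: "?r \<in> ?G2 \<rightarrow>\<^sub>M ?G2" by simp
  define R where "R = (\<lambda>z. (\<lambda>i\<in>I. c * fst z i + s * snd z i, \<lambda>i\<in>I. c * snd z i - s * fst z i))"
  have R[measurable]: "R \<in> ?P \<Otimes>\<^sub>M ?P \<rightarrow>\<^sub>M ?P \<Otimes>\<^sub>M ?P"
    unfolding R_def by (intro measurable_Pair measurable_restrict) auto
  define S where "S = (\<lambda>w. (\<lambda>i\<in>I. fst (w i) :: real, \<lambda>i\<in>I. snd (w i) :: real))"
  have S[measurable]: "S \<in> ?L \<rightarrow>\<^sub>M ?P \<Otimes>\<^sub>M ?P"
    unfolding S_def by (intro measurable_Pair measurable_restrict) auto
  have C[measurable]: "compose I ?r \<in> ?L \<rightarrow>\<^sub>M ?L"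
    unfolding compose_def by (intro measurable_restrict) auto
  have dist: "distr ?L ?L (compose I ?r) = ?L"
    by (subst distr_PiM_finite_prob_space'[OF I])
       (auto simp: distr_std_gauss_pair_rotate[OF cs] GG.prob_space_axioms)
  have "(\<integral>\<^sup>+z. f (R z) \<partial>(?P \<Otimes>\<^sub>M ?P)) = (\<integral>\<^sup>+w. f (R (S w)) \<partial>?L)"
    unfolding S_def by (rule nn_integral_PiM_pair[OF I prob_space_std_gauss]) simp
  also have "\<dots> = (\<integral>\<^sup>+w. f (S (compose I ?r w)) \<partial>?L)"
    by (intro nn_integral_cong arg_cong[where f = f])
       (auto simp: R_def S_def compose_def fun_eq_iff split_beta)
  also have "\<dots> = (\<integral>\<^sup>+w. f (S w) \<partial>?L)"
    by (subst (2) dist[symmetric], subst nn_integral_distr) simp_all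
  also have "\<dots> = (\<integral>\<^sup>+z. f z \<partial>(?P \<Otimes>\<^sub>M ?P))"
    unfolding S_def by (rule nn_integral_PiM_pair[OF I prob_space_std_gauss, symmetric]) simp
  finally show ?thesis unfolding R_def .
qed

lemma distr_std_gauss_PiM_inner:
  fixes v :: "'i \<Rightarrow> real"
  assumes J: "finite J" and v: "(\<Sum>j\<in>J. (v j)\<^sup>2) = 1"
  shows "distr (PiM J (\<lambda>_. std_gauss)) std_gauss (\<lambda>x. \<Sum>j\<in>J. v j * x j) = std_gauss"
proof -
  interpret G: prob_space std_gauss by (rule prob_space_std_gauss)
  let ?P = "PiM J (\<lambda>_. std_gauss)"
  interpret Pp: prob_space ?P by (rule prob_space_PiM) (rule prob_space_std_gauss)
  interpret P: product_prob_space "\<lambda>_. std_gauss" J ..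
  \<comment> \<open>Indices with \<open>v j = 0\<close> are dropped because a zero multiple of a
    Gaussian has no density, and the sum rule for normal variables asks for positive
    deviations.\<close>
  define K where "K = {j\<in>J. v j \<noteq> 0}"
  have K: "finite K" "K \<subseteq> J" using J by (auto simp: K_def)
  have vK: "(\<Sum>j\<in>K. (v j)\<^sup>2) = 1"
    unfolding v[symmetric] by (rule sum.mono_neutral_left) (use J in \<open>auto simp: K_def\<close>)
  have "K \<noteq> {}" using vK by auto
  have iv: "prob_space.indep_vars ?P (\<lambda>_. borel) (\<lambda>j x. v j * x j) K"
  proof -
    have "prob_space.indep_vars ?P (\<lambda>_. std_gauss) (\<lambda>j x. x j) J"
    proof (subst Pp.indep_vars_iff_distr_eq_PiM')
      show "J \<noteq> {}" using v by auto
      have "distr ?P ?P (\<lambda>x. \<lambda>i\<in>J. x i) = distr ?P ?P (\<lambda>x. x)"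
        by (rule distr_cong) (auto simp: space_PiM)
      also have "\<dots> = ?P" by (rule distr_id)
      also have "\<dots> = PiM J (\<lambda>i. distr ?P std_gauss (\<lambda>x. x i))"
        using P.PiM_component J by (intro PiM_cong) auto
      finally show "distr ?P ?P (\<lambda>x. \<lambda>i\<in>J. x i) = PiM J (\<lambda>i. distr ?P std_gauss (\<lambda>x. x i))" .
    qed simp
    then have "prob_space.indep_vars ?P (\<lambda>_. borel) (\<lambda>j. (\<lambda>t. v j * t) \<circ> (\<lambda>x. x j)) J"
      by (rule Pp.indep_vars_compose) simp
    then show ?thesis using K Pp.indep_vars_subset by (fastforce simp: comp_def)
  qed
  have "distributed ?P lborel (\<lambda>x. v j * x j) (normal_density 0 \<bar>v j\<bar>)" if "j \<in> K" for j
  proof -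
    have "distr ?P lborel (\<lambda>x. x j) = distr ?P std_gauss (\<lambda>x. x j)"
      by (rule distr_cong) simp_all
    also have "\<dots> = std_gauss" using that K by (intro P.PiM_component) auto
    finally have "distributed ?P lborel (\<lambda>x. x j) std_normal_density"
      using that K unfolding distributed_def std_gauss_def by auto
    from Pp.normal_density_affine[OF this, of "v j" 0] that show ?thesis by (simp add: K_def)
  qed
  from Pp.sum_indep_normal[OF K(1) \<open>K \<noteq> {}\<close> iv _ this]
  have "distributed ?P lborel (\<lambda>x. \<Sum>j\<in>K. v j * x j) std_normal_density"
    using vK by (simp add: K_def)
  then have "distr ?P lborel (\<lambda>x. \<Sum>j\<in>K. v j * x j) = std_gauss"
    by (simp add: distributed_def std_gauss_def)
  moreover have "(\<Sum>j\<in>K. v j * x j) = (\<Sum>j\<in>J. v j * x j)" for x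
    by (rule sum.mono_neutral_left) (use J in \<open>auto simp: K_def\<close>)
  moreover have "distr ?P lborel h = distr ?P std_gauss h" for h
    by (rule distr_cong) simp_all
  ultimately show ?thesis by simp
qed

subsection \<open>Gaussian concentration\<close>

definition grid_round :: "'i set \<Rightarrow> real \<Rightarrow> ('i \<Rightarrow> real) \<Rightarrow> 'i \<Rightarrow> real"
  where "grid_round I R a = (\<lambda>i. if i \<in> I then of_int \<lfloor>R * a i\<rfloor> / R else 0)"

lemma abs_diff_grid_round_le:
  assumes "i \<in> I" "R > 0"
  shows "\<bar>a i - grid_round I R a i\<bar> \<le> 1 / R"
proof -
  have "R * \<bar>a i - grid_round I R a i\<bar> = \<bar>R * (a i - grid_round I R a i)\<bar>"
    using assms by (simp add: abs_mult)
  also have "\<dots> = \<bar>R * a i - of_int \<lfloor>R * a i\<rfloor>\<bar>"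
    using assms by (simp add: grid_round_def right_diff_distrib)
  also have "\<dots> \<le> 1" by linarith
  finally show ?thesis using assms by (simp add: field_simps)
qed

text \<open>Rounding factors through a countable discrete space, so \<open>h\<close> may be
  arbitrary, even a function obtained by the axiom of choice.\<close>

lemma measurable_comp_grid_round:
  assumes I: "finite I"
  shows "(\<lambda>a. h (grid_round I R a) :: real) \<in> borel_measurable (PiM I (\<lambda>_. borel))"
proof -
  let ?A = "PiE I (\<lambda>_. UNIV :: int set)"
  have cA: "countable ?A" using I by (intro countable_PiE) auto
  define fl where "fl = (\<lambda>a. \<lambda>i\<in>I. \<lfloor>R * a i :: real\<rfloor>)"
  have fl: "fl \<in> PiM I (\<lambda>_. borel) \<rightarrow>\<^sub>M count_space ?A"
  proof (subst measurable_count_space_eq_countable[OF cA], intro conjI ballI)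
    show "fl \<in> space (PiM I (\<lambda>_. borel)) \<rightarrow> ?A" by (auto simp: fl_def)
    fix g assume g: "g \<in> ?A"
    have "fl -` {g} \<inter> space (PiM I (\<lambda>_. borel)) = {a \<in> space (PiM I (\<lambda>_. borel)). \<forall>i\<in>I. \<lfloor>R * a i\<rfloor> = g i}"
      using g by (force simp: fl_def fun_eq_iff PiE_iff extensional_def)
    also have "\<dots> \<in> sets (PiM I (\<lambda>_. borel))"
      using I by measurable
    finally show "fl -` {g} \<inter> space (PiM I (\<lambda>_. borel)) \<in> sets (PiM I (\<lambda>_. borel))" .
  qed
  have "(\<lambda>g. h (\<lambda>i. if i \<in> I then of_int (g i) / R else 0)) \<in> count_space ?A \<rightarrow>\<^sub>M borel" by simp
  from measurable_compose[OF fl this] show ?thesis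
    by (simp add: fl_def grid_round_def cong: if_cong)
qed

lemma nn_integral_std_gauss_square: "(\<integral>\<^sup>+t. ennreal (t\<^sup>2) \<partial>std_gauss) = 1"
proof -
  have "has_bochner_integral lborel (\<lambda>x. std_normal_density x * x\<^sup>2) 1"
    using std_normal_moment_even[of 1] by simp
  then have "(\<integral>\<^sup>+x. ennreal (std_normal_density x * x\<^sup>2) \<partial>lborel) = 1"
    using has_bochner_integral_iff nn_integral_eq_integral[of lborel "\<lambda>x. std_normal_density x * x\<^sup>2"]
    by (metis (no_types, lifting) AE_I2 ennreal_1 normal_density_nonneg zero_le_mult_iff zero_le_power2)
  then show ?thesis
    unfolding std_gauss_def by (subst nn_integral_density) (simp_all add: ennreal_mult)
qed

lemma nn_integral_std_gauss_PiM_inner_square: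
  assumes J: "finite J"
  shows "(\<integral>\<^sup>+x. ennreal ((\<Sum>j\<in>J. v j * x j)\<^sup>2) \<partial>PiM J (\<lambda>_. std_gauss)) = ennreal (\<Sum>j\<in>J. (v j)\<^sup>2)"
proof (cases "(\<Sum>j\<in>J. (v j)\<^sup>2) = 0")
  case True
  then have "v j = 0" if "j \<in> J" for j using J that by (simp add: sum_nonneg_eq_0_iff)
  then show ?thesis using True by simp
next
  case False
  define r where "r = sqrt (\<Sum>j\<in>J. (v j)\<^sup>2)"
  have r2: "r\<^sup>2 = (\<Sum>j\<in>J. (v j)\<^sup>2)" unfolding r_def by (simp add: sum_nonneg)
  with False have r: "r \<noteq> 0" by auto
  have n: "(\<Sum>j\<in>J. (v j / r)\<^sup>2) = 1"
    using r by (simp add: power_divide sum_divide_distrib[symmetric] r2[symmetric])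
  have "(\<Sum>j\<in>J. v j * x j) = r * (\<Sum>j\<in>J. v j / r * x j)" for x
    using r by (simp add: sum_distrib_left)
  then have "(\<integral>\<^sup>+x. ennreal ((\<Sum>j\<in>J. v j * x j)\<^sup>2) \<partial>PiM J (\<lambda>_. std_gauss))
    = (\<integral>\<^sup>+x. ennreal (r\<^sup>2) * ennreal ((\<Sum>j\<in>J. v j / r * x j)\<^sup>2) \<partial>PiM J (\<lambda>_. std_gauss))"
    by (simp add: power_mult_distrib ennreal_mult)
  also have "\<dots> = ennreal (r\<^sup>2) * (\<integral>\<^sup>+x. ennreal ((\<Sum>j\<in>J. v j / r * x j)\<^sup>2) \<partial>PiM J (\<lambda>_. std_gauss))"
    by (rule nn_integral_cmult) measurable
  also have "(\<integral>\<^sup>+x. ennreal ((\<Sum>j\<in>J. v j / r * x j)\<^sup>2) \<partial>PiM J (\<lambda>_. std_gauss))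
    = (\<integral>\<^sup>+t. ennreal (t\<^sup>2) \<partial>distr (PiM J (\<lambda>_. std_gauss)) std_gauss (\<lambda>x. \<Sum>j\<in>J. v j / r * x j))"
    by (subst nn_integral_distr) measurable
  also have "\<dots> = 1"
    unfolding distr_std_gauss_PiM_inner[OF J n] by (rule nn_integral_std_gauss_square)
  finally show ?thesis unfolding r2 by simp
qed

lemma sum_mult_le_of_norm:
  fixes s d :: "'i \<Rightarrow> real"
  assumes "(\<Sum>i\<in>I. (s i)\<^sup>2) \<le> 1"
  shows "\<bar>\<Sum>i\<in>I. s i * d i\<bar> \<le> sqrt (\<Sum>i\<in>I. (d i)\<^sup>2)"
proof (rule real_le_rsqrt)
  have "(\<Sum>i\<in>I. s i * d i)\<^sup>2 \<le> (\<Sum>i\<in>I. (s i)\<^sup>2) * (\<Sum>i\<in>I. (d i)\<^sup>2)"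
    by (rule Cauchy_Schwarz_ineq_sum)
  also have "\<dots> \<le> 1 * (\<Sum>i\<in>I. (d i)\<^sup>2)"
    using assms by (intro mult_right_mono sum_nonneg) auto
  finally show "\<bar>\<Sum>i\<in>I. s i * d i\<bar>\<^sup>2 \<le> (\<Sum>i\<in>I. (d i)\<^sup>2)" by simp
qed

lemma sqrt_sum_square_le_card_mult:
  fixes d :: "'i \<Rightarrow> real"
  assumes "\<And>i. i \<in> I \<Longrightarrow> \<bar>d i\<bar> \<le> e"
  shows "sqrt (\<Sum>i\<in>I. (d i)\<^sup>2) \<le> real (card I) * e"
proof -
  have "sqrt (\<Sum>i\<in>I. (d i)\<^sup>2) \<le> (\<Sum>i\<in>I. \<bar>d i\<bar>)"
    by (fold L2_set_def) (rule L2_set_le_sum_abs)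
  also have "\<dots> \<le> real (card I) * e"using assms by (intro sum_bounded_above) auto
  finally show ?thesis .
qed

text \<open>An encoding of convex functions of the coordinates in \<open>I\<close> with Lipschitz
  constant 1: convexity is a supporting affine function at each point, and the bound on
  \<open>s\<close> gives the constant. The form suits norms, which need not be
  differentiable.\<close>

locale bounded_subgradient =
  fixes I :: "'i set" and F :: "('i \<Rightarrow> real) \<Rightarrow> real"
  assumes I: "finite I"
    and subgradient: "\<And>a. \<exists>s. (\<Sum>i\<in>I. (s i)\<^sup>2) \<le> 1 \<and> (\<forall>b. F a + (\<Sum>i\<in>I. s i * (b i - a i)) \<le> F b)"
begin

abbreviation \<mu> where "\<mu> \<equiv> PiM I (\<lambda>_. std_gauss)"

lemma lipschitz: "\<bar>F a - F b\<bar> \<le> sqrt (\<Sum>i\<in>I. (a i - b i)\<^sup>2)"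
proof -
  have "F a - F b \<le> sqrt (\<Sum>i\<in>I. (a i - b i)\<^sup>2)" for a b
  proof -
    obtain s where s: "(\<Sum>i\<in>I. (s i)\<^sup>2) \<le> 1" "F a + (\<Sum>i\<in>I. s i * (b i - a i)) \<le> F b"
      using subgradient by blast
    with sum_mult_le_of_norm[OF s(1), of "\<lambda>i. b i - a i"] show ?thesis
      by (simp add: power2_commute abs_le_iff)
  qed
  from this[of a b] this[of b a] show ?thesis by (simp add: abs_le_iff power2_commute)
qed

lemma F_cong: "(\<And>i. i \<in> I \<Longrightarrow> a i = b i) \<Longrightarrow> F a = F b"
  using lipschitz[of a b] by simp

lemma measurable_F [measurable]: "F \<in> borel_measurable (PiM I (\<lambda>_. borel))"
proof (rule borel_measurable_LIMSEQ_real)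
  show "(\<lambda>a. F (grid_round I (real (Suc n)) a)) \<in> borel_measurable (PiM I (\<lambda>_. borel))" for n
    by (rule measurable_comp_grid_round[OF I])
  fix a
  have "(\<lambda>n. F (grid_round I (real (Suc n)) a) - F a) \<longlonglongrightarrow> 0"
  proof (rule Lim_null_comparison)
    show "eventually (\<lambda>n. norm (F (grid_round I (real (Suc n)) a) - F a) \<le> card I * (1 / real (Suc n))) sequentially"
    proof (rule always_eventually, rule allI)
      fix n
      show "norm (F (grid_round I (real (Suc n)) a) - F a) \<le> card I * (1 / real (Suc n))"
        unfolding real_norm_def
        by (rule order_trans[OF lipschitz sqrt_sum_square_le_card_mult])
          (metis abs_diff_grid_round_le abs_minus_commute of_nat_0_less_iff zero_less_Suc)
    qed
    show "(\<lambda>n. card I * (1 / real (Suc n))) \<longlonglongrightarrow> 0"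
      using tendsto_mult_right[OF LIMSEQ_inverse_real_of_nat, of "card I"] by (simp add: inverse_eq_divide)
  qed
  then show "(\<lambda>n. F (grid_round I (real (Suc n)) a)) \<longlonglongrightarrow> F a"
    by (simp add: LIM_zero_iff)
qed

lemma measurable_std_gauss_PiM: "borel_measurable \<mu> = borel_measurable (PiM I (\<lambda>_. borel))"
  by (intro measurable_cong_sets sets_PiM_cong) auto

text \<open>Choosing subgradients only at grid points makes the choice measurable; \<open>\<eta>\<close> is the resulting error.\<close>
lemma measurable_approx_subgradient:
  assumes "\<eta> > 0"
  obtains s where "\<And>i. (\<lambda>a. s a i :: real) \<in> borel_measurable (PiM I (\<lambda>_. borel))"
    "\<And>a. (\<Sum>i\<in>I. (s a i)\<^sup>2) \<le> 1" "\<And>a b. F a - \<eta> + (\<Sum>i\<in>I. s a i * (b i - a i)) \<le> F b"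
proof -
  obtain S where S: "(\<Sum>i\<in>I. (S a i)\<^sup>2) \<le> 1" "F a + (\<Sum>i\<in>I. S a i * (b i - a i)) \<le> F b" for a b
    using subgradient by metis
  \<comment> \<open>Half of \<open>\<eta>\<close> pays for replacing \<open>F a\<close> by the value
    at the grid point, half for shifting the base point of the supporting affine function.\<close>
  define R where "R = 2 * (real (card I) + 1) / \<eta>"
  have R: "R > 0" "card I * (1 / R) \<le> \<eta> / 2" using assms by (auto simp: R_def field_simps)
  define s where "s a = S (grid_round I R a)" for a
  show ?thesis
  proof (rule that[of s])
    show "(\<lambda>a. s a i) \<in> borel_measurable (PiM I (\<lambda>_. borel))" for i
      unfolding s_def by (rule measurable_comp_grid_round[OF I])
    show "(\<Sum>i\<in>I. (s a i)\<^sup>2) \<le> 1" for a unfolding s_def by (rule S)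
    fix a b
    let ?q = "grid_round I R a"
    have d: "sqrt (\<Sum>i\<in>I. (a i - ?q i)\<^sup>2) \<le> \<eta> / 2"
      by (rule order_trans[OF sqrt_sum_square_le_card_mult R(2)]) (rule abs_diff_grid_round_le[OF _ R(1)])
    have "F a \<le> F ?q + \<eta> / 2" using lipschitz[of a ?q] d by linarith
    moreover have "- (\<eta> / 2) \<le> (\<Sum>i\<in>I. s a i * (a i - ?q i))"
      using sum_mult_le_of_norm[OF S(1)[of ?q], of "\<lambda>i. a i - ?q i"] d unfolding s_def by linarith
    moreover have "F ?q + (\<Sum>i\<in>I. s a i * (b i - ?q i)) \<le> F b" unfolding s_def by (rule S)
    moreover have "(\<Sum>i\<in>I. s a i * (b i - ?q i)) = (\<Sum>i\<in>I. s a i * (a i - ?q i)) + (\<Sum>i\<in>I. s a i * (b i - a i))"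
      by (simp add: sum.distrib[symmetric] algebra_simps)
    ultimately show "F a - \<eta> + (\<Sum>i\<in>I. s a i * (b i - a i)) \<le> F b" by linarith
  qed
qed

text \<open>Maurey--Pisier argument: rotate \<open>x\<close> into \<open>y\<close> in \<open>K\<close> steps of angle \<open>\<delta>\<close>. Up to terms of lower
  order, \<open>F\<close> increases in each step by at most \<open>sin \<delta>\<close> times a subgradient at \<open>U\<close> applied to the
  direction \<open>V\<close>, and \<open>(U, V)\<close> is again a pair of independent Gaussian vectors.\<close>
lemma nn_integral_increment_le:
  "(\<integral>\<^sup>+z. ennreal ((max 0 (F (snd z) - F (fst z)))\<^sup>2) \<partial>(\<mu> \<Otimes>\<^sub>M \<mu>)) \<le> 27"
proof -
  \<comment> \<open>The second-order part of one step has mean square of order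
    \<open>card I / K^4\<close>. There are \<open>K\<close> steps and Cauchy-Schwarz costs another
    factor \<open>K\<close>, so with \<open>K > card I\<close> this contribution is bounded
    independently of the dimension. The \<open>K\<close> angles \<open>\<delta>\<close> add up to a
    right angle.\<close>
  define K where "K = card I + 1"
  have K: "K > 0" by (simp add: K_def)
  define \<delta> where "\<delta> = pi / (2 * real K)"
  have \<delta>: "\<delta> > 0" "\<delta> \<le> 2 / K"
    using K pi_less_4 divide_right_mono[of pi 4 "2 * real K"] by (auto simp: \<delta>_def)
  obtain s where s_m[measurable]: "\<And>i. (\<lambda>a. s a i :: real) \<in> borel_measurable (PiM I (\<lambda>_. borel))"
    and s1: "\<And>a. (\<Sum>i\<in>I. (s a i)\<^sup>2) \<le> 1"
    and s2: "\<And>a b. F a - 1 / K + (\<Sum>i\<in>I. s a i * (b i - a i)) \<le> F b"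
  proof (rule measurable_approx_subgradient)
    show "1 / real K > 0" using K by simp
  qed (rule that, assumption+)
  have [measurable]: "(\<lambda>a. s a i) \<in> borel_measurable \<mu>" "F \<in> borel_measurable \<mu>" for i
    unfolding measurable_std_gauss_PiM by (rule s_m, rule measurable_F)
  interpret G: prob_space std_gauss by (rule prob_space_std_gauss)
  interpret \<mu>: prob_space \<mu> by (rule prob_space_PiM) (rule prob_space_std_gauss)
  interpret MM: pair_prob_space \<mu> \<mu> ..
  let ?M = "\<mu> \<Otimes>\<^sub>M \<mu>"
  define \<psi> where "\<psi> z = 1 / K + (1 - cos \<delta>) * sqrt (\<Sum>i\<in>I. (fst z i)\<^sup>2) + sin \<delta> * \<bar>\<Sum>i\<in>I. s (fst z) i * snd z i\<bar>" for z
  have sd: "0 \<le> sin \<delta>" "0 \<le> 1 - cos \<delta>"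
    using \<delta> sin_ge_zero[of \<delta>] K pi_ge_zero by (auto simp: \<delta>_def divide_le_eq mult_le_cancel_left1)
  have \<psi>0: "\<psi> z \<ge> 0" for z unfolding \<psi>_def using sd by (auto intro!: add_nonneg_nonneg mult_nonneg_nonneg sum_nonneg)
  have \<psi>m[measurable]: "\<psi> \<in> borel_measurable ?M" unfolding \<psi>_def by measurable
  define \<theta> where "\<theta> j = real j * \<delta>" for j
  define U where "U j z = (\<lambda>i\<in>I. cos (\<theta> j) * fst z i + sin (\<theta> j) * snd z i)" for j :: nat and z :: "('i \<Rightarrow> real) \<times> ('i \<Rightarrow> real)"
  define V where "V j z = (\<lambda>i\<in>I. cos (\<theta> j) * snd z i - sin (\<theta> j) * fst z i)" for j :: nat and z :: "('i \<Rightarrow> real) \<times> ('i \<Rightarrow> real)"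
  \<comment> \<open>The subgradient is taken at the new point \<open>U (Suc j) z\<close>: its
    supporting function bounds \<open>F\<close> from below at the old point, hence the increase from
    above.\<close>
  have step: "F (U (Suc j) z) - F (U j z) \<le> \<psi> (U (Suc j) z, V (Suc j) z)" for j z
  proof -
    let ?u = "U (Suc j) z" and ?v = "V (Suc j) z"
    have \<theta>: "\<theta> j = \<theta> (Suc j) - \<delta>" by (simp add: \<theta>_def algebra_simps)
    have "?u i - U j z i = (1 - cos \<delta>) * ?u i + sin \<delta> * ?v i" if "i \<in> I" for i
    proof -
      have "U j z i = cos \<delta> * ?u i - sin \<delta> * ?v i"
        using that unfolding U_def V_def by (simp add: \<theta> cos_diff sin_diff algebra_simps)
      then show ?thesis by (simp add: algebra_simps)
    qed
    then have "(\<Sum>i\<in>I. s ?u i * (U j z i - ?u i)) = - (\<Sum>i\<in>I. s ?u i * ((1 - cos \<delta>) * ?u i + sin \<delta> * ?v i))"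
      unfolding sum_negf[symmetric] by (intro sum.cong refl) (simp add: algebra_simps)
    also have "(\<Sum>i\<in>I. s ?u i * ((1 - cos \<delta>) * ?u i + sin \<delta> * ?v i))
      = (1 - cos \<delta>) * (\<Sum>i\<in>I. s ?u i * ?u i) + sin \<delta> * (\<Sum>i\<in>I. s ?u i * ?v i)"
      by (simp add: sum_distrib_left sum.distrib[symmetric] algebra_simps)
    finally have e: "(\<Sum>i\<in>I. s ?u i * (U j z i - ?u i)) = - ((1 - cos \<delta>) * (\<Sum>i\<in>I. s ?u i * ?u i) + sin \<delta> * (\<Sum>i\<in>I. s ?u i * ?v i))" .
    have "(1 - cos \<delta>) * (\<Sum>i\<in>I. s ?u i * ?u i) \<le> (1 - cos \<delta>) * sqrt (\<Sum>i\<in>I. (?u i)\<^sup>2)"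
      using sum_mult_le_of_norm[OF s1[of ?u], of ?u] sd by (intro mult_left_mono) auto
    moreover have "sin \<delta> * (\<Sum>i\<in>I. s ?u i * ?v i) \<le> sin \<delta> * \<bar>\<Sum>i\<in>I. s ?u i * ?v i\<bar>"
      using sd by (intro mult_left_mono) auto
    ultimately show ?thesis
      using s2[of ?u "U j z"] unfolding e \<psi>_def by simp
  qed
  have U0: "F (U 0 z) = F (fst z)" for z by (rule F_cong) (simp add: U_def \<theta>_def)
  have UK: "F (U K z) = F (snd z)" for z
    by (rule F_cong) (use K in \<open>simp add: U_def \<theta>_def \<delta>_def cos_pi_half sin_pi_half\<close>)
  have path: "(max 0 (F (snd z) - F (fst z)))\<^sup>2 \<le> K * (\<Sum>j<K. (\<psi> (U (Suc j) z, V (Suc j) z))\<^sup>2)" for z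
  proof -
    let ?p = "\<lambda>j. \<psi> (U (Suc j) z, V (Suc j) z)"
    have "F (snd z) - F (fst z) = (\<Sum>j<K. F (U (Suc j) z) - F (U j z))"

      by (simp only: sum_lessThan_telescope[of "\<lambda>j. F (U j z)" K] U0 UK)
    also have "\<dots> \<le> (\<Sum>j<K. ?p j)" by (intro sum_mono step)
    finally have "max 0 (F (snd z) - F (fst z)) \<le> (\<Sum>j<K. ?p j)" using \<psi>0 by (simp add: sum_nonneg)
    then have "(max 0 (F (snd z) - F (fst z)))\<^sup>2 \<le> (\<Sum>j<K. ?p j)\<^sup>2" by (intro power_mono) auto
    also have "\<dots> \<le> K * (\<Sum>j<K. (?p j)\<^sup>2)"
      using Cauchy_Schwarz_ineq_sum[of "\<lambda>_. 1" ?p "{..<K}"] by simp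
    finally show ?thesis .
  qed
  have mean: "(\<integral>\<^sup>+z. ennreal ((\<psi> (U j z, V j z))\<^sup>2) \<partial>?M) = (\<integral>\<^sup>+z. ennreal ((\<psi> z)\<^sup>2) \<partial>?M)" for j
    unfolding U_def V_def
    by (rule nn_integral_std_gauss_PiM_rotate[OF I, where f = "\<lambda>z. ennreal ((\<psi> z)\<^sup>2)"]) simp_all
  have UVm[measurable]: "(\<lambda>z. (U j z, V j z)) \<in> ?M \<rightarrow>\<^sub>M ?M" for j
    unfolding U_def V_def by (intro measurable_Pair measurable_restrict) auto
  have n2: "(\<integral>\<^sup>+z. ennreal (\<Sum>i\<in>I. (fst z i)\<^sup>2) \<partial>?M) = card I"
  proof -
    have "(\<integral>\<^sup>+z. ennreal (\<Sum>i\<in>I. (fst z i)\<^sup>2) \<partial>?M) = (\<integral>\<^sup>+x. \<integral>\<^sup>+y. ennreal (\<Sum>i\<in>I. (x i)\<^sup>2) \<partial>\<mu> \<partial>\<mu>)"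
      by (subst \<mu>.nn_integral_fst[symmetric]) simp_all
    also have "\<dots> = (\<integral>\<^sup>+x. (\<Sum>i\<in>I. ennreal ((x i)\<^sup>2)) \<partial>\<mu>)"
      by (simp add: \<mu>.emeasure_space_1 sum_ennreal)
    also have "\<dots> = (\<Sum>i\<in>I. \<integral>\<^sup>+x. ennreal ((x i)\<^sup>2) \<partial>\<mu>)"
      by (rule nn_integral_sum) measurable
    also have "\<dots> = (\<Sum>i\<in>I. 1)"
    proof (rule sum.cong[OF refl])
      fix i assume i: "i \<in> I"
      show "(\<integral>\<^sup>+x. ennreal ((x i)\<^sup>2) \<partial>\<mu>) = 1"
        using nn_integral_std_gauss_PiM_inner_square[OF I, of "\<lambda>j. if j = i then 1 else 0"] i I
        by (simp add: if_distrib if_distribR cong: if_cong)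
    qed
    finally show ?thesis by simp
  qed
  \<comment> \<open>For a fixed first component, the sum has second moment at most 1 in the Gaussian
    second component, so the main term carries no factor \<open>card I\<close>.\<close>
  have s_int: "(\<integral>\<^sup>+z. ennreal ((\<Sum>i\<in>I. s (fst z) i * snd z i)\<^sup>2) \<partial>?M) \<le> 1"
  proof -
    have "(\<integral>\<^sup>+z. ennreal ((\<Sum>i\<in>I. s (fst z) i * snd z i)\<^sup>2) \<partial>?M) = (\<integral>\<^sup>+x. \<integral>\<^sup>+y. ennreal ((\<Sum>i\<in>I. s x i * y i)\<^sup>2) \<partial>\<mu> \<partial>\<mu>)"
      by (subst \<mu>.nn_integral_fst[symmetric]) simp_all
    also have "\<dots> = (\<integral>\<^sup>+x. ennreal (\<Sum>i\<in>I. (s x i)\<^sup>2) \<partial>\<mu>)"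
      by (simp add: nn_integral_std_gauss_PiM_inner_square[OF I])
    also have "\<dots> \<le> (\<integral>\<^sup>+x. 1 \<partial>\<mu>)"
      by (intro nn_integral_mono) (use s1 in simp)
    finally show ?thesis by (simp add: \<mu>.emeasure_space_1)
  qed
  have c: "1 - cos \<delta> \<le> 2 / (real K)\<^sup>2"
  proof -
    have "1 - cos \<delta> \<le> \<delta>\<^sup>2 / 2"
      using abs_sin_x_le_abs_x[of "\<delta> / 2"] abs_le_square_iff[of "sin (\<delta> / 2)" "\<delta> / 2"] cos_double_sin[of "\<delta> / 2"]
      by (simp add: power_divide)
    also have "\<delta>\<^sup>2 \<le> (2 / K)\<^sup>2" using \<delta> by (intro power_mono) auto
    finally show ?thesis by (simp add: power_divide)
  qed
  have sn: "sin \<delta> \<le> 2 / K" using sin_x_le_x[of \<delta>] \<delta> by linarith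
  have pointwise: "(\<psi> z)\<^sup>2 \<le> (3 / (real K)\<^sup>2) * (1 + (4 / (real K)\<^sup>2) * (\<Sum>i\<in>I. (fst z i)\<^sup>2) + 4 * (\<Sum>i\<in>I. s (fst z) i * snd z i)\<^sup>2)" for z
  proof -
    define A where "A = sqrt (\<Sum>i\<in>I. (fst z i)\<^sup>2)"
    define B where "B = \<bar>\<Sum>i\<in>I. s (fst z) i * snd z i\<bar>"
    have A2: "A\<^sup>2 = (\<Sum>i\<in>I. (fst z i)\<^sup>2)" "A \<ge> 0" unfolding A_def by (simp_all add: sum_nonneg)
    have B2: "B\<^sup>2 = (\<Sum>i\<in>I. s (fst z) i * snd z i)\<^sup>2" "B \<ge> 0" unfolding B_def by simp_all
    have "\<psi> z \<le> 1 / K + 2 / (real K)\<^sup>2 * A + 2 / K * B"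
      unfolding \<psi>_def A_def[symmetric] B_def[symmetric]
      using c sn A2 B2 by (intro add_mono mult_right_mono) auto
    then have "(\<psi> z)\<^sup>2 \<le> (1 / K + 2 / (real K)\<^sup>2 * A + 2 / K * B)\<^sup>2" using \<psi>0 by (intro power_mono)
    also have "\<dots> \<le> 3 * ((1 / K)\<^sup>2 + (2 / (real K)\<^sup>2 * A)\<^sup>2 + (2 / K * B)\<^sup>2)"
    proof -
      have "(a + b + c)\<^sup>2 \<le> 3 * (a\<^sup>2 + b\<^sup>2 + c\<^sup>2)" for a b c :: real
      proof -
        have "0 \<le> (a - b)\<^sup>2 + (a - c)\<^sup>2 + (b - c)\<^sup>2" by simp
        then show ?thesis by (simp add: power2_eq_square algebra_simps)
      qed
      then show ?thesis .
    qed
    also have "\<dots> = (3 / (real K)\<^sup>2) * (1 + (4 / (real K)\<^sup>2) * A\<^sup>2 + 4 * B\<^sup>2)"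
      using K by (simp add: field_simps power2_eq_square)
    finally show ?thesis unfolding A2 B2 .
  qed
  have split: "ennreal (A * (1 + B * x + 4 * y)) = ennreal A * (1 + ennreal B * ennreal x + 4 * ennreal y)"
    if "0 \<le> A" "0 \<le> B" "0 \<le> x" "0 \<le> y" for A B x y
    using that by (simp add: ennreal_mult ennreal_plus)
  have "(\<integral>\<^sup>+z. ennreal ((\<psi> z)\<^sup>2) \<partial>?M)
    \<le> (\<integral>\<^sup>+z. ennreal (3 / (real K)\<^sup>2) * (1 + ennreal (4 / (real K)\<^sup>2) * ennreal (\<Sum>i\<in>I. (fst z i)\<^sup>2) + 4 * ennreal ((\<Sum>i\<in>I. s (fst z) i * snd z i)\<^sup>2)) \<partial>?M)"
  proof (rule nn_integral_mono)
    fix z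
    show "ennreal ((\<psi> z)\<^sup>2) \<le> ennreal (3 / (real K)\<^sup>2) * (1 + ennreal (4 / (real K)\<^sup>2) * ennreal (\<Sum>i\<in>I. (fst z i)\<^sup>2) + 4 * ennreal ((\<Sum>i\<in>I. s (fst z) i * snd z i)\<^sup>2))"
    proof (subst split[symmetric])
      show "ennreal ((\<psi> z)\<^sup>2) \<le> ennreal (3 / (real K)\<^sup>2 * (1 + 4 / (real K)\<^sup>2 * (\<Sum>i\<in>I. (fst z i)\<^sup>2) + 4 * (\<Sum>i\<in>I. s (fst z) i * snd z i)\<^sup>2))"
        by (rule ennreal_leI[OF pointwise])
    qed (simp_all add: sum_nonneg)
  qed
  also have "\<dots> = ennreal (3 / (real K)\<^sup>2) * (1 + ennreal (4 / (real K)\<^sup>2) * (\<integral>\<^sup>+z. ennreal (\<Sum>i\<in>I. (fst z i)\<^sup>2) \<partial>?M) + 4 * (\<integral>\<^sup>+z. ennreal ((\<Sum>i\<in>I. s (fst z) i * snd z i)\<^sup>2) \<partial>?M))"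
    by (simp add: nn_integral_cmult nn_integral_add MM.emeasure_space_1)
  also have "\<dots> \<le> ennreal (3 / (real K)\<^sup>2) * (1 + ennreal (4 / (real K)\<^sup>2) * card I + 4 * 1)"
    unfolding n2 by (intro mult_left_mono add_mono s_int) auto
  also have "\<dots> = ennreal (3 / (real K)\<^sup>2 * (1 + 4 / (real K)\<^sup>2 * card I + 4 * 1))"
    using split[of "3 / (real K)\<^sup>2" "4 / (real K)\<^sup>2" "real (card I)" 1]
    by (simp add: ennreal_of_nat_eq_real_of_nat)
  \<comment> \<open>\<open>27 = 3 * (1 + 4 + 4)\<close>: the 3 comes from squaring a sum of three
    terms, one 4 bounds the dimension term, the other belongs to the sine term.\<close>
  also have "\<dots> \<le> ennreal (27 / (real K)\<^sup>2)"
  proof (rule ennreal_leI)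
    have "real (card I) \<le> (real K)\<^sup>2" by (simp add: K_def power2_eq_square algebra_simps)
    then have "4 / (real K)\<^sup>2 * card I \<le> 4" using K by (simp add: field_simps)
    then have "3 / (real K)\<^sup>2 * (1 + 4 / (real K)\<^sup>2 * card I + 4 * 1) \<le> 3 / (real K)\<^sup>2 * 9"
      by (intro mult_left_mono) auto
    then show "3 / (real K)\<^sup>2 * (1 + 4 / (real K)\<^sup>2 * card I + 4 * 1) \<le> 27 / (real K)\<^sup>2" by simp
  qed
  finally have bound: "(\<integral>\<^sup>+z. ennreal ((\<psi> z)\<^sup>2) \<partial>?M) \<le> ennreal (27 / (real K)\<^sup>2)" .
  have "(\<integral>\<^sup>+z. ennreal ((max 0 (F (snd z) - F (fst z)))\<^sup>2) \<partial>?M)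
    \<le> (\<integral>\<^sup>+z. of_nat K * (\<Sum>j<K. ennreal ((\<psi> (U (Suc j) z, V (Suc j) z))\<^sup>2)) \<partial>?M)"
  proof (rule nn_integral_mono)
    fix z
    show "ennreal ((max 0 (F (snd z) - F (fst z)))\<^sup>2) \<le> of_nat K * (\<Sum>j<K. ennreal ((\<psi> (U (Suc j) z, V (Suc j) z))\<^sup>2))"
      using ennreal_leI[OF path[of z]] by (simp add: ennreal_mult sum_ennreal sum_nonneg ennreal_of_nat_eq_real_of_nat)
  qed
  also have "\<dots> = of_nat K * (\<Sum>j<K. \<integral>\<^sup>+z. ennreal ((\<psi> (U (Suc j) z, V (Suc j) z))\<^sup>2) \<partial>?M)"
    by (subst nn_integral_cmult, simp, subst nn_integral_sum) simp_all
  also have "\<dots> \<le> of_nat K * (of_nat K * ennreal (27 / (real K)\<^sup>2))"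
    unfolding mean using bound by (intro mult_left_mono) (auto intro!: mult_left_mono)
  also have "\<dots> = 27"
    using K by (simp add: ennreal_of_nat_eq_real_of_nat ennreal_mult[symmetric] power2_eq_square)
  finally show ?thesis .
qed

text \<open>So far only increases of \<open>F\<close> were estimated. The squared difference is the
  sum of the squares of its two positive parts, whose integrals agree after exchanging the
  independent vectors; hence twice 27.\<close>

lemma nn_integral_square_diff_le:
  "(\<integral>\<^sup>+x. \<integral>\<^sup>+y. ennreal ((F x - F y)\<^sup>2) \<partial>\<mu> \<partial>\<mu>) \<le> 54"
proof -
  have [measurable]: "F \<in> borel_measurable \<mu>"
    unfolding measurable_std_gauss_PiM by (rule measurable_F)
  interpret \<mu>: prob_space \<mu> by (rule prob_space_PiM) (rule prob_space_std_gauss)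
  interpret MM: pair_prob_space \<mu> \<mu> ..
  let ?J = "\<integral>\<^sup>+x. \<integral>\<^sup>+y. ennreal ((max 0 (F y - F x))\<^sup>2) \<partial>\<mu> \<partial>\<mu>"
  have J: "?J \<le> 27"
    using nn_integral_increment_le by (subst (asm) \<mu>.nn_integral_fst[symmetric]) simp_all
  have "(\<integral>\<^sup>+x. \<integral>\<^sup>+y. ennreal ((F x - F y)\<^sup>2) \<partial>\<mu> \<partial>\<mu>)
    = (\<integral>\<^sup>+x. \<integral>\<^sup>+y. ennreal ((max 0 (F x - F y))\<^sup>2) + ennreal ((max 0 (F y - F x))\<^sup>2) \<partial>\<mu> \<partial>\<mu>)"
    by (intro nn_integral_cong) (auto simp: max_def power2_commute)
  also have "\<dots> = (\<integral>\<^sup>+x. \<integral>\<^sup>+y. ennreal ((max 0 (F x - F y))\<^sup>2) \<partial>\<mu> \<partial>\<mu>) + ?J"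
    by (simp add: nn_integral_add)
  also have "(\<integral>\<^sup>+x. \<integral>\<^sup>+y. ennreal ((max 0 (F x - F y))\<^sup>2) \<partial>\<mu> \<partial>\<mu>) = ?J"
    by (rule MM.Fubini') simp
  also have "?J + ?J \<le> 27 + 27" by (intro add_mono J)
  finally show ?thesis by simp
qed

end

section \<open>Lower bounds for typical values by sign changes\<close>

lemma distr_std_gauss_uminus: "distr std_gauss std_gauss uminus = std_gauss"
proof (rule measure_eqI)
  fix A :: "real set" assume "A \<in> sets (distr std_gauss std_gauss uminus)"
  then have A[measurable]: "A \<in> sets borel" by simp
  have "emeasure (distr std_gauss std_gauss uminus) A = (\<integral>\<^sup>+x. indicator A (- x) \<partial>std_gauss)"
    by (subst nn_integral_indicator[symmetric], simp, subst nn_integral_distr) simp_all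
  also have "\<dots> = (\<integral>\<^sup>+x. ennreal (std_normal_density (- x)) * indicator A (- x) \<partial>lborel)"
    unfolding std_gauss_def by (subst nn_integral_density) (simp_all add: std_normal_density_def)
  also have "\<dots> = (\<integral>\<^sup>+x. ennreal (std_normal_density x) * indicator A x \<partial>lborel)"
    by (subst (2) nn_integral_real_affine[where c = "-1" and t = 0]) simp_all
  also have "\<dots> = (\<integral>\<^sup>+x. indicator A x \<partial>std_gauss)"
    unfolding std_gauss_def by (subst nn_integral_density) simp_all
  finally show "emeasure (distr std_gauss std_gauss uminus) A = emeasure std_gauss A" by simp
qed simp

text \<open>Strictness makes the \<open>k\<close>-th power tend to 0: for large \<open>k\<close>,
  some coordinate of a Gaussian vector exceeds \<open>t\<close> in absolute value with probability
  at least one half.\<close>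

lemma emeasure_std_gauss_bounded_less_1: "emeasure std_gauss {u. \<bar>u\<bar> \<le> t} < 1"
proof -
  interpret G: prob_space std_gauss by (rule prob_space_std_gauss)
  have pos: "ennreal (std_normal_density x) \<noteq> 0" for x
    using normal_density_pos[of 1 0 x] by (simp add: ennreal_eq_0_iff not_le)
  have "emeasure std_gauss {t<..<t+1} \<noteq> 0"
  proof
    assume "emeasure std_gauss {t<..<t+1} = 0"
    then have "AE x in lborel. x \<notin> {t<..<t+1}"
      unfolding std_gauss_def
      by (subst (asm) emeasure_density, simp, simp, subst (asm) nn_integral_0_iff_AE)
         (auto simp: pos indicator_def split: if_splits)
    then have "emeasure lborel {t<..<t+1} = 0" by (subst (asm) AE_iff_measurable[where N = "{t<..<t+1}"]) auto
    then show False by simp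
  qed
  then have "emeasure std_gauss {t<..<t+1} > 0" by (simp add: zero_less_iff_neq_zero)
  then have "G.prob {t<..<t+1} > 0" by (simp add: G.emeasure_eq_measure)
  also have "G.prob {t<..<t+1} \<le> G.prob (space std_gauss - {u. \<bar>u\<bar> \<le> t})" by (intro G.finite_measure_mono) auto
  also have "\<dots> = 1 - G.prob {u. \<bar>u\<bar> \<le> t}" by (rule G.prob_compl) simp
  finally show ?thesis by (simp add: G.emeasure_eq_measure)
qed

text \<open>A vector plus its flip is twice its \<open>i\<close>-th component, so by the triangle
  inequality a norm is at least as large at one of the two as at that component.\<close>

definition flip_others :: "nat \<Rightarrow> (nat \<Rightarrow> real) \<Rightarrow> nat \<Rightarrow> real"
  where "flip_others i a = (\<lambda>j. if j = i then a j else - a j)"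

lemma distr_flip_others:
  fixes k :: nat
  defines "\<mu> \<equiv> PiM {..<k} (\<lambda>_. std_gauss)"
  shows "distr \<mu> \<mu> (\<lambda>x. \<lambda>j\<in>{..<k}. flip_others i x j) = \<mu>"
proof -
  interpret G: prob_space std_gauss by (rule prob_space_std_gauss)
  interpret P: product_prob_space "\<lambda>_. std_gauss" "{..<k}" ..
  let ?f = "\<lambda>x. \<lambda>j\<in>{..<k}. flip_others i x j"
  have m[measurable]: "?f \<in> \<mu> \<rightarrow>\<^sub>M \<mu>" unfolding \<mu>_def flip_others_def
    by (intro measurable_restrict) (auto simp: measurable_If)
  have u: "emeasure std_gauss (uminus -` A) = emeasure std_gauss A" if "A \<in> sets borel" for A :: "real set"
    using that by (subst (2) distr_std_gauss_uminus[symmetric], subst emeasure_distr) auto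
  have um: "uminus -` A \<in> sets borel" if "A \<in> sets borel" for A :: "real set"
    using measurable_sets[of uminus borel borel A] that by simp
  show ?thesis unfolding \<mu>_def
  proof (rule P.PiM_eqI)
    fix A assume A: "\<And>j. j \<in> {..<k} \<Longrightarrow> A j \<in> sets std_gauss"
    let ?B = "\<lambda>j. if j = i then A j else uminus -` A j"
    have "?f -` Pi\<^sub>E {..<k} A \<inter> space (PiM {..<k} (\<lambda>_. std_gauss)) = Pi\<^sub>E {..<k} ?B"
      unfolding set_eq_iff vimage_def Int_iff mem_Collect_eq space_PiM PiE_iff space_std_gauss flip_others_def
      by (simp add: Ball_def)
    then have "emeasure (distr (PiM {..<k} (\<lambda>_. std_gauss)) (PiM {..<k} (\<lambda>_. std_gauss)) ?f) (Pi\<^sub>E {..<k} A)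
      = emeasure (PiM {..<k} (\<lambda>_. std_gauss)) (Pi\<^sub>E {..<k} ?B)"
      using A m[unfolded \<mu>_def] by (subst emeasure_distr) (auto intro!: sets_PiM_I_finite)
    also have "\<dots> = (\<Prod>j<k. emeasure std_gauss (?B j))"
      using A um by (subst P.emeasure_PiM) auto
    also have "\<dots> = (\<Prod>j<k. emeasure std_gauss (A j))"
      using A u by (intro prod.cong) auto
    finally show "emeasure (distr (PiM {..<k} (\<lambda>_. std_gauss)) (PiM {..<k} (\<lambda>_. std_gauss)) ?f) (Pi\<^sub>E {..<k} A)
      = (\<Prod>j\<in>{..<k}. emeasure std_gauss (A j))" .
  qed simp_all
qed

locale flippable_subgradient = bounded_subgradient "{..<k}" F for k :: nat and F +
  fixes c :: real
  assumes c: "c > 0" and flip: "\<And>a i. i < k \<Longrightarrow> c * \<bar>a i\<bar> \<le> max (F a) (F (flip_others i a))"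
begin

text \<open>On the event that coordinate \<open>i\<close> is the first one exceeding \<open>t\<close>, which is invariant under
  \<^term>\<open>flip_others i\<close>, at least one of \<open>a\<close> and its flip has a large value.\<close>
lemma measure_ge_quarter:
  assumes q: "measure std_gauss {u. \<bar>u\<bar> \<le> t} ^ k \<le> 1 / 2" and t: "t > 0"
  shows "measure \<mu> {x \<in> space \<mu>. c * t \<le> F x} \<ge> 1 / 4"
proof -
  interpret G: prob_space std_gauss by (rule prob_space_std_gauss)
  interpret \<mu>: prob_space \<mu> by (rule prob_space_PiM) (rule prob_space_std_gauss)
  interpret P: product_prob_space "\<lambda>_. std_gauss" "{..<k}" ..
  have [measurable]: "F \<in> borel_measurable \<mu>"
    unfolding measurable_std_gauss_PiM by (rule measurable_F)
  let ?fl = "\<lambda>i x. \<lambda>j\<in>{..<k}. flip_others i x j"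
  have flm[measurable]: "?fl i \<in> \<mu> \<rightarrow>\<^sub>M \<mu>" for i unfolding flip_others_def
    by (intro measurable_restrict) (auto simp: measurable_If)
  define E where "E = {x \<in> space \<mu>. c * t \<le> F x}"
  \<comment> \<open>Singling out the first large coordinate makes the events disjoint, so that their
    probabilities add up without losing a factor \<open>k\<close>.\<close>
  define A where "A i = {x \<in> space \<mu>. t < \<bar>x i\<bar> \<and> (\<forall>j<i. \<bar>x j\<bar> \<le> t)}" for i
  have E[measurable]: "E \<in> sets \<mu>" unfolding E_def by measurable
  have A[measurable]: "A i \<in> sets \<mu>" if "i < k" for i
  proof -
    have [measurable]: "(\<lambda>x. x j) \<in> borel_measurable \<mu>" if "j \<le> i" for j
      using that \<open>i < k\<close> by (simp add: measurable_component_singleton)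
    have "{x \<in> space \<mu>. t < \<bar>x i\<bar> \<and> (\<forall>j\<in>{..<i}. \<bar>x j\<bar> \<le> t)} \<in> sets \<mu>"
      by (intro sets.sets_Collect sets.sets_Collect_finite_All) auto
    then show ?thesis by (simp add: A_def lessThan_iff Ball_def)
  qed
  have half: "measure \<mu> (A i) \<le> 2 * measure \<mu> (E \<inter> A i)" if i: "i < k" for i
  proof -
    have "A i \<subseteq> (E \<inter> A i) \<union> (?fl i -` (E \<inter> A i) \<inter> space \<mu>)"
    proof
      fix x assume x: "x \<in> A i"
      then have "c * t \<le> c * \<bar>x i\<bar>" using c by (simp add: A_def)
      also have "\<dots> \<le> max (F x) (F (flip_others i x))" by (rule flip[OF i])
      also have "F (flip_others i x) = F (?fl i x)" by (rule F_cong) simp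
      finally have "c * t \<le> F x \<or> c * t \<le> F (?fl i x)" by (simp add: le_max_iff_disj)
      moreover have "?fl i x \<in> A i" using x i measurable_space[OF flm, of x i]
        by (auto simp: A_def flip_others_def)
      moreover have "x \<in> space \<mu>" "?fl i x \<in> space \<mu>" using x measurable_space[OF flm, of x i] by (auto simp: A_def)
      ultimately show "x \<in> (E \<inter> A i) \<union> (?fl i -` (E \<inter> A i) \<inter> space \<mu>)" using x by (auto simp: E_def)
    qed
    then have "measure \<mu> (A i) \<le> measure \<mu> ((E \<inter> A i) \<union> (?fl i -` (E \<inter> A i) \<inter> space \<mu>))"
      using i by (intro \<mu>.finite_measure_mono) (auto intro!: sets.Un measurable_sets[OF flm] sets.Int)
    also have "\<dots> \<le> measure \<mu> (E \<inter> A i) + measure \<mu> (?fl i -` (E \<inter> A i) \<inter> space \<mu>)"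
      using i by (intro measure_Un_le) (auto intro!: measurable_sets[OF flm])
    also have "measure \<mu> (?fl i -` (E \<inter> A i) \<inter> space \<mu>) = measure (distr \<mu> \<mu> (?fl i)) (E \<inter> A i)"
      using i by (subst measure_distr) auto
    also have "\<dots> = measure \<mu> (E \<inter> A i)" by (simp only: distr_flip_others)
    finally show ?thesis by simp
  qed
  have disj: "disjoint_family_on A {..<k}"
  proof -
    have "A i \<inter> A j = {}" if "i < j" for i j
      using that by (force simp: A_def)
    then show ?thesis unfolding disjoint_family_on_def by (metis Int_commute linorder_neqE_nat)
  qed
  have "space \<mu> - (\<Union>i<k. A i) = Pi\<^sub>E {..<k} (\<lambda>_. {u. \<bar>u\<bar> \<le> t})"
  proof (intro set_eqI iffI)
    fix x assume x: "x \<in> space \<mu> - (\<Union>i<k. A i)"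
    have "\<bar>x i\<bar> \<le> t" if "i < k" for i using that
    proof (induction i rule: less_induct)
      case (less i)
      then have "\<forall>j<i. \<bar>x j\<bar> \<le> t" by auto
      with x less.prems show ?case by (auto simp: A_def not_less)
    qed
    with x show "x \<in> Pi\<^sub>E {..<k} (\<lambda>_. {u. \<bar>u\<bar> \<le> t})" by (auto simp: space_PiM PiE_iff)
  next
    fix x assume x: "x \<in> Pi\<^sub>E {..<k} (\<lambda>_. {u. \<bar>u\<bar> \<le> t})"
    have "\<bar>x i\<bar> \<le> t" if "i < k" for i using x that by (auto simp: PiE_iff)
    then have "x \<notin> A i" if "i < k" for i using that by (auto simp: A_def not_less)
    moreover have "x \<in> space \<mu>" using x by (auto simp: space_PiM PiE_iff)
    ultimately show "x \<in> space \<mu> - (\<Union>i<k. A i)" by auto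
  qed
  moreover have "measure \<mu> (Pi\<^sub>E {..<k} (\<lambda>_. {u. \<bar>u\<bar> \<le> t})) = measure std_gauss {u. \<bar>u\<bar> \<le> t} ^ k"
  proof -
    have "emeasure \<mu> (Pi\<^sub>E {..<k} (\<lambda>_. {u. \<bar>u\<bar> \<le> t})) = ennreal (measure std_gauss {u. \<bar>u\<bar> \<le> t} ^ k)"
      by (subst P.emeasure_PiM) (simp_all add: G.emeasure_eq_measure ennreal_power)
    then show ?thesis by (simp add: \<mu>.emeasure_eq_measure)
  qed
  ultimately have "measure \<mu> (\<Union>i<k. A i) = 1 - measure std_gauss {u. \<bar>u\<bar> \<le> t} ^ k"
    using \<mu>.prob_compl[of "\<Union>i<k. A i"] A by (simp add: sets.finite_UN)
  then have "1 / 2 \<le> measure \<mu> (\<Union>i<k. A i)" using q by simp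
  also have "\<dots> = (\<Sum>i<k. measure \<mu> (A i))"
    using disj A by (intro \<mu>.finite_measure_finite_Union) auto
  also have "\<dots> \<le> (\<Sum>i<k. 2 * measure \<mu> (E \<inter> A i))" by (intro sum_mono half) simp
  also have "\<dots> = 2 * measure \<mu> (\<Union>i<k. E \<inter> A i)"
    unfolding sum_distrib_left[symmetric] using disj A
    by (subst \<mu>.finite_measure_finite_Union) (auto simp: disjoint_family_on_def)
  also have "\<dots> \<le> 2 * measure \<mu> E" using A by (intro mult_left_mono \<mu>.finite_measure_mono) auto
  finally show ?thesis by (simp add: E_def)
qed

text \<open>Since \<open>270 = 5 * 54\<close>, Markov's inequality excludes a set of measure at most
  \<open>1 / 5\<close>, which cannot contain a set of measure \<open>1 / 4\<close>. Centring at an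
  attained value lets one point satisfy both demands.\<close>

lemma exists_typical_value:
  assumes q: "measure std_gauss {u. \<bar>u\<bar> \<le> t} ^ k \<le> 1 / 2" and t: "t > 0"
  obtains y where "c * t \<le> F y" "(\<integral>\<^sup>+x. ennreal ((F x - F y)\<^sup>2) \<partial>\<mu>) \<le> 270"
proof -
  interpret \<mu>: prob_space \<mu> by (rule prob_space_PiM) (rule prob_space_std_gauss)
  have [measurable]: "F \<in> borel_measurable \<mu>"
    unfolding measurable_std_gauss_PiM by (rule measurable_F)
  define f where "f y = (\<integral>\<^sup>+x. ennreal ((F x - F y)\<^sup>2) \<partial>\<mu>)" for y
  have f[measurable]: "f \<in> borel_measurable \<mu>" unfolding f_def by measurable
  have int: "(\<integral>\<^sup>+y. f y \<partial>\<mu>) \<le> 54"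
    unfolding f_def using nn_integral_square_diff_le by (simp add: power2_commute)
  define B where "B = {y \<in> space \<mu>. 270 < f y}"
  have [measurable]: "B \<in> sets \<mu>" unfolding B_def by measurable
  have "ennreal 270 * emeasure \<mu> B = (\<integral>\<^sup>+y. ennreal 270 * indicator B y \<partial>\<mu>)"
    by (rule nn_integral_cmult_indicator[symmetric]) simp
  also have "\<dots> \<le> (\<integral>\<^sup>+y. f y \<partial>\<mu>)" by (intro nn_integral_mono) (auto simp: B_def indicator_def)
  also have "\<dots> \<le> ennreal 54" using int by simp
  finally have "ennreal (270 * measure \<mu> B) \<le> ennreal 54"
    by (simp add: \<mu>.emeasure_eq_measure ennreal_mult)
  then have B: "measure \<mu> B \<le> 1 / 5" by (subst (asm) ennreal_le_iff) simp_all
  have "\<not> {x \<in> space \<mu>. c * t \<le> F x} \<subseteq> B"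
  proof
    assume "{x \<in> space \<mu>. c * t \<le> F x} \<subseteq> B"
    then have "measure \<mu> {x \<in> space \<mu>. c * t \<le> F x} \<le> measure \<mu> B" by (intro \<mu>.finite_measure_mono) auto
    with B measure_ge_quarter[OF q t] show False by simp
  qed
  then obtain y where "y \<in> space \<mu>" "c * t \<le> F y" "\<not> 270 < f y" by (auto simp: B_def)
  then show ?thesis using that unfolding f_def by (simp add: not_less)
qed

text \<open>By rotation invariance each unit vector \<open>v\<close> maps the Gaussian matrix to a Gaussian vector, so
  Chebyshev's inequality and the union bound apply to a finite set of directions.\<close>
lemma exists_good_matrix:
  fixes V :: "(nat \<Rightarrow> real) set" and n :: nat
  assumes q: "measure std_gauss {u. \<bar>u\<bar> \<le> t} ^ k \<le> 1 / 2" and t: "t > 0" and e: "e > 0"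
    and V: "finite V" "\<And>v. v \<in> V \<Longrightarrow> (\<Sum>j<n. (v j)\<^sup>2) = 1"
    and large: "270 * real (card V) < (e * (c * t))\<^sup>2"
  obtains M :: real and w :: "nat \<Rightarrow> nat \<Rightarrow> real"
  where "M > 0" "\<And>v. v \<in> V \<Longrightarrow> \<bar>F (\<lambda>i. \<Sum>j<n. v j * w i j) - M\<bar> < e * M"
proof -
  interpret \<mu>: prob_space \<mu> by (rule prob_space_PiM) (rule prob_space_std_gauss)
  have [measurable]: "F \<in> borel_measurable \<mu>"
    unfolding measurable_std_gauss_PiM by (rule measurable_F)
  obtain y where y: "c * t \<le> F y" "(\<integral>\<^sup>+x. ennreal ((F x - F y)\<^sup>2) \<partial>\<mu>) \<le> 270"
    using exists_typical_value[OF q t] .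
  define M where "M = F y"
  have ct: "c * t > 0" using c t by simp
  have M: "M > 0" "c * t \<le> M" using y ct by (auto simp: M_def)
  define B where "B = {x \<in> space \<mu>. e * M \<le> \<bar>F x - M\<bar>}"
  have Bm[measurable]: "B \<in> sets \<mu>" unfolding B_def by measurable
  have "ennreal ((e * M)\<^sup>2) * emeasure \<mu> B = (\<integral>\<^sup>+x. ennreal ((e * M)\<^sup>2) * indicator B x \<partial>\<mu>)"
    by (rule nn_integral_cmult_indicator[symmetric]) simp
  also have "\<dots> \<le> (\<integral>\<^sup>+x. ennreal ((F x - F y)\<^sup>2) \<partial>\<mu>)"
  proof (rule nn_integral_mono)
    fix x
    have "(e * M)\<^sup>2 \<le> (F x - M)\<^sup>2" if "x \<in> B"
      using that e M by (intro power2_le_iff_abs_le[THEN iffD2] abs_le_square_iff[THEN iffD1]) (auto simp: B_def)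
    then show "ennreal ((e * M)\<^sup>2) * indicator B x \<le> ennreal ((F x - F y)\<^sup>2)"
      by (auto simp: indicator_def M_def intro!: ennreal_leI)
  qed
  also have "\<dots> \<le> ennreal 270" using y by simp
  finally have "ennreal ((e * M)\<^sup>2 * measure \<mu> B) \<le> ennreal 270"
    by (simp add: \<mu>.emeasure_eq_measure ennreal_mult)
  then have "(e * M)\<^sup>2 * measure \<mu> B \<le> 270" by (subst (asm) ennreal_le_iff) simp_all
  moreover have "(e * (c * t))\<^sup>2 * measure \<mu> B \<le> (e * M)\<^sup>2 * measure \<mu> B"
    using e M ct by (intro mult_right_mono power_mono mult_left_mono) auto
  ultimately have B: "(e * (c * t))\<^sup>2 * measure \<mu> B \<le> 270" by linarith
  let ?N = "PiM {..<n} (\<lambda>_. std_gauss)"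
  let ?W = "PiM {..<k} (\<lambda>_. ?N)"
  have pN: "prob_space ?N" by (rule prob_space_PiM) (rule prob_space_std_gauss)
  interpret W: prob_space ?W by (rule prob_space_PiM) (rule pN)
  \<comment> \<open>Row \<open>i\<close> of the matrix is a Gaussian vector in dimension
    \<open>n\<close>, and coordinate \<open>i\<close> of \<open>Z v w\<close> is its inner product
    with \<open>v\<close>, of law \<open>std_gauss\<close> when \<open>v\<close> is a unit
    vector.\<close>
  define Z where "Z v = compose {..<k} (\<lambda>x. \<Sum>j<n. v j * x j)" for v :: "nat \<Rightarrow> real"
  have im: "(\<lambda>x. \<Sum>j<n. v j * x j) \<in> ?N \<rightarrow>\<^sub>M std_gauss" for v :: "nat \<Rightarrow> real" by measurable
  have Zm[measurable]: "Z v \<in> ?W \<rightarrow>\<^sub>M \<mu>" for v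
    unfolding Z_def compose_def
    by (intro measurable_restrict measurable_compose[OF measurable_component_singleton[where M = "\<lambda>_. ?N"] im])
  have Z: "distr ?W \<mu> (Z v) = \<mu>" if "v \<in> V" for v
    unfolding Z_def
    using distr_PiM_finite_prob_space'[of "{..<k}" "\<lambda>_. ?N" "\<lambda>_. std_gauss" "\<lambda>x. \<Sum>j<n. v j * x j"]
      pN prob_space_std_gauss im distr_std_gauss_PiM_inner[OF finite_lessThan V(2)[OF that]] by simp
  have "measure ?W (\<Union>v\<in>V. Z v -` B \<inter> space ?W) \<le> (\<Sum>v\<in>V. measure ?W (Z v -` B \<inter> space ?W))"
    by (rule measure_UNION_le[OF V(1)]) simp
  also have "\<dots> = (\<Sum>v\<in>V. measure \<mu> B)"
  proof (rule sum.cong[OF refl])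
    fix v assume "v \<in> V"
    have "measure ?W (Z v -` B \<inter> space ?W) = measure (distr ?W \<mu> (Z v)) B"
      by (rule measure_distr[symmetric]) simp_all
    then show "measure ?W (Z v -` B \<inter> space ?W) = measure \<mu> B" by (simp only: Z[OF \<open>v \<in> V\<close>])
  qed
  also have "\<dots> = card V * measure \<mu> B" by simp
  finally have le: "measure ?W (\<Union>v\<in>V. Z v -` B \<inter> space ?W) \<le> card V * measure \<mu> B" .
  have "card V * measure \<mu> B < 1"
  proof -
    have p: "(e * (c * t))\<^sup>2 > 0" using e c t by simp
    have "(e * (c * t))\<^sup>2 * (card V * measure \<mu> B) \<le> card V * 270"
      using mult_left_mono[OF B, of "card V"] by (simp add: algebra_simps)
    also have "\<dots> < (e * (c * t))\<^sup>2 * 1" using large by simp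
    finally show ?thesis using p by (simp only: mult_less_cancel_left_pos)
  qed
  with le have "measure ?W (\<Union>v\<in>V. Z v -` B \<inter> space ?W) < measure ?W (space ?W)" by (simp add: W.prob_space)
  moreover have "(\<Union>v\<in>V. Z v -` B \<inter> space ?W) \<in> sets ?W"
    using V(1) by (intro sets.finite_UN measurable_sets[OF Zm Bm])
  ultimately have "\<not> space ?W \<subseteq> (\<Union>v\<in>V. Z v -` B \<inter> space ?W)"
    using W.finite_measure_mono[of "space ?W" "\<Union>v\<in>V. Z v -` B \<inter> space ?W"] by linarith
  then obtain w where "w \<in> space ?W" "w \<notin> (\<Union>v\<in>V. Z v -` B \<inter> space ?W)" by blast
  then have w: "w \<in> space ?W" "\<And>v. v \<in> V \<Longrightarrow> Z v w \<notin> B" by auto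
  show ?thesis
  proof (rule that[OF M(1), of w])
    fix v assume "v \<in> V"
    have "Z v w \<in> space \<mu>" using measurable_space[OF Zm w(1)] .
    with w(2)[OF \<open>v \<in> V\<close>] have "\<bar>F (Z v w) - M\<bar> < e * M" by (simp add: B_def not_le)
    moreover have "F (Z v w) = F (\<lambda>i. \<Sum>j<n. v j * w i j)"
      by (rule F_cong) (simp add: Z_def compose_def)
    ultimately show "\<bar>F (\<lambda>i. \<Sum>j<n. v j * w i j) - M\<bar> < e * M" by simp
  qed
qed

end

subsection \<open>Dvoretzky's theorem\<close>

lemma flippable_subgradient_norm:
  fixes y :: "nat \<Rightarrow> 'a::real_normed_vector"
  assumes upper: "\<And>a. norm (\<Sum>l<k. a l *\<^sub>R y l) \<le> sqrt (\<Sum>l<k. (a l)\<^sup>2)"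
    and lower: "\<And>l. l < k \<Longrightarrow> 1 / 2 \<le> norm (y l)"
  shows "flippable_subgradient k (\<lambda>a. norm (\<Sum>l<k. a l *\<^sub>R y l)) (1 / 2)"
proof
  fix a :: "nat \<Rightarrow> real"
  obtain s where s: "(\<Sum>l<k. a l * s l) = norm (\<Sum>l<k. a l *\<^sub>R y l)"
    "\<And>b. (\<Sum>l<k. b l * s l) \<le> norm (\<Sum>l<k. b l *\<^sub>R y l)"
    using exists_norming_coefficients[of "{..<k}" a y] by auto
  \<comment> \<open>Testing the functional on its own coefficients and using \<open>upper\<close>
    gives \<open>r \<le> sqrt r\<close>, hence \<open>r \<le> 1\<close>.\<close>
  define r where "r = (\<Sum>l<k. (s l)\<^sup>2)"
  have r: "0 \<le> r" by (simp add: r_def sum_nonneg)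
  have "r \<le> sqrt r" using s(2)[of s] upper[of s] by (simp add: power2_eq_square r_def)
  then have "r * r \<le> sqrt r * sqrt r" using r by (intro mult_mono) auto
  then have "r * r \<le> r * 1" using r by simp
  then have "r \<le> 1" using r by (cases "r = 0") (simp_all add: mult_le_cancel_left)
  then have "(\<Sum>l<k. (s l)\<^sup>2) \<le> 1" by (simp add: r_def)
  moreover have "norm (\<Sum>l<k. a l *\<^sub>R y l) + (\<Sum>l<k. s l * (b l - a l)) \<le> norm (\<Sum>l<k. b l *\<^sub>R y l)" for b
    using s(2)[of b] s(1) by (simp add: right_diff_distrib sum_subtractf mult.commute)
  ultimately show "\<exists>s. (\<Sum>l<k. (s l)\<^sup>2) \<le> 1 \<and> (\<forall>b. norm (\<Sum>l<k. a l *\<^sub>R y l) + (\<Sum>l<k. s l * (b l - a l)) \<le> norm (\<Sum>l<k. b l *\<^sub>R y l))"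
    by blast
next
  fix a :: "nat \<Rightarrow> real" and i assume i: "i < k"
  have "(\<Sum>l<k. a l *\<^sub>R y l) + (\<Sum>l<k. flip_others i a l *\<^sub>R y l) = (\<Sum>l<k. if l = i then (2 * a i) *\<^sub>R y i else 0)"
    unfolding sum.distrib[symmetric] by (intro sum.cong) (auto simp: flip_others_def simp flip: scaleR_left_distrib)
  also have "\<dots> = (2 * a i) *\<^sub>R y i" using i by simp
  finally have "norm ((2 * a i) *\<^sub>R y i) \<le> norm (\<Sum>l<k. a l *\<^sub>R y l) + norm (\<Sum>l<k. flip_others i a l *\<^sub>R y l)"
    by (metis norm_triangle_ineq)
  moreover have "\<bar>a i\<bar> \<le> norm ((2 * a i) *\<^sub>R y i)"
    using mult_left_mono[OF lower[OF i], of "2 * \<bar>a i\<bar>"] by (simp add: abs_mult)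
  ultimately show "1 / 2 * \<bar>a i\<bar> \<le> max (norm (\<Sum>l<k. a l *\<^sub>R y l)) (norm (\<Sum>l<k. flip_others i a l *\<^sub>R y l))"
    by linarith
qed simp_all

lemma exists_almost_isometric_on_finite_set:
  assumes inf: "\<not> (\<exists>B :: 'a::real_normed_vector set. finite B \<and> span B = UNIV)"
    and V: "finite V" "\<And>v. v \<in> V \<Longrightarrow> (\<Sum>j<n. (v j)\<^sup>2) = 1" and e: "e > 0"
  shows "\<exists>z :: nat \<Rightarrow> 'a. \<forall>v\<in>V. \<bar>norm (\<Sum>j<n. v j *\<^sub>R z j) - 1\<bar> < e"
proof -
  \<comment> \<open>\<open>17^2 = 289 > 270\<close>, and the factor 2 offsets the constant
    \<open>1 / 2\<close> of \<open>flippable_subgradient_norm\<close>. Only \<open>V\<close> and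
    \<open>e\<close> determine \<open>t\<close>; \<open>k\<close> is chosen afterwards.\<close>
  define t where "t = 2 * (17 * (real (card V) + 1)) / e"
  have t: "t > 0" using e by (simp add: t_def)
  have "270 * real (card V) < (17 * (real (card V) + 1))\<^sup>2"
    by (simp add: power2_eq_square algebra_simps) (intro add_pos_nonneg; simp)
  also have "17 * (real (card V) + 1) = e * (1 / 2 * t)" using e by (simp add: t_def)
  finally have large: "270 * real (card V) < (e * (1 / 2 * t))\<^sup>2" .
  interpret G: prob_space std_gauss by (rule prob_space_std_gauss)
  let ?q = "measure std_gauss {u. \<bar>u\<bar> \<le> t}"
  have "?q < 1" using emeasure_std_gauss_bounded_less_1[of t] by (simp add: G.emeasure_eq_measure)
  then have "(\<lambda>k. ?q ^ k) \<longlonglongrightarrow> 0" by (intro LIMSEQ_power_zero) simp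
  then have "eventually (\<lambda>k. ?q ^ k < 1 / 2) sequentially" by (rule order_tendstoD) simp
  then have "eventually (\<lambda>k. ?q ^ k < 1 / 2 \<and> k > 0) sequentially"
    using eventually_gt_at_top[of 0] by (rule eventually_conj)
  then obtain k where k: "?q ^ k < 1 / 2" "k > 0"
    using eventually_happens'[OF sequentially_bot] by blast
  obtain y :: "nat \<Rightarrow> 'a" where y: "\<And>a. norm (\<Sum>l<k. a l *\<^sub>R y l) \<le> sqrt (\<Sum>l<k. (a l)\<^sup>2)"
    "\<And>l. l < k \<Longrightarrow> 1 / 2 \<le> norm (y l)"
    using Dvoretzky_Rogers[OF inf k(2)] by blast
  interpret flippable_subgradient k "\<lambda>a. norm (\<Sum>l<k. a l *\<^sub>R y l)" "1 / 2"
    by (rule flippable_subgradient_norm[OF y])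
  obtain M w where M: "M > 0" and w: "\<And>v. v \<in> V \<Longrightarrow> \<bar>norm (\<Sum>i<k. (\<Sum>j<n. v j * w i j) *\<^sub>R y i) - M\<bar> < e * M"
    using exists_good_matrix[OF less_imp_le[OF k(1)] t e V large] by blast
  define z where "z j = (\<Sum>i<k. w i j *\<^sub>R y i) /\<^sub>R M" for j
  show ?thesis
  proof (intro exI[of _ z] ballI)
    fix v assume v: "v \<in> V"
    have "(\<Sum>i<k. (\<Sum>j<n. v j * w i j) *\<^sub>R y i) = (\<Sum>i<k. \<Sum>j<n. v j *\<^sub>R w i j *\<^sub>R y i)"
      by (simp add: scaleR_sum_left)
    also have "\<dots> = (\<Sum>j<n. \<Sum>i<k. v j *\<^sub>R w i j *\<^sub>R y i)" by (rule sum.swap)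
    also have "\<dots> = (\<Sum>j<n. v j *\<^sub>R (\<Sum>i<k. w i j *\<^sub>R y i))" by (simp only: scaleR_sum_right)
    finally have "(\<Sum>j<n. v j *\<^sub>R z j) = (\<Sum>i<k. (\<Sum>j<n. v j * w i j) *\<^sub>R y i) /\<^sub>R M"
      unfolding z_def scaleR_left_commute[of _ "inverse M"] scaleR_sum_right[symmetric] by simp
    then have n: "norm (\<Sum>j<n. v j *\<^sub>R z j) = norm (\<Sum>i<k. (\<Sum>j<n. v j * w i j) *\<^sub>R y i) / M"
      using M by (simp add: divide_inverse)
    show "\<bar>norm (\<Sum>j<n. v j *\<^sub>R z j) - 1\<bar> < e"
      using w[OF v] M unfolding n by (simp add: abs_less_iff field_simps)
  qed
qed

text \<open>The directions to control are the normalised nonzero integer points of a cube. A vector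
  scaled to largest coordinate 1 is rounded to the grid; since the grid contains the coordinate
  vectors, the \<open>z j\<close> are bounded, and so is the effect of rounding on the
  image.\<close>

theorem Dvoretzky:
  assumes inf: "\<not> (\<exists>B :: 'a::real_normed_vector set. finite B \<and> span B = UNIV)" and e: "e > 0"
  shows "\<exists>z :: nat \<Rightarrow> 'a. \<forall>a. \<bar>norm (\<Sum>j<n. a j *\<^sub>R z j) - sqrt (\<Sum>j<n. (a j)\<^sup>2)\<bar> \<le> e * sqrt (\<Sum>j<n. (a j)\<^sup>2)"
proof -
  \<comment> \<open>\<open>d \<le> 1\<close> yields \<open>norm (z j) \<le> 2\<close>. Rounding
    costs \<open>2 * n / q\<close> in the image, \<open>n / q\<close> in the Euclidean norm and at
    most \<open>n / q\<close> in the term \<open>d * ?n b\<close>; \<open>q\<close> makes the total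
    at most \<open>e / 2\<close>, and \<open>d \<le> e / 2\<close> accounts for the rest.\<close>
  define d where "d = min 1 (e / 2)"
  have d: "d > 0" "d \<le> 1" "d \<le> e / 2" using e by (auto simp: d_def)
  define q where "q = nat \<lceil>8 * (real n + 1) / e\<rceil>"
  have q: "8 * (real n + 1) / e \<le> real q" unfolding q_def by linarith
  have "8 * (real n + 1) / e > 0" using e by simp
  with q have q0: "q > 0" by linarith
  let ?n = "\<lambda>a. sqrt (\<Sum>j<n. (a j)\<^sup>2) :: real"
  define Gr where "Gr = {g \<in> PiE {..<n} (\<lambda>_. {- int q..int q}). \<exists>j<n. g j \<noteq> 0}"
  have "finite (PiE {..<n} (\<lambda>_. {- int q..int q}))" by (rule finite_PiE) auto
  then have Gr: "finite Gr" unfolding Gr_def by simp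
  define nv where "nv = (\<lambda>(g :: nat \<Rightarrow> int) j. of_int (g j) / ?n (\<lambda>j. of_int (g j)))"
  have pos: "?n (\<lambda>j. of_int (g j)) > 0" if g: "g \<in> Gr" for g
  proof -
    obtain j where j: "j < n" "g j \<noteq> 0" using g by (auto simp: Gr_def)
    have "0 < (real_of_int (g j))\<^sup>2" using j by simp
    also have "\<dots> \<le> (\<Sum>j<n. (real_of_int (g j))\<^sup>2)" using j by (intro member_le_sum) auto
    finally show ?thesis by simp
  qed
  have unit: "(\<Sum>j<n. (v j)\<^sup>2) = 1" if v: "v \<in> nv ` Gr" for v
  proof -
    obtain g where g: "g \<in> Gr" "v = nv g" using v by blast
    define r where "r = ?n (\<lambda>j. of_int (g j))"
    have r: "r > 0" using pos[OF g(1)] by (simp add: r_def)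
    have r2: "(\<Sum>j<n. (real_of_int (g j))\<^sup>2) = r\<^sup>2" by (simp add: r_def sum_nonneg)
    show ?thesis using r unfolding g(2) nv_def r_def[symmetric]
      by (simp add: power_divide sum_divide_distrib[symmetric] r2)
  qed
  obtain z :: "nat \<Rightarrow> 'a" where z: "\<And>v. v \<in> nv ` Gr \<Longrightarrow> \<bar>norm (\<Sum>j<n. v j *\<^sub>R z j) - 1\<bar> < d"
    using exists_almost_isometric_on_finite_set[OF inf finite_imageI[OF Gr] unit d(1), of nv] by blast
  let ?T = "\<lambda>a. \<Sum>j<n. a j *\<^sub>R z j"
  have T_scale: "?T (\<lambda>j. c * a j) = c *\<^sub>R ?T a" for c a by (simp add: scaleR_sum_right)
  have n_scale: "?n (\<lambda>j. c * a j) = \<bar>c\<bar> * ?n a" for c a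
    by (simp add: power_mult_distrib sum_distrib_left[symmetric] real_sqrt_mult)
  have grid: "\<bar>norm (?T (\<lambda>j. of_int (g j))) - ?n (\<lambda>j. of_int (g j))\<bar> \<le> d * ?n (\<lambda>j. of_int (g j))"
    if g: "\<And>j. j < n \<Longrightarrow> \<bar>g j\<bar> \<le> int q" for g
  proof (cases "\<exists>j<n. g j \<noteq> 0")
    case False
    then show ?thesis by simp
  next
    case True
    define h where "h = restrict g {..<n}"
    have h: "h \<in> Gr" using g True by (force simp: Gr_def h_def abs_le_iff)
    define r where "r = ?n (\<lambda>j. of_int (g j))"
    have hr: "?n (\<lambda>j. of_int (h j)) = r" by (simp add: h_def r_def)
    have r: "r > 0" using pos[OF h] by (simp add: hr)
    have "?T (nv h) = ?T (\<lambda>j. inverse r * of_int (g j))"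
      unfolding nv_def hr by (intro sum.cong) (auto simp: h_def divide_inverse mult.commute)
    then have "norm (?T (nv h)) = norm (?T (\<lambda>j. of_int (g j))) / r"
      unfolding T_scale using r by (simp add: divide_inverse)
    with z[of "nv h"] h have "\<bar>norm (?T (\<lambda>j. of_int (g j))) / r - 1\<bar> < d" by simp
    then show ?thesis unfolding r_def[symmetric] using r by (simp add: abs_less_iff abs_le_iff field_simps)
  qed
  have z2: "norm (z j) \<le> 2" if j: "j < n" for j
  proof -
    have "(\<Sum>i<n. of_int (if i = j then 1 else 0) *\<^sub>R z i) = (\<Sum>i<n. if i = j then z i else 0)"
      by (rule sum.cong) auto
    moreover have "(\<Sum>i<n. (real_of_int (if i = j then 1 else 0))\<^sup>2) = (\<Sum>i<n. if i = j then 1 else 0)"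
      by (rule sum.cong) auto
    moreover have "\<bar>if i = j then 1 else 0 :: int\<bar> \<le> int q" for i using q0 by simp
    ultimately show ?thesis using grid[of "\<lambda>i. if i = j then 1 else 0"] d j by (simp add: abs_le_iff)
  qed
  have unit_box: "\<bar>norm (?T a) - ?n a\<bar> \<le> e * ?n a" if a: "\<And>j. j < n \<Longrightarrow> \<bar>a j\<bar> \<le> 1" and a1: "1 \<le> ?n a" for a
  proof -
    define g where "g j = \<lfloor>q * a j\<rfloor>" for j
    define b where "b j = inverse (real q) * of_int (g j)" for j
    have "\<bar>g j\<bar> \<le> int q" if "j < n" for j
    proof -
      have "\<bar>real q * a j\<bar> \<le> real q" using a[OF that] by (simp add: abs_mult mult_left_le)
      then have "- real q \<le> real q * a j" "real q * a j \<le> real q" by linarith+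
      then show ?thesis unfolding g_def abs_le_iff by linarith
    qed
    from mult_left_mono[OF grid[OF this], where c = "inverse (real q)"]
    have bgrid: "\<bar>norm (?T b) - ?n b\<bar> \<le> d * ?n b"
      unfolding b_def T_scale n_scale using q0 by (simp add: field_simps abs_mult)
    have ab: "\<bar>a j - b j\<bar> \<le> 1 / q" for j
    proof -
      have "q * \<bar>a j - b j\<bar> = \<bar>q * (a j - b j)\<bar>" by (simp add: abs_mult)
      also have "\<dots> = \<bar>q * a j - of_int \<lfloor>q * a j\<rfloor>\<bar>" using q0 by (simp add: b_def g_def right_diff_distrib mult.assoc[symmetric])
      also have "\<dots> \<le> 1" by linarith
      finally show ?thesis using q0 by (simp add: field_simps)
    qed
    have nq: "real n / q \<le> e / 8"
    proof -
      have "8 * real n / e \<le> q" using q e by (simp add: field_simps)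
      then show ?thesis using q0 e by (simp add: field_simps)
    qed
    have "norm (?T a - ?T b) \<le> (\<Sum>j<n. norm ((a j - b j) *\<^sub>R z j))"
      unfolding sum_subtractf[symmetric] scaleR_diff_left[symmetric] by (rule norm_sum)
    also have "\<dots> \<le> (\<Sum>j<n. 1 / q * 2)"
    proof (rule sum_mono)
      fix j assume "j \<in> {..<n}"
      then show "norm ((a j - b j) *\<^sub>R z j) \<le> 1 / q * 2"
        unfolding norm_scaleR using ab z2 by (intro mult_mono) auto
    qed
    also have "\<dots> = 2 * (n / q)" by simp
    finally have T1: "\<bar>norm (?T a) - norm (?T b)\<bar> \<le> 2 * (n / q)"
      using norm_triangle_ineq3[of "?T a" "?T b"] by linarith
    have "?n (\<lambda>j. a j - b j) \<le> (\<Sum>j<n. \<bar>a j - b j\<bar>)" by (fold L2_set_def) (rule L2_set_le_sum_abs)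
    also have "\<dots> \<le> (\<Sum>j<n. 1 / q)" by (intro sum_mono ab)
    also have "\<dots> = n / q" by simp
    finally have nab: "?n (\<lambda>j. a j - b j) \<le> n / q" .
    have "?n b \<le> ?n a + ?n (\<lambda>j. a j - b j)"
      using L2_set_triangle_ineq[of a "\<lambda>j. b j - a j" "{..<n}"] by (simp add: L2_set_def power2_commute)
    moreover have "?n a \<le> ?n b + ?n (\<lambda>j. a j - b j)"
      using L2_set_triangle_ineq[of b "\<lambda>j. a j - b j" "{..<n}"] by (simp add: L2_set_def)
    ultimately have N: "\<bar>?n a - ?n b\<bar> \<le> n / q" using nab by linarith
    have "d * ?n b \<le> d * (?n a + n / q)" using N d by (intro mult_left_mono) auto
    also have "\<dots> \<le> e / 2 * ?n a + 1 * (n / q)" unfolding distrib_left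
      using d by (intro add_mono mult_right_mono) (auto simp: sum_nonneg)
    finally have "\<bar>norm (?T a) - ?n a\<bar> \<le> 4 * (n / q) + e / 2 * ?n a"
      using T1 N bgrid by linarith
    also have "\<dots> \<le> e / 2 * 1 + e / 2 * ?n a" using nq by linarith
    also have "\<dots> \<le> e / 2 * ?n a + e / 2 * ?n a" using e a1 by (intro add_right_mono mult_left_mono) auto
    finally show ?thesis by simp
  qed
  show ?thesis
  proof (intro exI[of _ z] allI)
    fix a :: "nat \<Rightarrow> real"
    show "\<bar>norm (?T a) - ?n a\<bar> \<le> e * ?n a"
    proof (cases "\<forall>j<n. a j = 0")
      case True
      then show ?thesis by simp
    next
      case False
      define m where "m = Max ((\<lambda>j. \<bar>a j\<bar>) ` {..<n})"
      have le_m: "\<bar>a j\<bar> \<le> m" if "j < n" for j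
        unfolding m_def using that by (intro Max_ge) auto
      have "{..<n} \<noteq> {}" using False by auto
      then have "m \<in> (\<lambda>j. \<bar>a j\<bar>) ` {..<n}" unfolding m_def by (intro Max_in) auto
      then obtain i where i: "i < n" "m = \<bar>a i\<bar>" by auto
      have m: "m > 0" using False le_m by (metis abs_ge_zero abs_le_zero_iff less_le order_trans)
      let ?b = "\<lambda>j. inverse m * a j"
      have "1 \<le> ?n ?b"
      proof -
        have "(?b i)\<^sup>2 \<le> (\<Sum>j<n. (?b j)\<^sup>2)" using i by (intro member_le_sum) auto
        moreover have "(?b i)\<^sup>2 = 1" using i m by (simp add: power_mult_distrib power2_eq_square abs_if split: if_splits)
        ultimately show ?thesis by simp
      qed
      moreover have "\<bar>?b j\<bar> \<le> 1" if "j < n" for j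
        using le_m[OF that] m by (simp add: abs_mult field_simps)
      ultimately have "\<bar>norm (?T ?b) - ?n ?b\<bar> \<le> e * ?n ?b" by (intro unit_box)
      then have "\<bar>norm (?T a) / m - ?n a / m\<bar> \<le> e * (?n a / m)"
        unfolding T_scale n_scale using m by (simp add: divide_inverse mult.commute)
      then show ?thesis using m by (simp add: abs_le_iff field_simps)
    qed
  qed
qed

text \<open>\<open>C\<close> may contain the zero vector: its coefficient is
  \<open>0 / 0 = 0\<close>, so the sum is still the orthogonal projection of
  \<open>a\<close>.\<close>

lemma inner_diff_orthogonal_projection:
  fixes a :: "'b::real_inner"
  assumes C: "finite C" "pairwise orthogonal C" and x: "x \<in> span C"
  shows "inner x (a - (\<Sum>c\<in>C. (inner c a / inner c c) *\<^sub>R c)) = 0"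
  using x
proof (induction rule: span_induct_alt)
  case base
  show ?case by simp
next
  case (step r c y)
  have "inner c (\<Sum>d\<in>C. (inner d a / inner d d) *\<^sub>R d) = (\<Sum>d\<in>C. if d = c then inner c a else 0)"
    unfolding inner_sum_right using C(2) step.hyps
    by (intro sum.cong) (auto simp: pairwise_def orthogonal_def inner_commute)
  also have "\<dots> = inner c a" using C(1) step.hyps by simp
  finally show ?case using step.IH by (simp add: inner_add_left inner_diff_right)
qed

text \<open>An orthogonal basis identifies the span isometrically with coordinate space. The
  coordinate formula for \<open>T\<close> makes sense everywhere, so \<open>T\<close> is linear on
  the whole space, but its distortion is controlled on the span only.\<close>

lemma exists_almost_isometric_linear_on_span:
  fixes B :: "'b::real_inner set"
  assumes inf: "\<not> (\<exists>B :: 'a::real_normed_vector set. finite B \<and> span B = UNIV)"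
    and B: "finite B" and e: "e > 0"
  shows "\<exists>T :: 'b \<Rightarrow> 'a. linear T \<and> (\<forall>x\<in>span B. \<bar>norm (T x) - norm x\<bar> \<le> e * norm x)"
proof -
  obtain C where C: "finite C" "span C = span B" "pairwise orthogonal C"
    using basis_orthogonal[OF B] by blast
  define D where "D = C - {0}"
  have D: "finite D" "pairwise orthogonal D" "span D = span B" "0 \<notin> D"
    using C by (auto simp: D_def pairwise_def)
  obtain f where f: "bij_betw f {..<card D} D"
    using ex_bij_betw_nat_finite[OF D(1)] unfolding atLeast0LessThan by blast
  define n where "n = card D"
  obtain z :: "nat \<Rightarrow> 'a" where z: "\<And>a. \<bar>norm (\<Sum>j<n. a j *\<^sub>R z j) - sqrt (\<Sum>j<n. (a j)\<^sup>2)\<bar> \<le> e * sqrt (\<Sum>j<n. (a j)\<^sup>2)"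
    using Dvoretzky[OF inf e] by blast
  define T where "T x = (\<Sum>j<n. (inner (f j) x / norm (f j)) *\<^sub>R z j)" for x
  have "linear T"
    unfolding T_def by (rule linearI) (simp_all add: inner_add_right add_divide_distrib scaleR_left_distrib sum.distrib scaleR_sum_right)
  moreover have "\<bar>norm (T x) - norm x\<bar> \<le> e * norm x" if x: "x \<in> span B" for x
  proof -
    let ?p = "\<Sum>c\<in>D. (inner c x / inner c c) *\<^sub>R c"
    have "?p \<in> span D" by (intro span_sum span_mul span_base)
    then have "x - ?p \<in> span D" using x D(3) by (intro span_diff) auto
    from inner_diff_orthogonal_projection[OF D(1,2) this, of x] have "x = ?p" by simp
    have "(norm x)\<^sup>2 = inner x ?p" using \<open>x = ?p\<close> by (simp add: power2_norm_eq_inner)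
    also have "\<dots> = (\<Sum>c\<in>D. (inner c x / norm c)\<^sup>2)"
      by (simp add: inner_sum_right power_divide power2_norm_eq_inner) (simp add: power2_eq_square inner_commute)
    also have "\<dots> = (\<Sum>j<n. (inner (f j) x / norm (f j))\<^sup>2)"
      unfolding n_def by (rule sum.reindex_bij_betw[OF f, symmetric])
    finally have "norm x = sqrt (\<Sum>j<n. (inner (f j) x / norm (f j))\<^sup>2)"
      by (metis abs_norm_cancel real_sqrt_abs)
    with z[of "\<lambda>j. inner (f j) x / norm (f j)"] show ?thesis by (simp add: T_def)
  qed
  ultimately show ?thesis by blast
qed

subsection \<open>The Poincare--Miranda theorem\<close>

lemma LIMSEQ_fun:
  fixes X :: "nat \<Rightarrow> 'i \<Rightarrow> real"
  assumes "\<And>i. (\<lambda>n. X n i) \<longlonglongrightarrow> l i"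
  shows "X \<longlonglongrightarrow> l"
proof -
  have "limitin (product_topology (\<lambda>_. euclidean) UNIV) X l sequentially"
    using assms by (auto simp: limitin_componentwise)
  then show ?thesis by (simp add: euclidean_product_topology)
qed

lemma compact_cube_fun: "compact {u :: nat \<Rightarrow> real. \<forall>i. \<bar>u i\<bar> \<le> r}"
proof -
  have "compactin (product_topology (\<lambda>_. euclidean) UNIV) (PiE UNIV (\<lambda>_ :: nat. {- r..r :: real}))"
    by (subst compactin_PiE) simp
  moreover have "{- r..r} = {t. \<bar>t\<bar> \<le> r}" by auto
  then have "PiE UNIV (\<lambda>_ :: nat. {- r..r}) = {u. \<forall>i. \<bar>u i\<bar> \<le> r}" by (auto simp: PiE_iff)
  ultimately show ?thesis by (simp add: euclidean_product_topology)
qed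

text \<open>Kuhn's combinatorial lemma yields, for each mesh, a small cube on which every component
  takes a value \<le> 0 and a value \<ge> 0; compactness and continuity turn this into a common
  zero. With sequences as points, \<open>n\<close> is an ordinary number not fixed by a
  type.\<close>

theorem Poincare_Miranda:
  fixes \<Phi> :: "(nat \<Rightarrow> real) \<Rightarrow> nat \<Rightarrow> real"
  assumes cont: "\<And>i. i < n \<Longrightarrow> continuous_on UNIV (\<lambda>u. \<Phi> u i)" and r: "r > 0"
    and lo: "\<And>u i. (\<And>j. \<bar>u j\<bar> \<le> r) \<Longrightarrow> i < n \<Longrightarrow> u i = - r \<Longrightarrow> \<Phi> u i \<le> 0"
    and hi: "\<And>u i. (\<And>j. \<bar>u j\<bar> \<le> r) \<Longrightarrow> i < n \<Longrightarrow> u i = r \<Longrightarrow> 0 \<le> \<Phi> u i"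
  obtains u where "\<And>j. \<bar>u j\<bar> \<le> r" "\<And>i. i < n \<Longrightarrow> \<Phi> u i = 0"
proof -
  define pt where "pt p x i = (if i < n then - r + 2 * r * real (x i) / real p else 0)" for p :: nat and x :: "nat \<Rightarrow> nat" and i
  have pt_cube: "\<bar>pt p x j\<bar> \<le> r" if "p > 0" "\<And>i. i < n \<Longrightarrow> x i \<le> p" for p x j
  proof (cases "j < n")
    case True
    then have "0 \<le> 2 * r * real (x j) / real p" "2 * r * real (x j) / real p \<le> 2 * r"
      using that r by (auto simp: field_simps)
    then show ?thesis using True by (simp add: pt_def)
  qed (use r in \<open>simp add: pt_def\<close>)
  define near_zero where "near_zero p q i a b \<longleftrightarrow> (\<forall>j<n. q j \<le> a j \<and> a j \<le> q j + 1) \<and>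
      (\<forall>j<n. q j \<le> b j \<and> b j \<le> q j + 1) \<and> \<Phi> (pt p a) i \<le> 0 \<and> 0 \<le> \<Phi> (pt p b) i" for p q i a b
  have approx: "\<exists>q. (\<forall>i<n. q i < p) \<and> (\<forall>i<n. \<exists>a b. near_zero p q i a b)" if p: "p > 0" for p
  proof -
    \<comment> \<open>The labels on opposite faces are imposed as Kuhn's lemma demands;
      \<open>lo\<close> and \<open>hi\<close> guarantee that they agree with a weak sign of
      \<open>\<Phi>\<close> there.\<close>
    define label where "label x i = (if x i = p then 1 else if x i = 0 \<or> \<Phi> (pt p x) i < 0 then 0 else 1 :: nat)" for x i
    have l0: "\<Phi> (pt p x) i \<le> 0" if "label x i = 0" "\<And>i. i < n \<Longrightarrow> x i \<le> p" "i < n" for x i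
    proof (cases "x i = 0")
      case True
      then have "pt p x i = - r" using that by (simp add: pt_def)
      then show ?thesis using pt_cube[OF p that(2)] that(3) by (intro lo)
    next
      case False
      then show ?thesis using that(1) by (auto simp: label_def split: if_splits)
    qed
    have l1: "0 \<le> \<Phi> (pt p x) i" if "label x i = 1" "\<And>i. i < n \<Longrightarrow> x i \<le> p" "i < n" for x i
    proof (cases "x i = p")
      case True
      then have "pt p x i = r" using that p by (simp add: pt_def)
      then show ?thesis using pt_cube[OF p that(2)] that(3) by (intro hi)
    next
      case False
      then show ?thesis using that(1) by (auto simp: label_def split: if_splits)
    qed
    have label01: "label x i = 0 \<or> label x i = 1" for x i by (simp add: label_def)
    obtain q where q: "\<forall>i<n. q i < p"
      "\<forall>i<n. \<exists>s t. (\<forall>j<n. q j \<le> s j \<and> s j \<le> q j + 1) \<and> (\<forall>j<n. q j \<le> t j \<and> t j \<le> q j + 1) \<and> label s i \<noteq> label t i"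
    proof (rule kuhn_lemma[OF p, of n label])
      show "\<forall>x. (\<forall>i<n. x i \<le> p) \<longrightarrow> (\<forall>i<n. label x i = 0 \<or> label x i = 1)"
        using label01 by blast
      show "\<forall>x. (\<forall>i<n. x i \<le> p) \<longrightarrow> (\<forall>i<n. x i = 0 \<longrightarrow> label x i = 0)"
        using p by (simp add: label_def)
      show "\<forall>x. (\<forall>i<n. x i \<le> p) \<longrightarrow> (\<forall>i<n. x i = p \<longrightarrow> label x i = 1)"
        by (simp add: label_def)
    qed (rule that)
    have "\<exists>a b. near_zero p q i a b" if i: "i < n" for i
    proof -
      obtain s t where st: "\<forall>j<n. q j \<le> s j \<and> s j \<le> q j + 1" "\<forall>j<n. q j \<le> t j \<and> t j \<le> q j + 1" "label s i \<noteq> label t i"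
        using q(2) i by blast
      have sp: "\<And>j. j < n \<Longrightarrow> s j \<le> p" "\<And>j. j < n \<Longrightarrow> t j \<le> p"
      proof -
        fix j assume "j < n"
        then show "s j \<le> p" "t j \<le> p"
          using q(1)[rule_format, of j] st(1)[rule_format, of j] st(2)[rule_format, of j] by linarith+
      qed
      consider "label s i = 0" "label t i = 1" | "label s i = 1" "label t i = 0"
        using label01[of s i] label01[of t i] st(3) by auto
      then show ?thesis
      proof cases
        case 1
        then have "near_zero p q i s t" using st(1,2) l0[OF 1(1) sp(1) i] l1[OF 1(2) sp(2) i] by (simp add: near_zero_def)
        then show ?thesis by blast
      next
        case 2
        then have "near_zero p q i t s" using st(1,2) l0[OF 2(2) sp(2) i] l1[OF 2(1) sp(1) i] by (simp add: near_zero_def)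
        then show ?thesis by blast
      qed
    qed
    with q(1) show ?thesis by blast
  qed
  have "\<forall>p. \<exists>q. (\<forall>i<n. q i < Suc p) \<and> (\<forall>i<n. \<exists>a b. near_zero (Suc p) q i a b)"
    using approx by simp
  then obtain q where "\<forall>p. (\<forall>i<n. q p i < Suc p) \<and> (\<forall>i<n. \<exists>a b. near_zero (Suc p) (q p) i a b)"
    by (rule exE[OF choice])
  then have q: "q p i < Suc p" and ex: "\<exists>a b. near_zero (Suc p) (q p) i a b" if "i < n" for p i
    using that by simp_all
  define a where "a p i = (SOME a. \<exists>b. near_zero (Suc p) (q p) i a b)" for p i
  define b where "b p i = (SOME b. near_zero (Suc p) (q p) i (a p i) b)" for p i
  have ab: "near_zero (Suc p) (q p) i (a p i) (b p i)" if "i < n" for p i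
    unfolding b_def a_def by (rule someI_ex[OF someI_ex[OF ex[OF that]]])
  have a: "\<And>p i j. i < n \<Longrightarrow> j < n \<Longrightarrow> q p j \<le> a p i j \<and> a p i j \<le> q p j + 1"
    and b: "\<And>p i j. i < n \<Longrightarrow> j < n \<Longrightarrow> q p j \<le> b p i j \<and> b p i j \<le> q p j + 1"
    and \<Phi>a: "\<And>p i. i < n \<Longrightarrow> \<Phi> (pt (Suc p) (a p i)) i \<le> 0" and \<Phi>b: "\<And>p i. i < n \<Longrightarrow> 0 \<le> \<Phi> (pt (Suc p) (b p i)) i"
    using ab unfolding near_zero_def by blast+
  define u where "u p = pt (Suc p) (q p)" for p
  have "u p \<in> {u. \<forall>i. \<bar>u i\<bar> \<le> r}" for p
    unfolding u_def mem_Collect_eq by (intro allI pt_cube) (simp_all add: q less_imp_le)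
  moreover have "seq_compact {u :: nat \<Rightarrow> real. \<forall>i. \<bar>u i\<bar> \<le> r}"
    using compact_cube_fun by (simp add: compact_eq_seq_compact_metric)
  ultimately obtain v \<sigma> where v: "v \<in> {u. \<forall>i. \<bar>u i\<bar> \<le> r}" "strict_mono \<sigma>" "(u \<circ> \<sigma>) \<longlonglongrightarrow> v"
    unfolding seq_compact_def by metis
  have vi: "(\<lambda>m. u (\<sigma> m) i) \<longlonglongrightarrow> v i" for i
    using continuous_on_tendsto_compose[OF continuous_on_product_coordinates v(3)] by (simp add: comp_def)
  \<comment> \<open>Each coordinate of a point of the small cube differs from that of its corner
    \<open>u p\<close> by at most one mesh width, so every choice of points has the same limit
    \<open>v\<close>.\<close>
  have near: "(\<lambda>m. pt (Suc (\<sigma> m)) (c (\<sigma> m))) \<longlonglongrightarrow> v" if c: "\<And>p j. j < n \<Longrightarrow> q p j \<le> c p j \<and> c p j \<le> q p j + 1" for c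
  proof (rule LIMSEQ_fun)
    fix j
    have bd: "\<bar>pt (Suc p) (c p) j - u p j\<bar> \<le> 2 * r * (1 / real (Suc p))" for p
    proof (cases "j < n")
      case True
      define t where "t = (real (c p j) - real (q p j)) / real (Suc p)"
      have "pt (Suc p) (c p) j - u p j = 2 * r * t"
        using True by (simp add: pt_def u_def t_def diff_divide_distrib right_diff_distrib)
      moreover have "\<bar>t\<bar> \<le> 1 / real (Suc p)"
        unfolding t_def using c[OF True, of p] by (auto simp: abs_le_iff divide_le_cancel field_simps)
      moreover have "\<bar>2 * r * t\<bar> = 2 * r * \<bar>t\<bar>" using r by (simp add: abs_mult)
      ultimately show ?thesis using r by (simp only:) (intro mult_left_mono, auto)
    next
      case False
      then show ?thesis using r by (simp add: pt_def u_def)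
    qed
    have "(\<lambda>p. pt (Suc p) (c p) j - u p j) \<longlonglongrightarrow> 0"
    proof (rule Lim_null_comparison)
      show "(\<lambda>p. 2 * r * (1 / real (Suc p))) \<longlonglongrightarrow> 0"
        using tendsto_mult_right[OF LIMSEQ_inverse_real_of_nat, of "2 * r"] by (simp add: inverse_eq_divide)
    qed (use bd in \<open>auto intro!: always_eventually\<close>)
    then have "(\<lambda>m. pt (Suc (\<sigma> m)) (c (\<sigma> m)) j - u (\<sigma> m) j) \<longlonglongrightarrow> 0"
      using LIMSEQ_subseq_LIMSEQ[OF _ v(2)] by (fastforce simp: comp_def)
    from tendsto_add[OF this vi[of j]] show "(\<lambda>m. pt (Suc (\<sigma> m)) (c (\<sigma> m)) j) \<longlonglongrightarrow> v j" by simp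
  qed
  have lim: "(\<lambda>m. \<Phi> (pt (Suc (\<sigma> m)) (c (\<sigma> m))) i) \<longlonglongrightarrow> \<Phi> v i"
    if "\<And>p j. j < n \<Longrightarrow> q p j \<le> c p j \<and> c p j \<le> q p j + 1" "i < n" for c i
    using continuous_on_tendsto_compose[OF cont[OF that(2)] near[OF that(1)]] by simp
  have "\<Phi> v i = 0" if i: "i < n" for i
  proof (rule antisym)
    show "\<Phi> v i \<le> 0"
      by (rule LIMSEQ_le_const2[OF lim[of "\<lambda>p. a p i"]]) (use a \<Phi>a i in auto)
    show "0 \<le> \<Phi> v i"
      by (rule LIMSEQ_le_const[OF lim[of "\<lambda>p. b p i"]]) (use b \<Phi>b i in auto)
  qed
  then show ?thesis using v(1) that by blast
qed

subsection \<open>Perturbing distances of affinely independent points\<close>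

text \<open>Affine independence keeps \<open>i\<close> off the affine hull of the other points. The
  component of \<open>i - a\<close> orthogonal to that hull has the same nonzero inner product with
  all \<open>i - j\<close>, and rescaling makes it 1.\<close>

lemma exists_dual_vector:
  fixes Y :: "'b::real_inner set"
  assumes Y: "finite Y" "\<not> affine_dependent Y" and i: "i \<in> Y"
  shows "\<exists>f. \<forall>j\<in>Y - {i}. inner f (i - j) = 1"
proof (cases "Y - {i} = {}")
  case True
  then show ?thesis by blast
next
  case False
  then obtain a where a: "a \<in> Y - {i}" by blast
  let ?D = "(\<lambda>x. - a + x) ` (Y - {i})"
  obtain C where C: "finite C" "span C = span ?D" "pairwise orthogonal C"
    using basis_orthogonal[of ?D] Y(1) by auto
  have "i \<notin> affine hull (Y - {i})" using Y(2) i by (auto simp: affine_dependent_def)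
  then have out: "i - a \<notin> span C"
    unfolding C(2) affine_hull_span_gen[OF hull_inc[OF a]] by force
  define p where "p = (\<Sum>c\<in>C. (inner c (i - a) / inner c c) *\<^sub>R c)"
  define r where "r = i - a - p"
  have p: "p \<in> span C" unfolding p_def by (intro span_sum span_mul span_base)
  have orth: "inner x r = 0" if "x \<in> span C" for x
    unfolding r_def p_def by (rule inner_diff_orthogonal_projection[OF C(1,3) that])
  have r: "inner r r \<noteq> 0" using p out by (auto simp: r_def)
  show ?thesis
  proof (intro exI[of _ "r /\<^sub>R inner r r"] ballI)
    fix j assume j: "j \<in> Y - {i}"
    have "j - a \<in> span C" unfolding C(2) using j by (intro span_base) force
    then have "inner r (j - a) = 0" by (subst inner_commute) (rule orth)
    moreover have "inner r (i - a) = inner r r"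
    proof -
      have "i - a = r + p" by (simp add: r_def)
      moreover have "inner r p = 0" by (subst inner_commute) (rule orth[OF p])
      ultimately show ?thesis by (simp only: inner_add_right add_0_right)
    qed
    moreover have "i - j = (i - a) - (j - a)" by simp
    ultimately have "inner r (i - j) = inner r r" by (simp only: inner_diff_right)
    then show "inner (r /\<^sub>R inner r r) (i - j) = 1" using r by simp
  qed
qed

lemma sum_dual_shift:
  fixes u :: "'b \<Rightarrow> real" and w :: "'b \<Rightarrow> 'c::real_vector"
  assumes "finite Y" "a \<in> Y" "b \<in> Y" "a \<noteq> b"
  shows "(\<Sum>c\<in>Y - {a}. u c * (of_bool (c = a) - of_bool (c = b))) = - u b"
proof -
  have "(\<Sum>c\<in>Y - {a}. u c * (of_bool (c = a) - of_bool (c = b))) = (\<Sum>c\<in>Y - {a}. if c = b then - u b else 0)"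
    by (rule sum.cong) auto
  then show ?thesis using assms by simp
qed

text \<open>Because \<open>\<phi>\<close> is dual to the differences of points of \<open>Y\<close>, the inner product of \<open>a - b\<close> with the difference of
  the two displacements is \<open>U a b / 2\<close>, so the squared distances change by \<open>U a b\<close> to first order.\<close>
lemma norm_power2_perturbed_diff:
  fixes \<phi> :: "'b::real_inner \<Rightarrow> 'b" and U :: "'b \<Rightarrow> 'b \<Rightarrow> real"
  assumes Y: "finite Y" and dual: "\<And>i j. i \<in> Y \<Longrightarrow> j \<in> Y \<Longrightarrow> i \<noteq> j \<Longrightarrow> inner (\<phi> i) (i - j) = 1"
    and sym: "\<And>a b. U a b = U b a" and U: "\<And>a b. \<bar>U a b\<bar> \<le> r"
    and K: "K = 2 * (\<Sum>c\<in>Y. norm (\<phi> c))" and a: "a \<in> Y" and b: "b \<in> Y" and ab: "a \<noteq> b"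
  defines "p \<equiv> \<lambda>a. a - (1/4) *\<^sub>R (\<Sum>c\<in>Y - {a}. U a c *\<^sub>R \<phi> c)"
  shows "(norm (a - b))\<^sup>2 + U a b \<le> (norm (p a - p b))\<^sup>2"
    "(norm (p a - p b))\<^sup>2 \<le> (norm (a - b))\<^sup>2 + U a b + r\<^sup>2 * K\<^sup>2 / 16"
proof -
  have r: "r \<ge> 0" using U[of a b] by linarith
  \<comment> \<open>\<open>w\<close> has inner product \<open>- 2 * U a b\<close> with
    \<open>a - b\<close>, so subtracting a quarter of \<open>w\<close> changes the squared norm by
    \<open>U a b\<close> plus the remainder \<open>(norm w)^2 / 16\<close>. Its nonnegativity is why
    the lower bound carries no error.\<close>
  define w where "w = (\<Sum>c\<in>Y - {a}. U a c *\<^sub>R \<phi> c) - (\<Sum>c\<in>Y - {b}. U b c *\<^sub>R \<phi> c)"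
  have p: "p a - p b = (a - b) - (1/4) *\<^sub>R w" by (simp add: p_def w_def scaleR_diff_right)
  have \<phi>: "inner (a - b) (\<phi> c) = of_bool (c = a) - of_bool (c = b)" if c: "c \<in> Y" for c
  proof -
    consider "c = a" | "c = b" | "c \<noteq> a" "c \<noteq> b" by blast
    then show ?thesis
    proof cases
      case 1 then show ?thesis using dual[OF a b ab] ab by (simp add: inner_commute)
    next
      case 2
      have "inner (a - b) (\<phi> b) = - inner (\<phi> b) (b - a)"
        by (simp add: inner_commute[of _ "\<phi> b"] inner_diff_right)
      then show ?thesis using 2 dual[OF b a] ab by simp
    next
      case 3
      have "inner (a - b) (\<phi> c) = inner (\<phi> c) (c - b) - inner (\<phi> c) (c - a)"
        by (simp add: inner_commute[of _ "\<phi> c"] inner_diff_right)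
      then show ?thesis using 3 dual[OF c a] dual[OF c b] by simp
    qed
  qed
  have "inner (a - b) w = (\<Sum>c\<in>Y - {a}. U a c * (of_bool (c = a) - of_bool (c = b)))
      - (\<Sum>c\<in>Y - {b}. U b c * (of_bool (c = a) - of_bool (c = b)))"
    by (simp add: w_def inner_diff_right inner_sum_right \<phi>)
  also have "(\<Sum>c\<in>Y - {a}. U a c * (of_bool (c = a) - of_bool (c = b))) = - U a b"
    by (rule sum_dual_shift[OF Y a b ab])
  also have "(\<Sum>c\<in>Y - {b}. U b c * (of_bool (c = a) - of_bool (c = b)))
      = - (\<Sum>c\<in>Y - {b}. U b c * (of_bool (c = b) - of_bool (c = a)))"
    unfolding sum_negf[symmetric] by (rule sum.cong) (auto simp: algebra_simps)
  also have "\<dots> = U b a" using sum_dual_shift[OF Y b a, of "U b"] ab by simp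
  finally have inner: "inner (a - b) w = - 2 * U a b" using sym[of a b] by simp
  have e: "(norm (p a - p b))\<^sup>2 = (norm (a - b))\<^sup>2 + U a b + (norm w)\<^sup>2 / 16"
    unfolding p power2_norm_eq_inner
    using inner by (simp add: inner_diff_left inner_diff_right inner_commute algebra_simps)
  have part: "norm (\<Sum>c\<in>Y - {a}. U a c *\<^sub>R \<phi> c) \<le> r * (\<Sum>c\<in>Y. norm (\<phi> c))" for a
  proof -
    have "norm (\<Sum>c\<in>Y - {a}. U a c *\<^sub>R \<phi> c) \<le> (\<Sum>c\<in>Y - {a}. norm (U a c *\<^sub>R \<phi> c))" by (rule norm_sum)
    also have "\<dots> \<le> (\<Sum>c\<in>Y. norm (U a c *\<^sub>R \<phi> c))" using Y by (intro sum_mono2) auto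
    also have "\<dots> \<le> (\<Sum>c\<in>Y. r * norm (\<phi> c))" using U by (intro sum_mono) (simp add: mult_right_mono)
    finally show ?thesis by (simp add: sum_distrib_left)
  qed
  have "norm w \<le> r * K" unfolding w_def K
    using norm_triangle_ineq4[of "\<Sum>c\<in>Y - {a}. U a c *\<^sub>R \<phi> c" "\<Sum>c\<in>Y - {b}. U b c *\<^sub>R \<phi> c"] part[of a] part[of b]
    by simp
  then have "(norm w)\<^sup>2 \<le> (r * K)\<^sup>2" by (intro power_mono) auto
  then show "(norm (a - b))\<^sup>2 + U a b \<le> (norm (p a - p b))\<^sup>2"
    "(norm (p a - p b))\<^sup>2 \<le> (norm (a - b))\<^sup>2 + U a b + r\<^sup>2 * K\<^sup>2 / 16"
    unfolding e by (simp_all add: power_mult_distrib)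
qed

theorem exists_isometric_copy_of_affine_independent:
  fixes Y :: "'b::real_inner set"
  assumes inf: "\<not> (\<exists>B :: 'a::real_normed_vector set. finite B \<and> span B = UNIV)"
    and Y: "finite Y" "\<not> affine_dependent Y"
  shows "\<exists>f :: 'b \<Rightarrow> 'a. \<forall>y\<in>Y. \<forall>y'\<in>Y. norm (f y - f y') = norm (y - y')"
proof -
  obtain \<phi> where \<phi>: "\<And>i j. i \<in> Y \<Longrightarrow> j \<in> Y \<Longrightarrow> i \<noteq> j \<Longrightarrow> inner (\<phi> i) (i - j) = 1"
    using exists_dual_vector[OF Y] by (metis (no_types, lifting) Diff_iff empty_iff insert_iff)
  define K where "K = 2 * (\<Sum>c\<in>Y. norm (\<phi> c))"
  define D where "D = (\<Sum>a\<in>Y. \<Sum>b\<in>Y. (norm (a - b))\<^sup>2)"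
  have D: "(norm (a - b))\<^sup>2 \<le> D" if "a \<in> Y" "b \<in> Y" for a b
  proof -
    have "(norm (a - b))\<^sup>2 \<le> (\<Sum>b\<in>Y. (norm (a - b))\<^sup>2)" using that Y by (intro member_le_sum) auto
    also have "\<dots> \<le> D" unfolding D_def using that Y by (intro member_le_sum[of a Y "\<lambda>a. \<Sum>b\<in>Y. (norm (a - b))\<^sup>2"]) (auto intro: sum_nonneg)
    finally show ?thesis .
  qed
  have D0: "D \<ge> 0" by (simp add: D_def sum_nonneg)
  define r where "r = 1 / (1 + K\<^sup>2)"
  have r: "r > 0" "r \<le> 1" by (simp_all add: r_def add_pos_nonneg)
  have rK: "r\<^sup>2 * K\<^sup>2 / 16 \<le> r / 2"
  proof -
    have "r * K\<^sup>2 \<le> 1" by (simp add: r_def add_pos_nonneg)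
    then have "r * (r * K\<^sup>2) \<le> r * 1" using r by (intro mult_left_mono) auto
    moreover have "r\<^sup>2 * K\<^sup>2 = r * (r * K\<^sup>2)" by (simp add: power2_eq_square)
    ultimately show ?thesis using r by linarith
  qed
  \<comment> \<open>Perturbed squared distances stay below \<open>D + 2\<close>, and there
    \<open>T\<close> changes them by at most \<open>3 * e * (D + 2) = r / 2\<close>.\<close>
  define e where "e = r / (6 * (D + 2))"
  have e: "e > 0" "e \<le> 1" "3 * e * (D + 2) = r / 2"
    using r D0 by (auto simp: e_def field_simps)
  obtain T :: "'b \<Rightarrow> 'a" where T: "linear T"
    and iso: "\<And>x. x \<in> span (Y \<union> \<phi> ` Y) \<Longrightarrow> \<bar>norm (T x) - norm x\<bar> \<le> e * norm x"
    using exists_almost_isometric_linear_on_span[OF inf, of "Y \<union> \<phi> ` Y" e] Y(1) e(1) by auto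
  have iso2: "\<bar>(norm (T x))\<^sup>2 - (norm x)\<^sup>2\<bar> \<le> r / 2" if x: "x \<in> span (Y \<union> \<phi> ` Y)" and xD: "(norm x)\<^sup>2 \<le> D + 2" for x
  proof -
    have "norm (T x) + norm x \<le> 3 * norm x" using iso[OF x] e(2) mult_right_mono[OF e(2), of "norm x"] by (simp add: abs_le_iff)
    then have "\<bar>norm (T x) - norm x\<bar> * (norm (T x) + norm x) \<le> (e * norm x) * (3 * norm x)"
      using iso[OF x] e by (intro mult_mono) auto
    also have "\<dots> = 3 * e * (norm x)\<^sup>2" by (simp add: power2_eq_square)
    also have "\<dots> \<le> 3 * e * (D + 2)" using xD e by (intro mult_left_mono) auto
    finally have "\<bar>(norm (T x) - norm x) * (norm (T x) + norm x)\<bar> \<le> r / 2" using e by (simp add: abs_mult)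
    then show ?thesis by (simp add: power2_eq_square algebra_simps)
  qed
  \<comment> \<open>Indexing the parameters by unordered pairs makes \<open>U\<close> symmetric, so
    the displacements of both endpoints contribute equally.\<close>
  define E where "E = {{a, b} | a b. a \<in> Y \<and> b \<in> Y \<and> a \<noteq> b}"
  have "E \<subseteq> Pow Y" by (auto simp: E_def)
  then have fE: "finite E" by (rule finite_subset) (simp add: Y(1))
  define n where "n = card E"
  obtain idx where idx: "bij_betw idx E {..<n}"
    using ex_bij_betw_finite_nat[OF fE] unfolding n_def atLeast0LessThan by blast
  define U where "U u a b = u (idx {a, b})" for u :: "nat \<Rightarrow> real" and a b :: 'b
  define p where "p u = (\<lambda>a. a - (1/4) *\<^sub>R (\<Sum>c\<in>Y - {a}. U u a c *\<^sub>R \<phi> c))" for u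
  define \<Psi> where "\<Psi> u a b = (norm (T (p u a) - T (p u b)))\<^sup>2 - (norm (a - b))\<^sup>2" for u a b
  \<comment> \<open>\<open>ends\<close> fixes an orientation of each pair; any will do, since
    \<open>\<Psi>\<close> is symmetric in the two points.\<close>
  define ends where "ends i = (SOME (a, b). a \<in> Y \<and> b \<in> Y \<and> a \<noteq> b \<and> idx {a, b} = i)" for i
  have ends: "fst (ends i) \<in> Y \<and> snd (ends i) \<in> Y \<and> fst (ends i) \<noteq> snd (ends i) \<and> idx {fst (ends i), snd (ends i)} = i"
    if i: "i < n" for i
  proof -
    have "i \<in> idx ` E" using idx i by (simp add: bij_betw_def)
    then obtain a b where "a \<in> Y" "b \<in> Y" "a \<noteq> b" "idx {a, b} = i" by (auto simp: E_def)
    then have "case (a, b) of (a, b) \<Rightarrow> a \<in> Y \<and> b \<in> Y \<and> a \<noteq> b \<and> idx {a, b} = i" by simp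
    then have "case ends i of (a, b) \<Rightarrow> a \<in> Y \<and> b \<in> Y \<and> a \<noteq> b \<and> idx {a, b} = i"
      unfolding ends_def by (rule someI)
    then show ?thesis by (simp add: split_beta)
  qed
  define \<Phi> where "\<Phi> u i = \<Psi> u (fst (ends i)) (snd (ends i))" for u i
  have pspan: "p u a \<in> span (Y \<union> \<phi> ` Y)" if "a \<in> Y" for u a
    unfolding p_def using that by (intro span_diff span_mul span_sum span_base) auto
  have key: "(norm (a - b))\<^sup>2 + U u a b - r / 2 \<le> (norm (T (p u a) - T (p u b)))\<^sup>2"
    "(norm (T (p u a) - T (p u b)))\<^sup>2 \<le> (norm (a - b))\<^sup>2 + U u a b + r"
    if u: "\<And>j. \<bar>u j\<bar> \<le> r" and ab: "a \<in> Y" "b \<in> Y" "a \<noteq> b" for u a b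
  proof -
    have *: "(norm (a - b))\<^sup>2 + U u a b \<le> (norm (p u a - p u b))\<^sup>2"
      unfolding p_def by (rule norm_power2_perturbed_diff(1)[where r = r, OF Y(1) _ _ _ K_def ab])
        (simp_all add: \<phi> u U_def insert_commute)
    have **: "(norm (p u a - p u b))\<^sup>2 \<le> (norm (a - b))\<^sup>2 + U u a b + r\<^sup>2 * K\<^sup>2 / 16"
      unfolding p_def by (rule norm_power2_perturbed_diff(2)[OF Y(1) _ _ _ K_def ab])
        (simp_all add: \<phi> u U_def insert_commute)
    have "U u a b \<le> r" using u by (simp add: U_def abs_le_iff)
    then have "(norm (p u a - p u b))\<^sup>2 \<le> D + 2" using ** rK r D[OF ab(1,2)] by linarith
    from iso2[OF span_diff[OF pspan pspan] this] ab
    have "\<bar>(norm (T (p u a) - T (p u b)))\<^sup>2 - (norm (p u a - p u b))\<^sup>2\<bar> \<le> r / 2"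
      by (simp add: linear_diff[OF T])
    with * ** rK show "(norm (a - b))\<^sup>2 + U u a b - r / 2 \<le> (norm (T (p u a) - T (p u b)))\<^sup>2"
      "(norm (T (p u a) - T (p u b)))\<^sup>2 \<le> (norm (a - b))\<^sup>2 + U u a b + r" by linarith+
  qed
  obtain u where u: "\<And>j. \<bar>u j\<bar> \<le> r" "\<And>i. i < n \<Longrightarrow> \<Phi> u i = 0"
  proof (rule Poincare_Miranda[OF _ r(1), of n \<Phi>])
    fix i
    \<comment> \<open>This is a finite combination of fixed vectors with coordinates of
      \<open>u\<close> as coefficients, so continuity in \<open>u\<close> comes from the coordinates
      alone.\<close>
    have Tp: "T (p u a) = T a - (1/4) *\<^sub>R (\<Sum>c\<in>Y - {a}. U u a c *\<^sub>R T (\<phi> c))" for u a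
      by (simp add: p_def linear_diff[OF T] linear_scale[OF T] linear_sum[OF T])
    show "continuous_on UNIV (\<lambda>u. \<Phi> u i)"
      unfolding \<Phi>_def \<Psi>_def Tp U_def by (intro continuous_intros continuous_on_product_coordinates)
  next
    fix u :: "nat \<Rightarrow> real" and i assume *: "\<And>j. \<bar>u j\<bar> \<le> r" "i < n" "u i = - r"
    then show "\<Phi> u i \<le> 0"
      using key(2)[of u "fst (ends i)" "snd (ends i)", OF *(1)] ends[OF *(2)] by (simp add: \<Phi>_def \<Psi>_def U_def)
  next
    fix u :: "nat \<Rightarrow> real" and i assume *: "\<And>j. \<bar>u j\<bar> \<le> r" "i < n" "u i = r"
    have "U u (fst (ends i)) (snd (ends i)) = r" using ends[OF *(2)] *(3) by (simp add: U_def)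
    then show "0 \<le> \<Phi> u i"
      using key(1)[of u "fst (ends i)" "snd (ends i)", OF *(1)] ends[OF *(2)] r unfolding \<Phi>_def \<Psi>_def by linarith
  qed (rule that)
  show ?thesis
  proof (intro exI[of _ "\<lambda>y. T (p u y)"] ballI)
    fix a b assume ab: "a \<in> Y" "b \<in> Y"
    show "norm (T (p u a) - T (p u b)) = norm (a - b)"
    proof (cases "a = b")
      case False
      let ?i = "idx {a, b}"
      have E: "{a, b} \<in> E" using ab False by (auto simp: E_def)
      then have i: "?i < n" using bij_betwE[OF idx] by blast
      obtain c d where cd: "ends ?i = (c, d)" by fastforce
      have "{c, d} \<in> E" "idx {c, d} = ?i" using ends[OF i] cd by (auto simp: E_def)
      then have "{c, d} = {a, b}" by (intro inj_onD[OF bij_betw_imp_inj_on[OF idx]] E)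
      moreover have "\<Psi> u c d = 0" using u(2)[OF i] cd by (simp add: \<Phi>_def)
      ultimately have "\<Psi> u a b = 0" by (auto simp: \<Psi>_def doubleton_eq_iff norm_minus_commute)
      then show ?thesis by (simp add: \<Psi>_def)
    qed simp
  qed
qed

theorem theorem1p3:
  fixes Y :: "ell2 set"
  assumes "\<not> (\<exists>B :: 'a::banach set. finite B \<and> span B = UNIV)"
    and "finite Y"
    and "\<not> affine_dependent Y"
  shows "\<exists>f :: ell2 \<Rightarrow> 'a. \<forall>y\<in>Y. \<forall>y'\<in>Y. norm (f y - f y') = norm (y - y')"
  using assms by (rule exists_isometric_copy_of_affine_independent)

end
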